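(* Let $R=\mathbb{C}[x,y,z]$, let $\mathfrak m=(x,y,z)$, let $\ell\in R_1\smallsetminus\{0\}$ be a nonzero linear form, let $L\subset R_1$ be a $2$-dimensional linear subspace with $R_1=\langle \ell\rangle\oplus L$, and for $v\in(\operatorname{Sym}^3(L)+\ell\cdot L)\smallsetminus\{0\}$ consider the ideal \[ I=\big((\ell)+\mathfrak m^2\big)^2+(v)\subset R . \] Then, for every such $v$, $\dim_{\mathbb{C}} R/I=12$; and, for a general choice of $v$, \[ \dim_{\mathbb{C}}\mathsf T_{[I]}\operatorname{Hilb}^{12}\mathbb{A}^3=45 . \]
   Context: $R_k$ denotes the space of homogeneous polynomials of degree $k$ in $R=\mathbb{C}[x,y,z]$ (together with $0$). $\operatorname{Sym}^3(L)\subset R_3$ is the span of all products of three elements of $L$, and $\ell\cdot L=\{\ell m: m\in L\}\subset R_2$; so $\operatorname{Sym}^3(L)+\ell\cdot L$ is a $6$-dimensional subspace of $R$ and $v$ need not be homogeneous. "For a general choice of $v$" means for all $v$ in some nonempty Zariski open subset of $(\operatorname{Sym}^3(L)+\ell\cdot L)\smallsetminus\{0\}$. $\operatorname{Hilb}^{d}\mathbb{A}^3$ is the Hilbert scheme of length-$d$ zero-dimensional closed subschemes of $\mathbb{A}^3=\mathbb{A}^3_{\mathbb{C}}$; the point corresponding to an ideal $I$ is written $[I]$, and $\mathsf T_{[I]}\operatorname{Hilb}^{d}\mathbb{A}^3$ is its Zariski tangent space, which is canonically isomorphic to $\operatorname{Hom}_R(I,R/I)$. *)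

theory Defs
  imports
    "HOL-Library.Poly_Mapping"
    "HOL-Library.Product_Plus"
    "HOL-Algebra.Ideal_Product"
    "HOL-Algebra.QuotRing"
    "Jordan_Normal_Form.VS_Connect"
begin

section \<open>Polynomials in three variables\<close>

text \<open>The exponent \<open>(a, b, c)\<close> stands for the monomial \<open>x^a y^b z^c\<close>.\<close>

type_synonym 'a poly3 = "(nat \<times> nat \<times> nat) \<Rightarrow>\<^sub>0 'a"

abbreviation poly_ring :: "'a::comm_ring_1 poly3 ring" where
  "poly_ring \<equiv> class_ring"

definition const :: "'a::comm_ring_1 \<Rightarrow> 'a poly3" where
  "const c = Poly_Mapping.single 0 c"

definition varX :: "'a::comm_ring_1 poly3" where
  "varX = Poly_Mapping.single (1, 0, 0) 1"

definition varY :: "'a::comm_ring_1 poly3" where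
  "varY = Poly_Mapping.single (0, 1, 0) 1"

definition varZ :: "'a::comm_ring_1 poly3" where
  "varZ = Poly_Mapping.single (0, 0, 1) 1"

definition homogeneous :: "nat \<Rightarrow> complex poly3 set" where
  "homogeneous k = {p. \<forall>(a, b, c) \<in> Poly_Mapping.keys p. a + b + c = k}"

definition scale :: "complex \<Rightarrow> complex poly3 \<Rightarrow> complex poly3" where
  "scale c p = const c * p"

global_interpretation cpoly: Vector_Spaces.vector_space scale
proof
  fix a b :: complex and p q :: "complex poly3"
  show "scale a (p + q) = scale a p + scale a q" by (simp add: scale_def distrib_left)
  show "scale (a + b) p = scale a p + scale b p"
    by (simp add: scale_def const_def single_add distrib_right)
  show "scale a (scale b p) = scale (a * b) p"
    by (simp add: scale_def const_def mult_single flip: mult.assoc)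
  show "scale 1 p = p" by (simp add: scale_def const_def)
qed

section \<open>Linear algebra over the complex numbers\<close>

definition has_dimension :: "(complex, 'v) module \<Rightarrow> nat \<Rightarrow> bool" where
  "has_dimension V n \<longleftrightarrow>
     vectorspace class_ring V \<and>
     vectorspace.fin_dim class_ring V \<and>
     vectorspace.dim class_ring V = n"

definition quot_module :: "'a::comm_ring_1 poly3 set \<Rightarrow> ('a, 'a poly3 set) module" where
  "quot_module J =
     \<lparr>carrier = carrier (poly_ring Quot J),
      mult = mult (poly_ring Quot J),
      one = one (poly_ring Quot J),
      zero = zero (poly_ring Quot J),
      add = add (poly_ring Quot J),
      smult = (\<lambda>c X. (J +>\<^bsub>poly_ring\<^esub> const c) \<otimes>\<^bsub>poly_ring Quot J\<^esub> X)\<rparr>"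

definition free_of_rank :: "('a::comm_ring_1, 'v) module \<Rightarrow> nat \<Rightarrow> bool" where
  "free_of_rank M d \<longleftrightarrow>
     Module.module class_ring M \<and>
     (\<exists>B \<subseteq> carrier M. finite B \<and> card B = d \<and>
        \<not> LinearCombinations.module.lin_dep class_ring M B \<and>
        LinearCombinations.module.span class_ring M B = carrier M)"

section \<open>The Hilbert functor of affine 3-space and its tangent spaces\<close>

text \<open>
  The Hilbert scheme of \<open>d\<close> points on affine 3-space represents the functor that sends a
  \<open>\<complex>\<close>-algebra \<open>A\<close> to the set of closed subschemes of the affine 3-space over \<open>A\<close> which are finite
  and locally free of rank \<open>d\<close> over \<open>A\<close>, that is, to the set of ideals \<open>J\<close> of \<open>A[x,y,z]\<close> with
  \<open>A[x,y,z]/J\<close> locally free of rank \<open>d\<close>. The functor is used here only for local rings \<open>A\<close>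
  (\<open>\<complex>\<close>, \<open>dual\<close> and \<open>dual2\<close> below), over which locally free means free.
\<close>

definition hilb :: "nat \<Rightarrow> 'a::comm_ring_1 poly3 set set" where
  "hilb d = {J. ideal J poly_ring \<and> free_of_rank (quot_module J) d}"

text \<open>Functoriality along a ring homomorphism \<open>\<phi>\<close>: the extension of \<open>J\<close> along the map induced by
  \<open>\<phi>\<close> on coefficients.\<close>

definition base_change ::
    "('a::comm_ring_1 \<Rightarrow> 'b::comm_ring_1) \<Rightarrow> 'a poly3 set \<Rightarrow> 'b poly3 set" where
  "base_change \<phi> J = Idl\<^bsub>poly_ring\<^esub> (Poly_Mapping.map \<phi> ` J)"

text \<open>\<open>Dual a b\<close> is the dual number \<open>a + b \<epsilon>\<close>, with \<open>\<epsilon>^2 = 0\<close>.\<close>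

datatype dual = Dual complex complex

instantiation dual :: comm_ring_1
begin

definition "0 = Dual 0 0"
definition "1 = Dual 1 0"
fun plus_dual where "Dual a b + Dual a' b' = Dual (a + a') (b + b')"
fun minus_dual where "Dual a b - Dual a' b' = Dual (a - a') (b - b')"
fun uminus_dual where "- Dual a b = Dual (- a) (- b)"
fun times_dual where "Dual a b * Dual a' b' = Dual (a * a') (a * b' + b * a')"

instance
proof
  fix u v w :: dual
  show "u * v * w = u * (v * w)" by (cases u; cases v; cases w) (simp add: algebra_simps)
  show "u * v = v * u" by (cases u; cases v) (simp add: algebra_simps)
  show "1 * u = u" by (cases u) (simp add: one_dual_def)
  show "u + v + w = u + (v + w)" by (cases u; cases v; cases w) (simp add: algebra_simps)
  show "u + v = v + u" by (cases u; cases v) (simp add: algebra_simps)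
  show "0 + u = u" by (cases u) (simp add: zero_dual_def)
  show "- u + u = 0" by (cases u) (simp add: zero_dual_def)
  show "u - v = u + - v" by (cases u; cases v) simp
  show "(u + v) * w = u * w + v * w" by (cases u; cases v; cases w) (simp add: algebra_simps)
  show "(0::dual) \<noteq> 1" by (simp add: zero_dual_def one_dual_def)
qed

end

text \<open>\<open>Dual2 a b c\<close> is the element \<open>a + b \<epsilon>1 + c \<epsilon>2\<close> of \<open>\<complex>[\<epsilon>1,\<epsilon>2]/(\<epsilon>1,\<epsilon>2)^2\<close>, which is the fibre
  product of two copies of the dual numbers over \<open>\<complex>\<close>.\<close>

datatype dual2 = Dual2 complex complex complex

instantiation dual2 :: comm_ring_1
begin

definition "0 = Dual2 0 0 0"
definition "1 = Dual2 1 0 0"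
fun plus_dual2 where "Dual2 a b c + Dual2 a' b' c' = Dual2 (a + a') (b + b') (c + c')"
fun minus_dual2 where "Dual2 a b c - Dual2 a' b' c' = Dual2 (a - a') (b - b') (c - c')"
fun uminus_dual2 where "- Dual2 a b c = Dual2 (- a) (- b) (- c)"
fun times_dual2 where
  "Dual2 a b c * Dual2 a' b' c' = Dual2 (a * a') (a * b' + b * a') (a * c' + c * a')"

instance
proof
  fix u v w :: dual2
  show "u * v * w = u * (v * w)" by (cases u; cases v; cases w) (simp add: algebra_simps)
  show "u * v = v * u" by (cases u; cases v) (simp add: algebra_simps)
  show "1 * u = u" by (cases u) (simp add: one_dual2_def)
  show "u + v + w = u + (v + w)" by (cases u; cases v; cases w) (simp add: algebra_simps)
  show "u + v = v + u" by (cases u; cases v) (simp add: algebra_simps)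
  show "0 + u = u" by (cases u) (simp add: zero_dual2_def)
  show "- u + u = 0" by (cases u) (simp add: zero_dual2_def)
  show "u - v = u + - v" by (cases u; cases v) simp
  show "(u + v) * w = u * w + v * w" by (cases u; cases v; cases w) (simp add: algebra_simps)
  show "(0::dual2) \<noteq> 1" by (simp add: zero_dual2_def one_dual2_def)
qed

end

fun dual_residue :: "dual \<Rightarrow> complex" where "dual_residue (Dual a b) = a"
fun dual_const :: "complex \<Rightarrow> dual" where "dual_const a = Dual a 0"
fun dual_rescale :: "complex \<Rightarrow> dual \<Rightarrow> dual" where "dual_rescale t (Dual a b) = Dual a (t * b)"
fun dual2_fst :: "dual2 \<Rightarrow> dual" where "dual2_fst (Dual2 a b c) = Dual a b"
fun dual2_snd :: "dual2 \<Rightarrow> dual" where "dual2_snd (Dual2 a b c) = Dual a c"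
fun dual2_sum :: "dual2 \<Rightarrow> dual" where "dual2_sum (Dual2 a b c) = Dual a (b + c)"

text \<open>
  The Zariski tangent space at the \<open>\<complex>\<close>-point \<open>[I]\<close> consists of the morphisms from the spectrum of
  the dual numbers to the Hilbert scheme which send the closed point to \<open>[I]\<close>. By
  representability these are the families over the dual numbers that restrict to \<open>I\<close>. The
  vector space structure is the usual one on the tangent space of a representable functor: the
  scalar \<open>t\<close> acts through \<open>\<epsilon> \<mapsto> t \<epsilon>\<close>, and to add two tangent vectors one takes the unique family
  over \<open>\<complex>[\<epsilon>1,\<epsilon>2]/(\<epsilon>1,\<epsilon>2)^2\<close> restricting to them along \<open>\<epsilon>2 \<mapsto> 0\<close> and \<open>\<epsilon>1 \<mapsto> 0\<close>, and restricts
  it along \<open>\<epsilon>1, \<epsilon>2 \<mapsto> \<epsilon>\<close>. The fields \<open>mult\<close> and \<open>one\<close> play no role in a module.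
\<close>

definition hilb_tangent_space ::
    "nat \<Rightarrow> complex poly3 set \<Rightarrow> (complex, dual poly3 set) module" where
  "hilb_tangent_space d I =
     \<lparr>carrier = {J \<in> hilb d. base_change dual_residue J = I},
      mult = undefined,
      one = undefined,
      zero = base_change dual_const I,
      add = (\<lambda>J1 J2. base_change dual2_sum
               (THE K. K \<in> hilb d \<and> base_change dual2_fst K = J1 \<and> base_change dual2_snd K = J2)),
      smult = (\<lambda>t J. base_change (dual_rescale t) J)\<rparr>"

section \<open>Zariski open sets\<close>

text \<open>Polynomial functions in the coefficients. On a finite-dimensional subspace of \<open>\<complex>[x,y,z]\<close>
  their restrictions are exactly the polynomial functions on that subspace.\<close>

inductive_set polynomial_functions :: "(complex poly3 \<Rightarrow> complex) set" where
  coefficient: "(\<lambda>p. Poly_Mapping.lookup p m) \<in> polynomial_functions"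
| const: "(\<lambda>p. c) \<in> polynomial_functions"
| add: "f \<in> polynomial_functions \<Longrightarrow> g \<in> polynomial_functions \<Longrightarrow>
    (\<lambda>p. f p + g p) \<in> polynomial_functions"
| mult: "f \<in> polynomial_functions \<Longrightarrow> g \<in> polynomial_functions \<Longrightarrow>
    (\<lambda>p. f p * g p) \<in> polynomial_functions"

text \<open>The induced Zariski topology on a subset \<open>X\<close> of a finite-dimensional subspace.\<close>

definition zariski_open_in :: "complex poly3 set \<Rightarrow> complex poly3 set \<Rightarrow> bool" where
  "zariski_open_in X U \<longleftrightarrow>
     (\<exists>F \<subseteq> polynomial_functions. U = {v \<in> X. \<exists>f \<in> F. f v \<noteq> 0})"

section \<open>The ideals under consideration\<close>

definition max_ideal :: "complex poly3 set" where
  "max_ideal = Idl\<^bsub>poly_ring\<^esub> {varX, varY, varZ}"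

definition sym3 :: "complex poly3 set \<Rightarrow> complex poly3 set" where
  "sym3 L = cpoly.span {a * b * c | a b c. a \<in> L \<and> b \<in> L \<and> c \<in> L}"

definition parameter_space :: "complex poly3 \<Rightarrow> complex poly3 set \<Rightarrow> complex poly3 set" where
  "parameter_space l L = {s + l * m | s m. s \<in> sym3 L \<and> m \<in> L}"

definition square_ideal :: "complex poly3 \<Rightarrow> complex poly3 \<Rightarrow> complex poly3 set" where
  "square_ideal l v =
     (let Q = (Idl\<^bsub>poly_ring\<^esub> {l}) <+>\<^bsub>poly_ring\<^esub> ideal_prod poly_ring max_ideal max_ideal
      in ideal_prod poly_ring Q Q <+>\<^bsub>poly_ring\<^esub> (Idl\<^bsub>poly_ring\<^esub> {v}))"

end

theory Submission
  imports Defs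
begin

text \<open>
  A tangent vector at \<open>[I]\<close> is an ideal \<open>J\<close> over the dual numbers, and flatness of \<open>J\<close> forces
  \<open>J = {f + \<epsilon> g. f \<in> I, g \<in> \<psi> f}\<close> for an \<open>R\<close>-linear map \<open>\<psi> : I \<rightarrow> R/I\<close>; so the tangent space is
  \<open>Hom(I, R/I)\<close>. In coordinates \<open>x = l\<close> and \<open>y, z \<in> L\<close> the polynomial \<open>v\<close> is a
  cubic in \<open>y, z\<close> plus \<open>x\<close> times a linear form in \<open>y, z\<close>. It lies in the socle of \<open>R\<close> modulo the
  square, which has colength 13, hence the colength 12. For general \<open>v\<close> the linear form does not
  divide the cubic, and an automorphism \<open>x \<mapsto> x + q(y, z)\<close> of the affine space, followed by a
  linear one, turns \<open>v\<close> into \<open>x z + y^3\<close>. This single ideal has 8 minimal generators and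
  \<open>R/I\<close> has a 5-dimensional socle, which gives 40 homomorphisms into the socle. The relations
  among the generators show that modulo these there are only the ones induced by the derivations
  \<open>\<partial>/\<partial>x\<close>, \<open>\<partial>/\<partial>y\<close>, \<open>\<partial>/\<partial>z\<close>, \<open>y \<partial>/\<partial>x\<close> and \<open>z \<partial>/\<partial>x\<close>.
\<close>

section \<open>Free modules given by coordinates\<close>

text \<open>The obstacle is that \<open>v\<close> moves in a six-parameter family, while a tangent
  space has to be computed exactly. The family collapses because
  \<open>x \<mapsto> x + q(y, z)\<close> with \<open>q\<close> a quadric leaves
  \<open>(x) + m^2\<close>, and hence its square, unchanged. So \<open>q\<close> can be taken as the
  quotient of the cubic of \<open>v\<close> by its linear form \<open>s y + t z\<close>; the
  remainder is a multiple of \<open>y^3\<close>, whose coefficient a cube root absorbs into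
  \<open>y\<close>. The open set is where \<open>t\<close> times the value of the cubic at
  \<open>(t, -s)\<close> is nonzero. For \<open>x z + y^3\<close> everything is a comparison of
  coefficients: modulo the square thirteen monomials survive, and membership in \<open>I0\<close>
  amounts to twelve linear equations. A homomorphism is controlled by its value at
  \<open>x z + y^3\<close>: the syzygies kill the coefficients of \<open>1\<close> and
  \<open>y\<close> in that value and leave those of \<open>z, x, y^2, y z, z^2\<close> free. This is
  the first summand of \<open>45 = 5 + 8 * 5\<close>. Homomorphisms to \<open>R/I\<close> are
  handled as functions choosing representatives, so that neither a quotient nor a module of
  homomorphisms has to be carried through the argument.\<close>

locale coordinates =
  fixes V :: "('a::comm_ring_1, 'v) module" and K :: "'k set" and \<Theta> :: "('k \<Rightarrow> 'a) \<Rightarrow> 'v"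
  assumes finite_K: "finite K"
    and carrier_eq: "carrier V = range \<Theta>"
    and zero_eq: "\<zero>\<^bsub>V\<^esub> = \<Theta> (\<lambda>_. 0)"
    and add_eq: "\<Theta> c \<oplus>\<^bsub>V\<^esub> \<Theta> d = \<Theta> (\<lambda>k. c k + d k)"
    and smult_eq: "a \<odot>\<^bsub>V\<^esub> \<Theta> c = \<Theta> (\<lambda>k. a * c k)"
    and eq_iff: "\<Theta> c = \<Theta> d \<longleftrightarrow> (\<forall>k\<in>K. c k = d k)"
begin

text \<open>Each axiom holds coefficientwise for \<open>\<Theta>\<close>. This replaces a direct
  check for the tangent space, whose addition is given by a \<open>THE\<close> and base changes, and
  for quotients over all the coefficient rings.\<close>

lemma is_module: "Module.module class_ring V"
proof (rule module_criteria)
  show "cring (class_ring :: 'a ring)" by (rule class_cring.is_cring)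
  show "\<forall>v\<in>carrier V. \<exists>n\<in>carrier V. v \<oplus>\<^bsub>V\<^esub> n = \<zero>\<^bsub>V\<^esub>"
  proof
    fix v assume "v \<in> carrier V"
    then obtain c where "v = \<Theta> c" by (auto simp: carrier_eq)
    then show "\<exists>n\<in>carrier V. v \<oplus>\<^bsub>V\<^esub> n = \<zero>\<^bsub>V\<^esub>"
      by (intro bexI[of _ "\<Theta> (\<lambda>k. - c k)"]) (simp_all add: add_eq zero_eq carrier_eq)
  qed
qed (auto simp: carrier_eq zero_eq add_eq smult_eq algebra_simps)

sublocale M: Module.module class_ring V by (rule is_module)

definition unit :: "'k \<Rightarrow> 'v" where "unit k = \<Theta> (\<lambda>j. if j = k then 1 else 0)"

lemma inj_unit: "inj_on unit K"
  by (rule inj_onI) (auto simp: unit_def eq_iff split: if_splits)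

lemma unit_closed: "unit k \<in> carrier V"
  by (simp add: unit_def carrier_eq)

lemma finsum_unit:
  assumes "finite S" "S \<subseteq> K"
  shows "(\<Oplus>\<^bsub>V\<^esub>k\<in>S. c k \<odot>\<^bsub>V\<^esub> unit k) = \<Theta> (\<lambda>k. if k \<in> S then c k else 0)"
  using assms
proof (induction S rule: finite_induct)
  case empty
  then show ?case by (simp add: zero_eq)
next
  case (insert s S)
  have cl: "c k \<odot>\<^bsub>V\<^esub> unit k \<in> carrier V" for k
    by (simp add: unit_def smult_eq carrier_eq)
  have "(\<Oplus>\<^bsub>V\<^esub>k\<in>insert s S. c k \<odot>\<^bsub>V\<^esub> unit k)
      = c s \<odot>\<^bsub>V\<^esub> unit s \<oplus>\<^bsub>V\<^esub> (\<Oplus>\<^bsub>V\<^esub>k\<in>S. c k \<odot>\<^bsub>V\<^esub> unit k)"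
    using insert cl by (intro M.finsum_insert) auto
  also have "\<dots> = \<Theta> (\<lambda>k. if k \<in> insert s S then c k else 0)"
    using insert by (simp add: unit_def smult_eq add_eq eq_iff)
  finally show ?case .
qed

lemma lincomb_unit: "M.lincomb a (unit ` K) = \<Theta> (\<lambda>k. a (unit k))"
proof -
  have "M.lincomb a (unit ` K) = (\<Oplus>\<^bsub>V\<^esub>k\<in>K. a (unit k) \<odot>\<^bsub>V\<^esub> unit k)"
    unfolding M.lincomb_def
    by (rule M.add.finprod_reindex) (auto simp: inj_unit unit_def smult_eq carrier_eq)
  then show ?thesis by (simp add: finsum_unit finite_K eq_iff)
qed

lemma lin_indpt_unit: "\<not> M.lin_dep (unit ` K)"
  by (rule M.finite_lin_indpt2) (auto simp: finite_K unit_closed lincomb_unit zero_eq eq_iff)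

lemma span_unit: "M.span (unit ` K) = carrier V"
proof -
  have "M.span (unit ` K) = {M.lincomb a (unit ` K) |a. a \<in> unit ` K \<rightarrow> carrier class_ring}"
    by (rule M.finite_span) (auto simp: finite_K unit_closed)
  also have "\<dots> = range \<Theta>"
  proof -
    \<comment> \<open>The coefficients of \<open>lincomb\<close> are functions of vectors, so
      coefficients indexed by \<open>K\<close> are pulled back through the inverse of
      \<open>unit\<close>.\<close>
    have "\<exists>a. \<Theta> c = \<Theta> (\<lambda>k. a (unit k))" for c
      by (rule exI[of _ "\<lambda>v. c (the_inv_into K unit v)"])
        (simp add: eq_iff the_inv_into_f_f inj_unit)
    then show ?thesis by (auto simp: lincomb_unit)
  qed
  finally show ?thesis by (simp add: carrier_eq)
qed

lemma is_free_of_rank: "free_of_rank V (card K)"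
  unfolding free_of_rank_def
proof (intro conjI exI[of _ "unit ` K"] is_module lin_indpt_unit span_unit)
  show "card (unit ` K) = card K" by (rule card_image) (rule inj_unit)
qed (auto simp: finite_K unit_closed)

end

lemma free_of_rank_imp_has_dimension:
  assumes "free_of_rank V d"
  shows "has_dimension V d"
proof -
  from assms obtain B where M: "Module.module class_ring V"
    and B: "B \<subseteq> carrier V" "finite B" "card B = d"
    "\<not> LinearCombinations.module.lin_dep class_ring V B"
    "LinearCombinations.module.span class_ring V B = carrier V"
    by (auto simp: free_of_rank_def)
  interpret M: Module.module class_ring V by (rule M)
  interpret vectorspace class_ring V
    by (intro vectorspace.intro M class_field)
  show ?thesis
    unfolding has_dimension_def fin_dim_def
    using B vectorspace_axioms dim_basis[of B] by (auto simp: basis_def)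
qed

section \<open>Ideals\<close>

text \<open>In the ring as a module over itself, submodules are ideals and \<open>rmod.span\<close>
  is the generated ideal. Span induction and the closure rules thus become available for the ideals
  of the definitions.\<close>

global_interpretation rmod: Modules.module "(*) :: 'a::comm_ring_1 \<Rightarrow> 'a \<Rightarrow> 'a"
  by unfold_locales (simp_all add: algebra_simps)

text \<open>As a rewrite rule, this instance of associativity loops with \<open>algebra_simps\<close>.\<close>
declare rmod.scale_scale [simp del]

lemma ideal_iff_subspace:
  "ideal J (class_ring :: 'a::comm_ring_1 ring) \<longleftrightarrow> rmod.subspace J"
proof
  assume "ideal J (class_ring :: 'a ring)"
  then interpret ideal J "class_ring :: 'a ring" .
  show "rmod.subspace J"
    unfolding rmod.subspace_def using a_closed zero_closed I_l_closed by auto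
next
  assume J: "rmod.subspace J"
  show "ideal J (class_ring :: 'a ring)"
  proof (rule idealI)
    show "ring (class_ring :: 'a ring)" by (rule class_ring.ring_axioms)
    have "- x \<in> J" if "x \<in> J" for x using rmod.subspace_neg[OF J that] .
    moreover have "\<zero>\<^bsub>class_ring\<^esub> = (0 :: 'a)" by simp
    moreover have "inv\<^bsub>add_monoid class_ring\<^esub> x = - x" for x :: 'a
      using fun_cong[OF class_ring_simps(8)] unfolding a_inv_def .
    ultimately show "subgroup J (add_monoid (class_ring :: 'a ring))"
      using J by (auto simp: subgroup_def rmod.subspace_def)
  qed (use rmod.subspace_scale[OF J] in \<open>simp_all add: mult.commute\<close>)
qed

lemma genideal_eq_span: "Idl\<^bsub>class_ring\<^esub> S = rmod.span S"
proof -
  have "rmod.subspace (rmod.span S)" "S \<subseteq> rmod.span S"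
    by (auto simp: rmod.span_base)
  moreover have "rmod.span S \<subseteq> J" if "rmod.subspace J" "S \<subseteq> J" for J
    using that by (rule rmod.span_minimal[rotated])
  ultimately show ?thesis
    unfolding genideal_def ideal_iff_subspace by (intro equalityI Inter_lower Inter_greatest) blast+
qed

lemma set_add_class_ring: "A <+>\<^bsub>class_ring\<^esub> B = {a + b |a b. a \<in> A \<and> b \<in> B}"
  by (auto simp: set_add_def set_mult_def)

lemma ideal_prod_eq_span:
  assumes "rmod.subspace A" "rmod.subspace B"
  shows "ideal_prod class_ring A B = rmod.span {a * b |a b. a \<in> A \<and> b \<in> B}"
proof
  have "x \<in> rmod.span {a * b |a b. a \<in> A \<and> b \<in> B}" if "x \<in> ideal_prod class_ring A B" for x
    using that
  proof induction
    case (prod i j)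
    then show ?case by (auto intro: rmod.span_base)
  next
    case (sum s1 s2)
    then show ?case by (simp add: rmod.span_add)
  qed
  then show "ideal_prod class_ring A B \<subseteq> rmod.span {a * b |a b. a \<in> A \<and> b \<in> B}" by blast
  have "rmod.subspace (ideal_prod class_ring A B)"
    using assms ring.ideal_prod_is_ideal[OF class_ring.ring_axioms]
    unfolding ideal_iff_subspace[symmetric] by blast
  moreover have "{a * b |a b. a \<in> A \<and> b \<in> B} \<subseteq> ideal_prod class_ring A B"
    using ideal_prod.prod[of _ A _ B "class_ring"] by auto
  ultimately show "rmod.span {a * b |a b. a \<in> A \<and> b \<in> B} \<subseteq> ideal_prod class_ring A B"
    by (rule rmod.span_minimal[rotated])
qed

text \<open>Bilinearity, in two inductions: \<open>1\<close> lets the second factor range over the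
  span, \<open>2\<close> then the first. This turns the nested ideal products of
  \<open>square_ideal\<close> into finite generating sets.\<close>

lemma span_mult_span:
  "rmod.span {a * b |a b. a \<in> rmod.span S \<and> b \<in> rmod.span T}
    = rmod.span {a * b |a b. a \<in> S \<and> b \<in> T}" (is "?L = ?R")
proof (rule equalityI)
  have 1: "a * b \<in> ?R" if "a \<in> S" "b \<in> rmod.span T" for a b
    using that(2)
  proof (induction b rule: rmod.span_induct_alt)
    case base
    then show ?case by (simp add: rmod.span_zero)
  next
    case (step c x y)
    have "a * x \<in> ?R" by (rule rmod.span_base) (use step(1) that(1) in blast)
    then have "c * (a * x) + a * y \<in> ?R" by (intro rmod.span_add[OF rmod.span_scale] step)
    then show ?case by (simp add: algebra_simps)
  qed
  have 2: "a * b \<in> ?R" if "a \<in> rmod.span S" "b \<in> rmod.span T" for a b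
    using that(1)
  proof (induction a rule: rmod.span_induct_alt)
    case base
    then show ?case by (simp add: rmod.span_zero)
  next
    case (step c x y)
    have "c * (x * b) + y * b \<in> ?R"
      by (intro rmod.span_add[OF rmod.span_scale] step 1 that)
    then show ?case by (simp add: algebra_simps)
  qed
  have "{a * b |a b. a \<in> rmod.span S \<and> b \<in> rmod.span T} \<subseteq> ?R" using 2 by blast
  then show "?L \<subseteq> ?R" by (rule rmod.span_minimal) (rule rmod.subspace_span)
  have "\<exists>a' b'. a * b = a' * b' \<and> a' \<in> rmod.span S \<and> b' \<in> rmod.span T"
    if "a \<in> S" "b \<in> T" for a b
    using that rmod.span_base by metis
  then show "?R \<subseteq> ?L" by (intro rmod.span_mono subsetI CollectI) auto
qed

section \<open>Quotients of the polynomial ring\<close>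

lemma coset_eq_iff:
  assumes "rmod.subspace J"
  shows "J +>\<^bsub>class_ring\<^esub> p = J +>\<^bsub>class_ring\<^esub> q \<longleftrightarrow> p - q \<in> J"
proof -
  have coset: "x \<in> J +>\<^bsub>class_ring\<^esub> p \<longleftrightarrow> x - p \<in> J" for x p
    by (auto simp: a_r_coset_def' intro: bexI[of _ "x - p"])
  show ?thesis
  proof
    assume "J +>\<^bsub>class_ring\<^esub> p = J +>\<^bsub>class_ring\<^esub> q"
    moreover have "p \<in> J +>\<^bsub>class_ring\<^esub> p" unfolding coset using rmod.subspace_0[OF assms] by simp
    ultimately show "p - q \<in> J" unfolding coset[symmetric] by simp
  next
    assume pq: "p - q \<in> J"
    have "x - p \<in> J \<longleftrightarrow> x - q \<in> J" for x
      using rmod.subspace_add[OF assms pq, of "x - p"] rmod.subspace_diff[OF assms _ pq, of "x - q"]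
      by auto
    then show "J +>\<^bsub>class_ring\<^esub> p = J +>\<^bsub>class_ring\<^esub> q" by (auto simp: coset)
  qed
qed

text \<open>The classes of the \<open>b k\<close> form a basis of the quotient over the coefficient
  ring. Phrased by membership in \<open>J\<close>, the property passes easily along automorphisms
  and from \<open>I\<close> to \<open>deform I \<psi>\<close>.\<close>

definition quot_basis :: "'a::comm_ring_1 poly3 set \<Rightarrow> 'k set \<Rightarrow> ('k \<Rightarrow> 'a poly3) \<Rightarrow> bool" where
  "quot_basis J K b \<longleftrightarrow> finite K \<and>
     (\<forall>p. \<exists>c. p - (\<Sum>k\<in>K. const (c k) * b k) \<in> J) \<and>
     (\<forall>c. (\<Sum>k\<in>K. const (c k) * b k) \<in> J \<longrightarrow> (\<forall>k\<in>K. c k = 0))"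

lemma const_add: "const (a + b) = const a + const b"
  by (simp add: const_def single_add)

lemma const_diff: "const (a - b) = const a - const b"
  by (simp add: const_def single_diff)

lemma const_mult: "const (a * b) = const a * const b"
  by (simp add: const_def mult_single)

lemma const_0 [simp]: "const 0 = 0" and const_1 [simp]: "const 1 = 1"
  by (simp_all add: const_def)

context
  fixes J :: "'a::comm_ring_1 poly3 set"
  assumes J: "rmod.subspace J"
begin

interpretation J: ideal J "class_ring :: 'a poly3 ring"
  using J by (simp add: ideal_iff_subspace)

lemma carrier_quot_module: "carrier (quot_module J) = range (\<lambda>p. J +>\<^bsub>class_ring\<^esub> p)"
  by (auto simp: quot_module_def FactRing_def A_RCOSETS_def')

lemma zero_quot_module: "\<zero>\<^bsub>quot_module J\<^esub> = J +>\<^bsub>class_ring\<^esub> 0"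
  by (auto simp: quot_module_def FactRing_def a_r_coset_def')

lemma add_quot_module:
  "(J +>\<^bsub>class_ring\<^esub> p) \<oplus>\<^bsub>quot_module J\<^esub> (J +>\<^bsub>class_ring\<^esub> q) = J +>\<^bsub>class_ring\<^esub> (p + q)"
  using J.a_rcos_sum[of p q] by (simp add: quot_module_def FactRing_def)

lemma smult_quot_module:
  "a \<odot>\<^bsub>quot_module J\<^esub> (J +>\<^bsub>class_ring\<^esub> p) = J +>\<^bsub>class_ring\<^esub> (const a * p)"
  using J.rcoset_mult_add[of "const a" p] by (simp add: quot_module_def FactRing_def)

lemma free_of_rank_quot_moduleI:
  fixes K :: "'k set"
  assumes "quot_basis J K b"
  shows "free_of_rank (quot_module J) (card K)"
proof -
  let ?s = "\<lambda>c. \<Sum>k\<in>K. const (c k) * b k"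
  have fin: "finite K" and gen: "\<exists>c. p - ?s c \<in> J"
    and indep: "?s c \<in> J \<Longrightarrow> \<forall>k\<in>K. c k = 0" for p c
    using assms by (auto simp: quot_basis_def)
  interpret coordinates "quot_module J" K "\<lambda>c. J +>\<^bsub>class_ring\<^esub> ?s c"
  proof
    show "carrier (quot_module J) = range (\<lambda>c. J +>\<^bsub>class_ring\<^esub> ?s c)"
    proof (rule equalityI)
      have "\<exists>c. J +>\<^bsub>class_ring\<^esub> p = J +>\<^bsub>class_ring\<^esub> ?s c" for p
        unfolding coset_eq_iff[OF J] by (rule gen)
      then show "carrier (quot_module J) \<subseteq> range (\<lambda>c. J +>\<^bsub>class_ring\<^esub> ?s c)"
        unfolding carrier_quot_module by (simp add: image_subset_iff image_iff)
    qed (auto simp: carrier_quot_module)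
    fix c d :: "'k \<Rightarrow> 'a"
    have diff: "?s c - ?s d = ?s (\<lambda>k. c k - d k)"
      by (simp add: const_diff left_diff_distrib sum_subtractf)
    show "J +>\<^bsub>class_ring\<^esub> ?s c = J +>\<^bsub>class_ring\<^esub> ?s d \<longleftrightarrow> (\<forall>k\<in>K. c k = d k)"
      unfolding coset_eq_iff[OF J]
    proof
      assume "?s c - ?s d \<in> J"
      from indep[OF this[unfolded diff]] show "\<forall>k\<in>K. c k = d k" by simp
    next
      assume "\<forall>k\<in>K. c k = d k"
      then have "?s c - ?s d = 0" unfolding diff by (intro sum.neutral) simp
      then show "?s c - ?s d \<in> J" using rmod.subspace_0[OF J] by simp
    qed
  qed (simp_all add: fin zero_quot_module add_quot_module smult_quot_module const_add const_mult
        distrib_right sum.distrib sum_distrib_left mult.assoc)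
  show ?thesis by (rule is_free_of_rank)
qed

end

text \<open>Flatness: a free module over \<open>A\<close> has no more \<open>e\<close>-torsion than \<open>A\<close> itself.\<close>

lemma free_quot_module_flat:
  fixes J :: "'a::comm_ring_1 poly3 set"
  assumes J: "rmod.subspace J" and free: "free_of_rank (quot_module J) d"
    and ann: "\<And>a. e * a = 0 \<Longrightarrow> \<exists>a'. a = e * a'" and p: "const e * p \<in> J"
  shows "\<exists>q. p - const e * q \<in> J"
proof -
  let ?V = "quot_module J"
  from free obtain B where M: "Module.module class_ring ?V"
    and B: "B \<subseteq> carrier ?V" "finite B"
    "\<not> LinearCombinations.module.lin_dep class_ring ?V B"
    "LinearCombinations.module.span class_ring ?V B = carrier ?V"
    by (auto simp: free_of_rank_def)
  interpret M: Module.module class_ring ?V by (rule M)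
  have "J +>\<^bsub>class_ring\<^esub> p \<in> M.span B"
    unfolding B(4) by (auto simp: carrier_quot_module[OF J])
  then obtain a where a: "J +>\<^bsub>class_ring\<^esub> p = M.lincomb a B"
    using M.finite_in_span[OF B(2,1)] by metis
  \<comment> \<open>Expand \<open>p\<close> in the basis: if \<open>e * p\<close> is zero in the
    quotient, then \<open>e\<close> kills every coordinate, and by \<open>ann\<close> every
    coordinate is a multiple of \<open>e\<close>.\<close>
  have "M.lincomb (\<lambda>v. e * a v) B = e \<odot>\<^bsub>?V\<^esub> (J +>\<^bsub>class_ring\<^esub> p)"
    using M.lincomb_smult[OF B(1), of a e] by (simp add: a)
  also have "\<dots> = \<zero>\<^bsub>?V\<^esub>"
    using p by (simp add: smult_quot_module[OF J] zero_quot_module[OF J] coset_eq_iff[OF J])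
  finally have "e * a v = 0" if "v \<in> B" for v
    using M.lin_dep_crit[OF B(2) subset_refl, of "\<lambda>v. e * a v" v] that B(3) by auto
  then have "\<forall>v\<in>B. \<exists>a'. a v = e * a'" using ann by blast
  from bchoice[OF this] obtain a' where a': "\<And>v. v \<in> B \<Longrightarrow> a v = e * a' v" by blast
  have "M.lincomb a B = M.lincomb (\<lambda>v. e * a' v) B"
    using a' B(1) by (intro M.lincomb_cong) auto
  also have "\<dots> = e \<odot>\<^bsub>?V\<^esub> M.lincomb a' B"
    using M.lincomb_smult[OF B(1), of a' e] by simp
  finally have "J +>\<^bsub>class_ring\<^esub> p = e \<odot>\<^bsub>?V\<^esub> M.lincomb a' B" by (simp add: a)
  moreover have "M.lincomb a' B \<in> carrier ?V" using B(1) by (intro M.lincomb_closed) auto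
  then obtain q where "M.lincomb a' B = J +>\<^bsub>class_ring\<^esub> q" by (auto simp: carrier_quot_module[OF J])
  ultimately show ?thesis by (auto simp: smult_quot_module[OF J] coset_eq_iff[OF J])
qed

section \<open>Polynomials over the dual numbers\<close>

abbreviation lookup :: "('m \<Rightarrow>\<^sub>0 'a::zero) \<Rightarrow> 'm \<Rightarrow> 'a" where
  "lookup \<equiv> Poly_Mapping.lookup"

lemma poly_mapping_induct_add [case_names zero single add]:
  assumes "P 0" "\<And>m c. P (Poly_Mapping.single m c)" "\<And>p q. P p \<Longrightarrow> P q \<Longrightarrow> P (p + q)"
  shows "P (p :: 'a \<Rightarrow>\<^sub>0 'b::monoid_add)"
proof (induction p rule: update_induct)
  case const
  show ?case by (rule assms)
next
  case (update f a b)
  have "Poly_Mapping.update a b f = f + Poly_Mapping.single a b"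
    using update(1) by (intro poly_mapping_eqI)
      (auto simp: lookup_update lookup_add lookup_single not_in_keys_iff_lookup_eq_zero when_def)
  with update assms show ?case by simp
qed

lemma lookup_map:
  assumes "\<phi> 0 = 0"
  shows "lookup (Poly_Mapping.map \<phi> p) m = \<phi> (lookup p m)"
  using assms by (simp add: Poly_Mapping.map.rep_eq when_def)

lemma lookup_const_mult: "lookup (const c * p) m = c * lookup p m"
  using mult_map_scale_conv_mult[of c p] lookup_map[of "(*) c" p m] by (simp add: const_def)

lemma map_0 [simp]: "Poly_Mapping.map \<phi> 0 = 0"
  by (intro poly_mapping_eqI) (simp add: Poly_Mapping.map.rep_eq)

lemma map_poly_add:
  assumes "\<phi> 0 = 0" "\<And>a b. \<phi> (a + b) = \<phi> a + \<phi> b"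
  shows "Poly_Mapping.map \<phi> (p + q) = Poly_Mapping.map \<phi> p + Poly_Mapping.map \<phi> q"
  by (intro poly_mapping_eqI) (simp add: lookup_map lookup_add assms)

lemma map_poly_mult:
  fixes p q :: "'a::comm_ring_1 poly3" and \<phi> :: "'a \<Rightarrow> 'b::comm_ring_1"
  assumes "\<phi> 0 = 0" "\<And>a b. \<phi> (a + b) = \<phi> a + \<phi> b" "\<And>a b. \<phi> (a * b) = \<phi> a * \<phi> b"
  shows "Poly_Mapping.map \<phi> (p * q) = Poly_Mapping.map \<phi> p * Poly_Mapping.map \<phi> q"
proof (induction p rule: poly_mapping_induct_add)
  case (single m c)
  show ?case
    by (induction q rule: poly_mapping_induct_add)
      (simp_all add: mult_single assms map_poly_add distrib_left)
qed (simp_all add: assms map_poly_add distrib_right)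

abbreviation embed :: "complex poly3 \<Rightarrow> dual poly3" where
  "embed \<equiv> Poly_Mapping.map dual_const"

abbreviation embed2 :: "complex poly3 \<Rightarrow> dual2 poly3" where
  "embed2 \<equiv> Poly_Mapping.map (\<lambda>a. Dual2 a 0 0)"

text \<open>This is \<open>f + \<epsilon> g\<close>, and \<open>dpoly2 f g h\<close> is
  \<open>f + \<epsilon>1 g + \<epsilon>2 h\<close>. Every polynomial over the dual rings has this
  form, so questions about ideals there become questions about complex polynomials.\<close>

definition dpoly :: "complex poly3 \<Rightarrow> complex poly3 \<Rightarrow> dual poly3" where
  "dpoly f g = embed f + const (Dual 0 1) * embed g"

definition dpoly2 :: "complex poly3 \<Rightarrow> complex poly3 \<Rightarrow> complex poly3 \<Rightarrow> dual2 poly3" where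
  "dpoly2 f g h = embed2 f + const (Dual2 0 1 0) * embed2 g + const (Dual2 0 0 1) * embed2 h"

lemma lookup_dpoly: "lookup (dpoly f g) m = Dual (lookup f m) (lookup g m)"
  by (simp add: dpoly_def lookup_add lookup_map lookup_const_mult zero_dual_def)

lemma lookup_dpoly2: "lookup (dpoly2 f g h) m = Dual2 (lookup f m) (lookup g m) (lookup h m)"
  by (simp add: dpoly2_def lookup_add lookup_map lookup_const_mult zero_dual2_def)

lemma dpoly_eq_iff: "dpoly f g = dpoly f' g' \<longleftrightarrow> f = f' \<and> g = g'"
  by (auto simp: poly_mapping_eq_iff fun_eq_iff lookup_dpoly)

lemma dpoly2_eq_iff: "dpoly2 f g h = dpoly2 f' g' h' \<longleftrightarrow> f = f' \<and> g = g' \<and> h = h'"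
  by (auto simp: poly_mapping_eq_iff fun_eq_iff lookup_dpoly2)

lemma dpoly_cases: obtains f g where "p = dpoly f g"
proof -
  let ?eps = "\<lambda>d. case d of Dual a b \<Rightarrow> b"
  have "p = dpoly (Poly_Mapping.map dual_residue p) (Poly_Mapping.map ?eps p)"
  proof (rule poly_mapping_eqI)
    fix m
    show "lookup p m = lookup (dpoly (Poly_Mapping.map dual_residue p) (Poly_Mapping.map ?eps p)) m"
      by (cases "lookup p m") (simp add: lookup_dpoly lookup_map zero_dual_def)
  qed
  then show thesis by (rule that)
qed

lemma dpoly2_cases: obtains f g h where "p = dpoly2 f g h"
proof -
  let ?f = "\<lambda>d. case d of Dual2 a b c \<Rightarrow> a"
  let ?g = "\<lambda>d. case d of Dual2 a b c \<Rightarrow> b"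
  let ?h = "\<lambda>d. case d of Dual2 a b c \<Rightarrow> c"
  have "p = dpoly2 (Poly_Mapping.map ?f p) (Poly_Mapping.map ?g p) (Poly_Mapping.map ?h p)"
  proof (rule poly_mapping_eqI)
    fix m
    show "lookup p m = lookup (dpoly2 (Poly_Mapping.map ?f p) (Poly_Mapping.map ?g p)
        (Poly_Mapping.map ?h p)) m"
      by (cases "lookup p m") (simp add: lookup_dpoly2 lookup_map zero_dual2_def)
  qed
  then show thesis by (rule that)
qed

lemma dpoly_0: "dpoly 0 0 = 0" and dpoly2_0: "dpoly2 0 0 0 = 0"
  by (simp_all add: dpoly_def dpoly2_def)

lemma dpoly_add: "dpoly f g + dpoly f' g' = dpoly (f + f') (g + g')"
  by (intro poly_mapping_eqI) (simp add: lookup_dpoly lookup_add)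

lemma dpoly_diff: "dpoly f g - dpoly f' g' = dpoly (f - f') (g - g')"
  by (intro poly_mapping_eqI) (simp add: lookup_dpoly lookup_minus)

lemma dpoly2_add: "dpoly2 f g h + dpoly2 f' g' h' = dpoly2 (f + f') (g + g') (h + h')"
  by (intro poly_mapping_eqI) (simp add: lookup_dpoly2 lookup_add)

lemma dpoly2_diff: "dpoly2 f g h - dpoly2 f' g' h' = dpoly2 (f - f') (g - g') (h - h')"
  by (intro poly_mapping_eqI) (simp add: lookup_dpoly2 lookup_minus)

lemma dpoly_mult: "dpoly f g * dpoly f' g' = dpoly (f * f') (f * g' + g * f')"
proof -
  have mult: "embed (p * q) = embed p * embed q" for p q
    by (rule map_poly_mult) (simp_all add: zero_dual_def)
  have add: "embed (p + q) = embed p + embed q" for p q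
    by (rule map_poly_add) (simp_all add: zero_dual_def)
  let ?e = "const (Dual 0 1)"
  have "?e * ?e = 0" by (simp flip: const_mult add: zero_dual_def[symmetric])
  then have "?e * (?e * p) = 0" for p by (simp flip: mult.assoc)
  then show ?thesis by (simp add: dpoly_def mult add algebra_simps)
qed

lemma dpoly2_mult:
  "dpoly2 f g h * dpoly2 f' g' h' = dpoly2 (f * f') (f * g' + g * f') (f * h' + h * f')"
proof -
  have mult: "embed2 (p * q) = embed2 p * embed2 q" for p q
    by (rule map_poly_mult) (simp_all add: zero_dual2_def)
  have add: "embed2 (p + q) = embed2 p + embed2 q" for p q
    by (rule map_poly_add) (simp_all add: zero_dual2_def)
  let ?e1 = "const (Dual2 0 1 0)" and ?e2 = "const (Dual2 0 0 1)"
  have "?e1 * ?e1 = 0" "?e1 * ?e2 = 0" "?e2 * ?e1 = 0" "?e2 * ?e2 = 0"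
    by (simp_all flip: const_mult add: zero_dual2_def[symmetric])
  then have nil: "?e1 * (?e1 * p) = 0" "?e1 * (?e2 * p) = 0" "?e2 * (?e1 * p) = 0"
    "?e2 * (?e2 * p) = 0" for p
    by (simp_all flip: mult.assoc)
  show ?thesis by (simp add: dpoly2_def mult add algebra_simps nil)
qed

lemma embed_eq: "embed f = dpoly f 0" and embed2_eq: "embed2 f = dpoly2 f 0 0"
  by (simp_all add: dpoly_def dpoly2_def)

lemma const_Dual: "const (Dual a b) = dpoly (const a) (const b)"
  by (intro poly_mapping_eqI)
    (simp add: lookup_dpoly const_def lookup_single when_def zero_dual_def)

lemma const_Dual2: "const (Dual2 a b c) = dpoly2 (const a) (const b) (const c)"
  by (intro poly_mapping_eqI)
    (simp add: lookup_dpoly2 const_def lookup_single when_def zero_dual2_def)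

lemma sum_dpoly: "(\<Sum>k\<in>K. dpoly (f k) (g k)) = dpoly (\<Sum>k\<in>K. f k) (\<Sum>k\<in>K. g k)"
  by (induction K rule: infinite_finite_induct) (simp_all add: dpoly_0 dpoly_add)

lemma sum_dpoly2:
  "(\<Sum>k\<in>K. dpoly2 (f k) (g k) (h k)) = dpoly2 (\<Sum>k\<in>K. f k) (\<Sum>k\<in>K. g k) (\<Sum>k\<in>K. h k)"
  by (induction K rule: infinite_finite_induct) (simp_all add: dpoly2_0 dpoly2_add)

lemma map_residue_dpoly [simp]: "Poly_Mapping.map dual_residue (dpoly f g) = f"
  by (intro poly_mapping_eqI) (simp add: lookup_map lookup_dpoly zero_dual_def)

lemma map_rescale_dpoly [simp]:
  "Poly_Mapping.map (dual_rescale t) (dpoly f g) = dpoly f (const t * g)"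
  by (intro poly_mapping_eqI) (simp add: lookup_map lookup_dpoly zero_dual_def lookup_const_mult)

lemma map_fst_dpoly2 [simp]: "Poly_Mapping.map dual2_fst (dpoly2 f g h) = dpoly f g"
  and map_snd_dpoly2 [simp]: "Poly_Mapping.map dual2_snd (dpoly2 f g h) = dpoly f h"
  and map_sum_dpoly2 [simp]: "Poly_Mapping.map dual2_sum (dpoly2 f g h) = dpoly f (g + h)"
  by (intro poly_mapping_eqI;
      simp add: lookup_map lookup_dpoly lookup_dpoly2 zero_dual_def zero_dual2_def lookup_add)+

section \<open>Tangent vectors as homomorphisms\<close>

text \<open>\<open>\<psi>\<close> induces an \<open>R\<close>-linear map \<open>I \<rightarrow> R/I\<close>.\<close>

definition hom_mod :: "complex poly3 set \<Rightarrow> (complex poly3 \<Rightarrow> complex poly3) \<Rightarrow> bool" where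
  "hom_mod I \<psi> \<longleftrightarrow>
     (\<forall>f\<in>I. \<forall>g\<in>I. \<psi> (f + g) - (\<psi> f + \<psi> g) \<in> I) \<and> (\<forall>r. \<forall>f\<in>I. \<psi> (r * f) - r * \<psi> f \<in> I)"

definition deform :: "complex poly3 set \<Rightarrow> (complex poly3 \<Rightarrow> complex poly3) \<Rightarrow> dual poly3 set" where
  "deform I \<psi> = {dpoly f g |f g. f \<in> I \<and> g - \<psi> f \<in> I}"

text \<open>The two families glued along their common special fibre \<open>I\<close>. By
  \<open>deform2_unique\<close> it is the family that the addition of tangent vectors
  selects.\<close>

definition deform2 :: "complex poly3 set \<Rightarrow> (complex poly3 \<Rightarrow> complex poly3) \<Rightarrow>
    (complex poly3 \<Rightarrow> complex poly3) \<Rightarrow> dual2 poly3 set" where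
  "deform2 I \<psi> \<chi> = {dpoly2 f g h |f g h. f \<in> I \<and> g - \<psi> f \<in> I \<and> h - \<chi> f \<in> I}"

lemma dpoly_in_deform: "dpoly f g \<in> deform I \<psi> \<longleftrightarrow> f \<in> I \<and> g - \<psi> f \<in> I"
  by (auto simp: deform_def dpoly_eq_iff)

lemma dpoly2_in_deform2: "dpoly2 f g h \<in> deform2 I \<psi> \<chi> \<longleftrightarrow> f \<in> I \<and> g - \<psi> f \<in> I \<and> h - \<chi> f \<in> I"
  by (auto simp: deform2_def dpoly2_eq_iff)

lemma dpoly_set_eqI: "(\<And>f g. dpoly f g \<in> A \<longleftrightarrow> dpoly f g \<in> B) \<Longrightarrow> A = B"
  by (metis dpoly_cases subsetI subset_antisym)

lemma dpoly2_set_eqI: "(\<And>f g h. dpoly2 f g h \<in> A \<longleftrightarrow> dpoly2 f g h \<in> B) \<Longrightarrow> A = B"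
  by (metis dpoly2_cases subsetI subset_antisym)

text \<open>The image of an ideal under a surjective ring map is already an ideal. This covers the
  residue map and the three maps out of \<open>dual2\<close>; \<open>dual_const\<close> and, for
  \<open>t = 0\<close>, \<open>dual_rescale t\<close> are not surjective and are treated
  separately.\<close>

lemma base_change_surj:
  fixes \<phi> :: "'a::comm_ring_1 \<Rightarrow> 'b::comm_ring_1"
  assumes J: "rmod.subspace J"
    and \<phi>: "\<phi> 0 = 0" "\<And>a b. \<phi> (a + b) = \<phi> a + \<phi> b" "\<And>a b. \<phi> (a * b) = \<phi> a * \<phi> b"
    and surj: "\<And>q. \<exists>p. Poly_Mapping.map \<phi> p = (q :: 'b poly3)"
  shows "base_change \<phi> J = Poly_Mapping.map \<phi> ` J"
proof -
  have "rmod.subspace (Poly_Mapping.map \<phi> ` J)"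
  proof (rule rmod.subspaceI)
    show "0 \<in> Poly_Mapping.map \<phi> ` J"
      using rmod.subspace_0[OF J] by (metis image_eqI map_0)
  next
    fix x y assume "x \<in> Poly_Mapping.map \<phi> ` J" "y \<in> Poly_Mapping.map \<phi> ` J"
    then obtain p q where "p \<in> J" "q \<in> J" "x = Poly_Mapping.map \<phi> p" "y = Poly_Mapping.map \<phi> q"
      by blast
    then show "x + y \<in> Poly_Mapping.map \<phi> ` J"
      using rmod.subspace_add[OF J] map_poly_add[of \<phi> p q] \<phi> by (metis image_eqI)
  next
    fix c x :: "'b poly3" assume "x \<in> Poly_Mapping.map \<phi> ` J"
    then obtain p where p: "p \<in> J" "x = Poly_Mapping.map \<phi> p" by blast
    obtain r where r: "Poly_Mapping.map \<phi> r = c" using surj by blast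
    have "c * x = Poly_Mapping.map \<phi> (r * p)"
      unfolding p(2) r[symmetric] by (rule map_poly_mult[symmetric]) (fact \<phi>)+
    then show "c * x \<in> Poly_Mapping.map \<phi> ` J"
      using rmod.subspace_scale[OF J p(1), of r] by blast
  qed
  then show ?thesis
    unfolding base_change_def genideal_eq_span by (simp add: rmod.span_eq_iff)
qed

lemma base_change_residue:
  assumes "rmod.subspace J"
  shows "base_change dual_residue J = {f. \<exists>g. dpoly f g \<in> J}"
proof -
  have "base_change dual_residue J = Poly_Mapping.map dual_residue ` J"
  proof (rule base_change_surj[OF assms])
    show "\<exists>p. Poly_Mapping.map dual_residue p = q" for q :: "complex poly3"
      by (rule exI[of _ "dpoly q 0"]) simp
    show "dual_residue (a + b) = dual_residue a + dual_residue b"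
      "dual_residue (a * b) = dual_residue a * dual_residue b" for a b by (cases a; cases b; simp)+
  qed (simp add: zero_dual_def)
  also have "\<dots> = {f. \<exists>g. dpoly f g \<in> J}"
    by (auto simp: image_iff) (metis dpoly_cases map_residue_dpoly)+
  finally show ?thesis .
qed

lemma base_change_fst:
  assumes "rmod.subspace J"
  shows "dpoly f g \<in> base_change dual2_fst J \<longleftrightarrow> (\<exists>h. dpoly2 f g h \<in> J)"
proof -
  have "base_change dual2_fst J = Poly_Mapping.map dual2_fst ` J"
  proof (rule base_change_surj[OF assms])
    show "\<exists>p. Poly_Mapping.map dual2_fst p = q" for q :: "dual poly3"
      by (rule dpoly_cases[of q]) (metis map_fst_dpoly2)
    show "dual2_fst (a + b) = dual2_fst a + dual2_fst b"
      "dual2_fst (a * b) = dual2_fst a * dual2_fst b" for a b by (cases a; cases b; simp)+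
  qed (simp add: zero_dual_def zero_dual2_def)
  then show ?thesis
    by (auto simp: image_iff) (metis dpoly2_cases dpoly_eq_iff map_fst_dpoly2)+
qed

lemma base_change_snd:
  assumes "rmod.subspace J"
  shows "dpoly f h \<in> base_change dual2_snd J \<longleftrightarrow> (\<exists>g. dpoly2 f g h \<in> J)"
proof -
  have "base_change dual2_snd J = Poly_Mapping.map dual2_snd ` J"
  proof (rule base_change_surj[OF assms])
    show "\<exists>p. Poly_Mapping.map dual2_snd p = q" for q :: "dual poly3"
      by (rule dpoly_cases[of q]) (metis map_snd_dpoly2)
    show "dual2_snd (a + b) = dual2_snd a + dual2_snd b"
      "dual2_snd (a * b) = dual2_snd a * dual2_snd b" for a b by (cases a; cases b; simp)+
  qed (simp add: zero_dual_def zero_dual2_def)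
  then show ?thesis
    by (auto simp: image_iff) (metis dpoly2_cases dpoly_eq_iff map_snd_dpoly2)+
qed

lemma base_change_sum:
  assumes "rmod.subspace J"
  shows "dpoly f k \<in> base_change dual2_sum J \<longleftrightarrow> (\<exists>g h. k = g + h \<and> dpoly2 f g h \<in> J)"
proof -
  have "base_change dual2_sum J = Poly_Mapping.map dual2_sum ` J"
  proof (rule base_change_surj[OF assms])
    show "\<exists>p. Poly_Mapping.map dual2_sum p = q" for q :: "dual poly3"
      by (rule dpoly_cases[of q]) (metis map_sum_dpoly2 add.right_neutral)
    show "dual2_sum (a + b) = dual2_sum a + dual2_sum b"
      "dual2_sum (a * b) = dual2_sum a * dual2_sum b" for a b
      by (cases a; cases b; simp add: algebra_simps)+
  qed (simp add: zero_dual_def zero_dual2_def)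
  then show ?thesis
    by (auto simp: image_iff) (metis dpoly2_cases dpoly_eq_iff map_sum_dpoly2)+
qed

section \<open>Linear combinations of homomorphisms\<close>

lemma hom_mod_zero: "rmod.subspace I \<Longrightarrow> hom_mod I (\<lambda>_. 0)"
  by (simp add: hom_mod_def rmod.subspace_0)

lemma hom_mod_add:
  assumes I: "rmod.subspace I" and "hom_mod I \<psi>" "hom_mod I \<chi>"
  shows "hom_mod I (\<lambda>f. \<psi> f + \<chi> f)"
  unfolding hom_mod_def
proof (intro conjI ballI allI)
  fix f g assume "f \<in> I" "g \<in> I"
  then have "\<psi> (f + g) - (\<psi> f + \<psi> g) + (\<chi> (f + g) - (\<chi> f + \<chi> g)) \<in> I"
    using assms by (intro rmod.subspace_add) (auto simp: hom_mod_def)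
  then show "\<psi> (f + g) + \<chi> (f + g) - (\<psi> f + \<chi> f + (\<psi> g + \<chi> g)) \<in> I" by (simp add: algebra_simps)
next
  fix r f assume "f \<in> I"
  then have "\<psi> (r * f) - r * \<psi> f + (\<chi> (r * f) - r * \<chi> f) \<in> I"
    using assms by (intro rmod.subspace_add) (auto simp: hom_mod_def)
  then show "\<psi> (r * f) + \<chi> (r * f) - r * (\<psi> f + \<chi> f) \<in> I" by (simp add: algebra_simps)
qed

lemma hom_mod_mult:
  assumes I: "rmod.subspace I" and "hom_mod I \<psi>"
  shows "hom_mod I (\<lambda>f. s * \<psi> f)"
  unfolding hom_mod_def
proof (intro conjI ballI allI)
  fix f g assume "f \<in> I" "g \<in> I"
  then have "s * (\<psi> (f + g) - (\<psi> f + \<psi> g)) \<in> I"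
    using assms by (intro rmod.subspace_scale) (auto simp: hom_mod_def)
  then show "s * \<psi> (f + g) - (s * \<psi> f + s * \<psi> g) \<in> I" by (simp add: algebra_simps)
next
  fix r f assume "f \<in> I"
  then have "s * (\<psi> (r * f) - r * \<psi> f) \<in> I"
    using assms by (intro rmod.subspace_scale) (auto simp: hom_mod_def)
  then show "s * \<psi> (r * f) - r * (s * \<psi> f) \<in> I" by (simp add: algebra_simps)
qed

lemma hom_mod_sum:
  assumes "rmod.subspace I" "\<And>k. k \<in> K \<Longrightarrow> hom_mod I (\<psi> k)"
  shows "hom_mod I (\<lambda>f. \<Sum>k\<in>K. \<psi> k f)"
  using assms(2)
  by (induction K rule: infinite_finite_induct)
    (simp_all add: hom_mod_zero hom_mod_add assms(1))

section \<open>Deformed ideals are ideals with free quotients\<close>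

context
  fixes I :: "complex poly3 set"
  assumes I: "rmod.subspace I"
begin

lemmas I_closed = rmod.subspace_add[OF I] rmod.subspace_diff[OF I] rmod.subspace_scale[OF I]
  rmod.subspace_0[OF I]

lemma hom_mod_0: "hom_mod I \<psi> \<Longrightarrow> \<psi> 0 \<in> I"
  using I_closed(4) unfolding hom_mod_def by (metis diff_zero mult_zero_left)

lemma subspace_deform:
  assumes "hom_mod I \<psi>"
  shows "rmod.subspace (deform I \<psi>)"
proof (rule rmod.subspaceI)
  have "dpoly 0 0 \<in> deform I \<psi>"
    using hom_mod_0[OF assms] I_closed rmod.subspace_neg[OF I] by (simp add: dpoly_in_deform)
  then show "0 \<in> deform I \<psi>" by (simp add: dpoly_0)
next
  fix x y assume xy: "x \<in> deform I \<psi>" "y \<in> deform I \<psi>"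
  obtain f g where x: "x = dpoly f g" by (rule dpoly_cases)
  obtain f' g' where y: "y = dpoly f' g'" by (rule dpoly_cases)
  from xy have *: "f \<in> I" "f' \<in> I" "g - \<psi> f \<in> I" "g' - \<psi> f' \<in> I"
    by (auto simp: x y dpoly_in_deform)
  then have "(g - \<psi> f) + (g' - \<psi> f') - (\<psi> (f + f') - (\<psi> f + \<psi> f')) \<in> I"
    using assms by (intro I_closed(2)[OF I_closed(1)]) (auto simp: hom_mod_def)
  with * show "x + y \<in> deform I \<psi>"
    by (simp add: x y dpoly_add dpoly_in_deform I_closed algebra_simps)
next
  fix c x assume xI: "x \<in> deform I \<psi>"
  obtain f g where x: "x = dpoly f g" by (rule dpoly_cases)
  obtain r s where c: "c = dpoly r s" by (rule dpoly_cases)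
  from xI have *: "f \<in> I" "g - \<psi> f \<in> I" by (auto simp: x dpoly_in_deform)
  \<comment> \<open>The \<epsilon>-part of \<open>(r + \<epsilon> s) * (f + \<epsilon> g)\<close> is
    \<open>r * g + s * f\<close>; the second term lies in \<open>I\<close>, so only the first has to
    agree with \<open>\<psi> (r * f)\<close>.\<close>
  then have "r * (g - \<psi> f) + s * f - (\<psi> (r * f) - r * \<psi> f) \<in> I"
    using assms by (intro I_closed(2)[OF I_closed(1)[OF I_closed(3) I_closed(3)]])
      (auto simp: hom_mod_def)
  with * I_closed(3)[OF *(1), of r] show "c * x \<in> deform I \<psi>"
    by (simp add: x c dpoly_mult dpoly_in_deform I_closed algebra_simps)
qed

lemma subspace_deform2:
  assumes "hom_mod I \<psi>" "hom_mod I \<chi>"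
  shows "rmod.subspace (deform2 I \<psi> \<chi>)"
proof (rule rmod.subspaceI)
  \<comment> \<open>The directions \<open>\<epsilon>1\<close> and \<open>\<epsilon>2\<close> do not
    interact, so all closure properties come from the two ideals \<open>deform I \<psi>\<close> and
    \<open>deform I \<chi>\<close>.\<close>
  have iff: "dpoly2 f g h \<in> deform2 I \<psi> \<chi> \<longleftrightarrow> dpoly f g \<in> deform I \<psi> \<and> dpoly f h \<in> deform I \<chi>"
    for f g h by (auto simp: dpoly2_in_deform2 dpoly_in_deform)
  note sub = assms[THEN subspace_deform]
  show "0 \<in> deform2 I \<psi> \<chi>"
    using sub[THEN rmod.subspace_0] iff[of 0 0 0] by (simp add: dpoly_0 dpoly2_0)
  fix c x y assume xy: "x \<in> deform2 I \<psi> \<chi>"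
  obtain f g h where x: "x = dpoly2 f g h" by (rule dpoly2_cases)
  obtain r s t where c: "c = dpoly2 r s t" by (rule dpoly2_cases)
  show "c * x \<in> deform2 I \<psi> \<chi>"
    using xy rmod.subspace_scale[OF sub(1), of "dpoly f g" "dpoly r s"]
      rmod.subspace_scale[OF sub(2), of "dpoly f h" "dpoly r t"]
    by (simp add: x c iff dpoly2_mult dpoly_mult)
  assume y_in: "y \<in> deform2 I \<psi> \<chi>"
  obtain f' g' h' where y: "y = dpoly2 f' g' h'" by (rule dpoly2_cases)
  show "x + y \<in> deform2 I \<psi> \<chi>"
    using xy y_in rmod.subspace_add[OF sub(1), of "dpoly f g" "dpoly f' g'"]
      rmod.subspace_add[OF sub(2), of "dpoly f h" "dpoly f' h'"]
    by (simp add: x y iff dpoly2_add dpoly_add)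
qed

lemma deform_eq_iff:
  assumes "hom_mod I \<psi>" "hom_mod I \<chi>"
  shows "deform I \<psi> = deform I \<chi> \<longleftrightarrow> (\<forall>f\<in>I. \<psi> f - \<chi> f \<in> I)"
proof
  assume eq: "deform I \<psi> = deform I \<chi>"
  show "\<forall>f\<in>I. \<psi> f - \<chi> f \<in> I"
  proof
    fix f assume "f \<in> I"
    then have "dpoly f (\<psi> f) \<in> deform I \<psi>" by (simp add: dpoly_in_deform I_closed)
    then show "\<psi> f - \<chi> f \<in> I" by (simp add: eq dpoly_in_deform)
  qed
next
  assume *: "\<forall>f\<in>I. \<psi> f - \<chi> f \<in> I"
  have "g - \<psi> f \<in> I \<longleftrightarrow> g - \<chi> f \<in> I" if "f \<in> I" for f g
    using I_closed(1)[of "g - \<psi> f" "\<psi> f - \<chi> f"] I_closed(2)[of "g - \<chi> f" "\<psi> f - \<chi> f"] * that by auto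
  then show "deform I \<psi> = deform I \<chi>"
    by (intro dpoly_set_eqI) (auto simp: dpoly_in_deform)
qed

text \<open>Coordinates are found in two rounds: \<open>?s c\<close> reduces the leading part into
  \<open>I\<close>, and \<open>?s d\<close> then reduces the \<epsilon>-part after correction by
  \<open>\<psi>\<close> of what was removed. For independence the leading coefficients vanish first,
  which leaves \<open>?s d\<close> in \<open>I\<close>. Hence every \<open>deform I \<psi>\<close>
  is a free family of the right rank.\<close>

lemma quot_basis_deform:
  assumes \<psi>: "hom_mod I \<psi>" and b: "quot_basis I K b"
  shows "quot_basis (deform I \<psi>) K (\<lambda>k. embed (b k))"
proof -
  let ?s = "\<lambda>c. \<Sum>k\<in>K. const (c k) * b k"
  have fin: "finite K" and gen: "\<exists>c. p - ?s c \<in> I"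
    and indep: "?s c \<in> I \<Longrightarrow> \<forall>k\<in>K. c k = 0" for p c
    using b by (auto simp: quot_basis_def)
  have sum: "(\<Sum>k\<in>K. const (Dual (c k) (d k)) * embed (b k)) = dpoly (?s c) (?s d)" for c d
    by (simp add: const_Dual embed_eq dpoly_mult sum_dpoly mult.commute)
  show ?thesis
    unfolding quot_basis_def
  proof (intro conjI allI impI fin)
    fix p :: "dual poly3"
    obtain f g where p: "p = dpoly f g" by (rule dpoly_cases)
    obtain c where c: "f - ?s c \<in> I" using gen by blast
    obtain d where d: "g - \<psi> (f - ?s c) - ?s d \<in> I" using gen by blast
    have "p - (\<Sum>k\<in>K. const (Dual (c k) (d k)) * embed (b k)) \<in> deform I \<psi>"
      unfolding p sum dpoly_diff dpoly_in_deform using c d by (simp add: algebra_simps)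
    then show "\<exists>c. p - (\<Sum>k\<in>K. const (c k) * embed (b k)) \<in> deform I \<psi>"
      by (rule exI[of _ "\<lambda>k. Dual (c k) (d k)"])
  next
    fix e :: "_ \<Rightarrow> dual"
    assume e: "(\<Sum>k\<in>K. const (e k) * embed (b k)) \<in> deform I \<psi>"
    obtain c d where cd: "e = (\<lambda>k. Dual (c k) (d k))"
    proof
      show "e = (\<lambda>k. Dual (dual_residue (e k)) (case e k of Dual a b \<Rightarrow> b))"
        by (auto simp: fun_eq_iff split: dual.split)
    qed
    have *: "?s c \<in> I" "?s d - \<psi> (?s c) \<in> I"
      using e by (simp_all add: cd sum dpoly_in_deform)
    from indep[OF *(1)] have c: "\<forall>k\<in>K. c k = 0" .
    then have "?s c = 0" by simp
    then have "?s d \<in> I" using I_closed(1)[OF *(2) hom_mod_0[OF \<psi>]] by simp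
    from indep[OF this] c show "\<forall>k\<in>K. e k = 0" by (simp add: cd zero_dual_def)
  qed
qed

lemma quot_basis_deform2:
  assumes \<psi>: "hom_mod I \<psi>" and \<chi>: "hom_mod I \<chi>" and b: "quot_basis I K b"
  shows "quot_basis (deform2 I \<psi> \<chi>) K (\<lambda>k. embed2 (b k))"
proof -
  let ?s = "\<lambda>c. \<Sum>k\<in>K. const (c k) * b k"
  have fin: "finite K" and gen: "\<exists>c. p - ?s c \<in> I"
    and indep: "?s c \<in> I \<Longrightarrow> \<forall>k\<in>K. c k = 0" for p c
    using b by (auto simp: quot_basis_def)
  have sum: "(\<Sum>k\<in>K. const (Dual2 (c k) (d k) (d' k)) * embed2 (b k)) = dpoly2 (?s c) (?s d) (?s d')"
    for c d d'
    by (simp add: const_Dual2 embed2_eq dpoly2_mult sum_dpoly2 mult.commute)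
  show ?thesis
    unfolding quot_basis_def
  proof (intro conjI allI impI fin)
    fix p :: "dual2 poly3"
    obtain f g h where p: "p = dpoly2 f g h" by (rule dpoly2_cases)
    obtain c where c: "f - ?s c \<in> I" using gen by blast
    obtain d where d: "g - \<psi> (f - ?s c) - ?s d \<in> I" using gen by blast
    obtain d' where d': "h - \<chi> (f - ?s c) - ?s d' \<in> I" using gen by blast
    have "p - (\<Sum>k\<in>K. const (Dual2 (c k) (d k) (d' k)) * embed2 (b k)) \<in> deform2 I \<psi> \<chi>"
      unfolding p sum dpoly2_diff dpoly2_in_deform2 using c d d' by (simp add: algebra_simps)
    then show "\<exists>c. p - (\<Sum>k\<in>K. const (c k) * embed2 (b k)) \<in> deform2 I \<psi> \<chi>"
      by (rule exI[of _ "\<lambda>k. Dual2 (c k) (d k) (d' k)"])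
  next
    fix e :: "_ \<Rightarrow> dual2"
    assume e: "(\<Sum>k\<in>K. const (e k) * embed2 (b k)) \<in> deform2 I \<psi> \<chi>"
    obtain c d d' where cd: "e = (\<lambda>k. Dual2 (c k) (d k) (d' k))"
    proof
      show "e = (\<lambda>k. Dual2 (case e k of Dual2 a b c \<Rightarrow> a) (case e k of Dual2 a b c \<Rightarrow> b)
          (case e k of Dual2 a b c \<Rightarrow> c))"
        by (auto simp: fun_eq_iff split: dual2.split)
    qed
    have *: "?s c \<in> I" "?s d - \<psi> (?s c) \<in> I" "?s d' - \<chi> (?s c) \<in> I"
      using e by (simp_all add: cd sum dpoly2_in_deform2)
    from indep[OF *(1)] have c: "\<forall>k\<in>K. c k = 0" .
    then have "?s c = 0" by simp
    then have "?s d \<in> I" "?s d' \<in> I"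
      using I_closed(1)[OF *(2) hom_mod_0[OF \<psi>]] I_closed(1)[OF *(3) hom_mod_0[OF \<chi>]] by simp_all
    from this[THEN indep] c show "\<forall>k\<in>K. e k = 0" by (simp add: cd zero_dual2_def)
  qed
qed

end

text \<open>The maps induced by the \<open>\<phi> k\<close> form a complex basis of
  \<open>Hom(I, R/I)\<close>; equality of homomorphisms is congruence modulo \<open>I\<close> on
  \<open>I\<close>.\<close>

definition hom_basis ::
    "complex poly3 set \<Rightarrow> 'k set \<Rightarrow> ('k \<Rightarrow> complex poly3 \<Rightarrow> complex poly3) \<Rightarrow> bool" where
  "hom_basis I K \<phi> \<longleftrightarrow> finite K \<and> (\<forall>k\<in>K. hom_mod I (\<phi> k)) \<and>
     (\<forall>\<psi>. hom_mod I \<psi> \<longrightarrow> (\<exists>c. \<forall>f\<in>I. \<psi> f - (\<Sum>k\<in>K. const (c k) * \<phi> k f) \<in> I)) \<and>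
     (\<forall>c. (\<forall>f\<in>I. (\<Sum>k\<in>K. const (c k) * \<phi> k f) \<in> I) \<longrightarrow> (\<forall>k\<in>K. c k = 0))"

section \<open>The operations of the tangent space on deformed ideals\<close>

context
  fixes I :: "complex poly3 set" and B :: "'b set" and b :: "'b \<Rightarrow> complex poly3"
  assumes I: "rmod.subspace I" and b: "quot_basis I B b"
begin

lemma deform_in_hilb:
  assumes "hom_mod I \<psi>"
  shows "deform I \<psi> \<in> hilb (card B)"
  using free_of_rank_quot_moduleI[OF subspace_deform[OF I assms] quot_basis_deform[OF I assms b]]
    subspace_deform[OF I assms]
  by (simp add: hilb_def ideal_iff_subspace)

lemma deform2_in_hilb:
  assumes "hom_mod I \<psi>" "hom_mod I \<chi>"
  shows "deform2 I \<psi> \<chi> \<in> hilb (card B)"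
  using free_of_rank_quot_moduleI[OF subspace_deform2[OF I assms] quot_basis_deform2[OF I assms b]]
    subspace_deform2[OF I assms]
  by (simp add: hilb_def ideal_iff_subspace)

lemma base_change_residue_deform:
  assumes "hom_mod I \<psi>"
  shows "base_change dual_residue (deform I \<psi>) = I"
proof -
  have "\<exists>g. g - \<psi> f \<in> I" for f
    using rmod.subspace_0[OF I] by (intro exI[of _ "\<psi> f"]) simp
  then show ?thesis
    by (simp add: base_change_residue[OF subspace_deform[OF I assms]] dpoly_in_deform)
qed

lemma base_change_const: "base_change dual_const I = deform I (\<lambda>_. 0)"
  unfolding base_change_def genideal_eq_span
proof (rule equalityI)
  show "rmod.span (embed ` I) \<subseteq> deform I (\<lambda>_. 0)"
    using rmod.subspace_0[OF I] subspace_deform[OF I hom_mod_zero[OF I]]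
    by (intro rmod.span_minimal) (auto simp: embed_eq dpoly_in_deform)
  have "dpoly f g \<in> rmod.span (embed ` I)" if "f \<in> I" "g \<in> I" for f g
    unfolding dpoly_def by (rule rmod.span_add[OF rmod.span_base rmod.span_scale[OF rmod.span_base]])
      (simp_all add: that)
  then show "deform I (\<lambda>_. 0) \<subseteq> rmod.span (embed ` I)"
    by (auto simp: deform_def)
qed

lemma base_change_rescale:
  assumes "hom_mod I \<psi>"
  shows "base_change (dual_rescale t) (deform I \<psi>) = deform I (\<lambda>f. const t * \<psi> f)"
  unfolding base_change_def genideal_eq_span
proof (rule equalityI)
  let ?S = "Poly_Mapping.map (dual_rescale t) ` deform I \<psi>"
  have "dpoly f (const t * g) \<in> deform I (\<lambda>f. const t * \<psi> f)" if "f \<in> I" "g - \<psi> f \<in> I" for f g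
    using that rmod.subspace_scale[OF I that(2), of "const t"]
    by (simp add: dpoly_in_deform right_diff_distrib)
  then show "rmod.span ?S \<subseteq> deform I (\<lambda>f. const t * \<psi> f)"
    using subspace_deform[OF I hom_mod_mult[OF I assms]]
    by (intro rmod.span_minimal) (auto simp: deform_def)
  have base: "dpoly f (const t * \<psi> f) \<in> rmod.span ?S" if "f \<in> I" for f
  proof (rule rmod.span_base)
    have "dpoly f (\<psi> f) \<in> deform I \<psi>"
      using that rmod.subspace_0[OF I] by (simp add: dpoly_in_deform)
    then show "dpoly f (const t * \<psi> f) \<in> ?S" by (intro image_eqI) simp_all
  qed
  have "dpoly f h \<in> rmod.span ?S" if f: "f \<in> I" and h: "h - const t * \<psi> f \<in> I" for f h
  proof -
    \<comment> \<open>The images only give \<epsilon>-parts of the form \<open>const t * g\<close>.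
      The discrepancy \<open>?i\<close> lies in \<open>I\<close>, and \<epsilon> times the generator
      above \<open>?i\<close> is \<open>\<epsilon> ?i\<close>; this works for \<open>t = 0\<close>
      too.\<close>
    let ?i = "h - const t * \<psi> f"
    have "dpoly f (const t * \<psi> f) + dpoly 0 1 * dpoly ?i (const t * \<psi> ?i) \<in> rmod.span ?S"
      by (intro rmod.span_add rmod.span_scale[OF base[OF h]] base f)
    then show ?thesis by (simp add: dpoly_mult dpoly_add)
  qed
  then show "deform I (\<lambda>f. const t * \<psi> f) \<subseteq> rmod.span ?S"
    by (auto simp: deform_def)
qed

lemma base_change_sum_deform2:
  assumes "hom_mod I \<psi>" "hom_mod I \<chi>"
  shows "base_change dual2_sum (deform2 I \<psi> \<chi>) = deform I (\<lambda>f. \<psi> f + \<chi> f)"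
proof (rule dpoly_set_eqI)
  fix f k
  have "(\<exists>g h. k = g + h \<and> g - \<psi> f \<in> I \<and> h - \<chi> f \<in> I) \<longleftrightarrow> k - (\<psi> f + \<chi> f) \<in> I"
  proof
    assume "\<exists>g h. k = g + h \<and> g - \<psi> f \<in> I \<and> h - \<chi> f \<in> I"
    then obtain g h where gh: "k = g + h" "g - \<psi> f \<in> I" "h - \<chi> f \<in> I" by blast
    from rmod.subspace_add[OF I gh(2,3)] show "k - (\<psi> f + \<chi> f) \<in> I"
      by (simp add: gh(1) algebra_simps)
  next
    assume "k - (\<psi> f + \<chi> f) \<in> I"
    then show "\<exists>g h. k = g + h \<and> g - \<psi> f \<in> I \<and> h - \<chi> f \<in> I"
      using rmod.subspace_0[OF I]
      by (intro exI[of _ "k - \<chi> f"] exI[of _ "\<chi> f"]) (simp add: algebra_simps)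
  qed
  then show "dpoly f k \<in> base_change dual2_sum (deform2 I \<psi> \<chi>)
      \<longleftrightarrow> dpoly f k \<in> deform I (\<lambda>f. \<psi> f + \<chi> f)"
    by (auto simp: base_change_sum[OF subspace_deform2[OF I assms]] dpoly2_in_deform2
        dpoly_in_deform)
qed

text \<open>For uniqueness, the first restriction puts some
  \<open>f + \<epsilon>1 g + \<epsilon>2 h'\<close> into \<open>K\<close>. Since
  \<open>h - h'\<close> lies in \<open>I\<close>, it is the leading part of another element of
  \<open>K\<close>, and \<epsilon>2 times that element corrects \<open>h'\<close> to
  \<open>h\<close>.\<close>

lemma deform2_unique:
  assumes "hom_mod I \<psi>" "hom_mod I \<chi>"
  shows "(THE K. K \<in> hilb (card B) \<and> base_change dual2_fst K = deform I \<psi> \<and>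
    base_change dual2_snd K = deform I \<chi>) = deform2 I \<psi> \<chi>"
proof (rule the_equality)
  have ex: "\<exists>g. g - \<psi> f \<in> I" "\<exists>g. g - \<chi> f \<in> I" for f
    using rmod.subspace_0[OF I] by (metis diff_self)+
  have "base_change dual2_fst (deform2 I \<psi> \<chi>) = deform I \<psi>"
    by (rule dpoly_set_eqI) (simp add: base_change_fst[OF subspace_deform2[OF I assms]]
        dpoly2_in_deform2 dpoly_in_deform ex)
  moreover have "base_change dual2_snd (deform2 I \<psi> \<chi>) = deform I \<chi>"
    by (rule dpoly_set_eqI) (simp add: base_change_snd[OF subspace_deform2[OF I assms]]
        dpoly2_in_deform2 dpoly_in_deform ex)
  ultimately show "deform2 I \<psi> \<chi> \<in> hilb (card B) \<and>
      base_change dual2_fst (deform2 I \<psi> \<chi>) = deform I \<psi> \<and>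
      base_change dual2_snd (deform2 I \<psi> \<chi>) = deform I \<chi>"
    using deform2_in_hilb[OF assms] by blast
next
  fix K assume K: "K \<in> hilb (card B) \<and> base_change dual2_fst K = deform I \<psi> \<and>
    base_change dual2_snd K = deform I \<chi>"
  then have sub: "rmod.subspace K" by (simp add: hilb_def ideal_iff_subspace)
  have fst: "(\<exists>h. dpoly2 f g h \<in> K) \<longleftrightarrow> f \<in> I \<and> g - \<psi> f \<in> I" for f g
    using K base_change_fst[OF sub, of f g] by (simp add: dpoly_in_deform)
  have snd: "(\<exists>g. dpoly2 f g h \<in> K) \<longleftrightarrow> f \<in> I \<and> h - \<chi> f \<in> I" for f h
    using K base_change_snd[OF sub, of f h] by (simp add: dpoly_in_deform)
  show "K = deform2 I \<psi> \<chi>"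
  proof (rule dpoly2_set_eqI)
    fix f g h
    show "dpoly2 f g h \<in> K \<longleftrightarrow> dpoly2 f g h \<in> deform2 I \<psi> \<chi>"
    proof
      assume "dpoly2 f g h \<in> K"
      then have "\<exists>h. dpoly2 f g h \<in> K" "\<exists>g. dpoly2 f g h \<in> K" by blast+
      then show "dpoly2 f g h \<in> deform2 I \<psi> \<chi>" by (simp add: fst snd dpoly2_in_deform2)
    next
      assume *: "dpoly2 f g h \<in> deform2 I \<psi> \<chi>"
      then obtain h' where h': "dpoly2 f g h' \<in> K" using fst by (auto simp: dpoly2_in_deform2)
      then have "h' - \<chi> f \<in> I" using snd by blast
      moreover have "h - \<chi> f \<in> I" using * by (simp add: dpoly2_in_deform2)
      ultimately have "(h - \<chi> f) - (h' - \<chi> f) \<in> I"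
        by (rule rmod.subspace_diff[OF I, rotated])
      then obtain j j' where "dpoly2 (h - h') j j' \<in> K"
        using fst[of "h - h'" "\<psi> (h - h')"] rmod.subspace_0[OF I] by auto
      from rmod.subspace_add[OF sub h' rmod.subspace_scale[OF sub this, of "dpoly2 0 0 1"]]
      show "dpoly2 f g h \<in> K" by (simp add: dpoly2_add dpoly2_mult)
    qed
  qed
qed

text \<open>Flatness enters in \<open>eps\<close>: if \<open>\<epsilon> g\<close> lies in
  \<open>J\<close>, then \<open>g\<close> is congruent modulo \<open>J\<close> to a multiple of
  \<epsilon>, so \<open>g\<close> lies in \<open>I\<close>. Hence the \<epsilon>-parts above a fixed
  \<open>f\<close> form one coset of \<open>I\<close>, and any choice of representatives is linear
  modulo \<open>I\<close>.\<close>

lemma tangent_vector_is_deform: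
  assumes J: "J \<in> hilb d" and JI: "base_change dual_residue J = I"
  obtains \<psi> where "hom_mod I \<psi>" "J = deform I \<psi>"
proof -
  have sub: "rmod.subspace J" and free: "free_of_rank (quot_module J) d"
    using J by (simp_all add: hilb_def ideal_iff_subspace)
  have I_iff: "f \<in> I \<longleftrightarrow> (\<exists>g. dpoly f g \<in> J)" for f
    using JI base_change_residue[OF sub] by blast
  have eps: "dpoly 0 g \<in> J \<longleftrightarrow> g \<in> I" for g
  proof
    have ann: "\<exists>a'. a = Dual 0 1 * a'" if "Dual 0 1 * a = 0" for a
    proof (cases a)
      case (Dual x y)
      with that have "a = Dual 0 1 * Dual y 0" by (simp add: zero_dual_def)
      then show ?thesis by blast
    qed
    assume "dpoly 0 g \<in> J"
    then have "const (Dual 0 1) * dpoly g 0 \<in> J" by (simp add: const_Dual dpoly_mult)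
    from free_quot_module_flat[OF sub free ann this]
    obtain q where q: "dpoly g 0 - const (Dual 0 1) * q \<in> J" by blast
    obtain q0 q1 where "q = dpoly q0 q1" by (rule dpoly_cases)
    with q have "dpoly g (- q0) \<in> J" by (simp add: const_Dual dpoly_mult dpoly_diff)
    then show "g \<in> I" using I_iff by blast
  next
    assume "g \<in> I"
    then obtain h where "dpoly g h \<in> J" using I_iff by blast
    from rmod.subspace_scale[OF sub this, of "dpoly 0 1"] show "dpoly 0 g \<in> J"
      by (simp add: dpoly_mult)
  qed
  define \<psi> where "\<psi> f = (SOME g. dpoly f g \<in> J)" for f
  have \<psi>: "dpoly f (\<psi> f) \<in> J" if "f \<in> I" for f
    using that I_iff someI_ex[of "\<lambda>g. dpoly f g \<in> J"] by (simp add: \<psi>_def)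
  have J_iff: "dpoly f g \<in> J \<longleftrightarrow> g - \<psi> f \<in> I" if "f \<in> I" for f g
  proof -
    have "dpoly f g \<in> J \<longleftrightarrow> dpoly f g - dpoly f (\<psi> f) \<in> J"
      using rmod.subspace_diff[OF sub _ \<psi>[OF that]] rmod.subspace_add[OF sub _ \<psi>[OF that]]
      by (metis diff_add_cancel)
    then show ?thesis by (simp add: dpoly_diff eps)
  qed
  have "J = deform I \<psi>"
  proof (rule dpoly_set_eqI)
    fix f g
    show "dpoly f g \<in> J \<longleftrightarrow> dpoly f g \<in> deform I \<psi>"
    proof (cases "f \<in> I")
      case True
      then show ?thesis by (simp only: J_iff dpoly_in_deform simp_thms)
    next
      case False
      then show ?thesis unfolding dpoly_in_deform using I_iff by blast
    qed
  qed
  moreover have "hom_mod I \<psi>"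
    unfolding hom_mod_def
  proof (intro conjI ballI allI)
    fix f g assume fg: "f \<in> I" "g \<in> I"
    from rmod.subspace_add[OF sub \<psi>[OF fg(1)] \<psi>[OF fg(2)]]
    have "\<psi> f + \<psi> g - \<psi> (f + g) \<in> I"
      using J_iff[OF rmod.subspace_add[OF I fg]] by (simp add: dpoly_add)
    then show "\<psi> (f + g) - (\<psi> f + \<psi> g) \<in> I" using rmod.subspace_neg[OF I] by fastforce
  next
    fix r f assume f: "f \<in> I"
    from rmod.subspace_scale[OF sub \<psi>[OF f], of "dpoly r 0"]
    have "r * \<psi> f - \<psi> (r * f) \<in> I"
      using J_iff[OF rmod.subspace_scale[OF I f]] by (simp add: dpoly_mult)
    then show "\<psi> (r * f) - r * \<psi> f \<in> I" using rmod.subspace_neg[OF I] by fastforce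
  qed
  ultimately show thesis using that by blast
qed

text \<open>The locale \<open>coordinates\<close> applies to
  \<open>c \<mapsto> deform I (\<Phi> c)\<close>: surjectivity is
  \<open>tangent_vector_is_deform\<close> with the spanning half of \<open>hom_basis\<close>,
  injectivity is its independence half, and the base change lemmas identify the operations.\<close>

theorem has_dimension_hilb_tangent_space:
  fixes K :: "'k set"
  assumes "hom_basis I K \<phi>"
  shows "has_dimension (hilb_tangent_space (card B) I) (card K)"
proof (rule free_of_rank_imp_has_dimension)
  define \<Phi> where "\<Phi> c f = (\<Sum>k\<in>K. const (c k) * \<phi> k f)" for c :: "'k \<Rightarrow> complex" and f
  have fin: "finite K" and \<phi>: "\<And>k. k \<in> K \<Longrightarrow> hom_mod I (\<phi> k)"
    and gen: "\<And>\<psi>. hom_mod I \<psi> \<Longrightarrow> \<exists>c. \<forall>f\<in>I. \<psi> f - \<Phi> c f \<in> I"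
    and indep: "\<And>c. \<forall>f\<in>I. \<Phi> c f \<in> I \<Longrightarrow> \<forall>k\<in>K. c k = 0"
    using assms unfolding hom_basis_def \<Phi>_def by blast+
  have hom: "hom_mod I (\<Phi> c)" for c
  proof -
    have "hom_mod I (\<lambda>f. \<Sum>k\<in>K. const (c k) * \<phi> k f)"
      by (intro hom_mod_sum hom_mod_mult \<phi> I)
    then show ?thesis by (simp add: \<Phi>_def[abs_def])
  qed
  have \<Phi>_add: "\<Phi> (\<lambda>k. c k + d k) = (\<lambda>f. \<Phi> c f + \<Phi> d f)" for c d
    by (simp add: \<Phi>_def fun_eq_iff const_add distrib_right sum.distrib)
  have \<Phi>_mult: "\<Phi> (\<lambda>k. a * c k) = (\<lambda>f. const a * \<Phi> c f)" for a c
    by (simp add: \<Phi>_def fun_eq_iff const_mult sum_distrib_left mult.assoc)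
  interpret coordinates "hilb_tangent_space (card B) I" K "\<lambda>c. deform I (\<Phi> c)"
  proof
    show "finite K" by (rule fin)
    show "carrier (hilb_tangent_space (card B) I) = range (\<lambda>c. deform I (\<Phi> c))"
    proof (intro equalityI subsetI)
      fix J assume "J \<in> carrier (hilb_tangent_space (card B) I)"
      then have "J \<in> hilb (card B)" "base_change dual_residue J = I"
        by (simp_all add: hilb_tangent_space_def)
      then obtain \<psi> where \<psi>: "hom_mod I \<psi>" "J = deform I \<psi>" by (rule tangent_vector_is_deform)
      from gen[OF \<psi>(1)] obtain c where "\<forall>f\<in>I. \<psi> f - \<Phi> c f \<in> I" by blast
      then have "J = deform I (\<Phi> c)" unfolding \<psi>(2) using deform_eq_iff[OF I \<psi>(1) hom] by blast
      then show "J \<in> range (\<lambda>c. deform I (\<Phi> c))" by blast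
    next
      fix J assume "J \<in> range (\<lambda>c. deform I (\<Phi> c))"
      then show "J \<in> carrier (hilb_tangent_space (card B) I)"
        using deform_in_hilb[OF hom] base_change_residue_deform[OF hom]
        by (auto simp: hilb_tangent_space_def)
    qed
    show "\<zero>\<^bsub>hilb_tangent_space (card B) I\<^esub> = deform I (\<Phi> (\<lambda>_. 0))"
    proof -
      have "\<Phi> (\<lambda>_. 0) = (\<lambda>_. 0)" by (simp add: \<Phi>_def fun_eq_iff)
      then show ?thesis by (simp add: hilb_tangent_space_def base_change_const)
    qed
  next
    fix c d
    show "deform I (\<Phi> c) \<oplus>\<^bsub>hilb_tangent_space (card B) I\<^esub> deform I (\<Phi> d)
        = deform I (\<Phi> (\<lambda>k. c k + d k))"
      by (simp add: hilb_tangent_space_def deform2_unique[OF hom hom] \<Phi>_add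
          base_change_sum_deform2[OF hom hom])
    show "a \<odot>\<^bsub>hilb_tangent_space (card B) I\<^esub> deform I (\<Phi> c) = deform I (\<Phi> (\<lambda>k. a * c k))" for a
      by (simp add: hilb_tangent_space_def base_change_rescale[OF hom] \<Phi>_mult)
    have diff: "\<Phi> c f - \<Phi> d f = \<Phi> (\<lambda>k. c k - d k) f" for f
      by (simp add: \<Phi>_def const_diff left_diff_distrib sum_subtractf)
    show "deform I (\<Phi> c) = deform I (\<Phi> d) \<longleftrightarrow> (\<forall>k\<in>K. c k = d k)"
      unfolding deform_eq_iff[OF I hom hom] diff
    proof
      assume "\<forall>f\<in>I. \<Phi> (\<lambda>k. c k - d k) f \<in> I"
      from indep[OF this] show "\<forall>k\<in>K. c k = d k" by simp
    next
      assume "\<forall>k\<in>K. c k = d k"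
      then have "\<Phi> (\<lambda>k. c k - d k) f = 0" for f by (simp add: \<Phi>_def)
      then show "\<forall>f\<in>I. \<Phi> (\<lambda>k. c k - d k) f \<in> I" using rmod.subspace_0[OF I] by simp
    qed
  qed
  show "free_of_rank (hilb_tangent_space (card B) I) (card K)" by (rule is_free_of_rank)
qed

end

section \<open>Coefficients and monomials\<close>

lemma single_eq_const_mult: "Poly_Mapping.single m c = const c * Poly_Mapping.single m 1"
  by (simp add: const_def mult_single)

lemma sum_single_keys:
  "(\<Sum>m\<in>Poly_Mapping.keys p. Poly_Mapping.single m (lookup p m)) = p"
  by (intro poly_mapping_eqI)
    (auto simp: lookup_sum lookup_single when_def in_keys_iff sum.delta)

text \<open>Multiplication by a variable merely shifts coefficients. With this induction the ideal
  property and linearity need checking only for three shifts, in \<open>subspaceI_poly3\<close> and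
  \<open>hom_modI\<close>.\<close>

lemma poly3_induct [case_names const X Y Z add]:
  fixes p :: "'a::comm_ring_1 poly3"
  assumes const: "\<And>c. P (const c)" and X: "\<And>p. P p \<Longrightarrow> P (varX * p)"
    and Y: "\<And>p. P p \<Longrightarrow> P (varY * p)" and Z: "\<And>p. P p \<Longrightarrow> P (varZ * p)"
    and add: "\<And>p q. P p \<Longrightarrow> P q \<Longrightarrow> P (p + q)"
  shows "P p"
proof (induction p rule: poly_mapping_induct_add)
  case zero
  show ?case using const[of 0] by simp
next
  case (single m c)
  obtain i j k where m: "m = (i, j, k)" by (cases m)
  have 0: "P (Poly_Mapping.single (0, 0, 0) c)"
    using const[of c] by (simp add: const_def zero_prod_def)
  have 1: "P (Poly_Mapping.single (0, 0, k) c)" for k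
  proof (induction k)
    case (Suc k)
    from Z[OF this] show ?case by (simp add: varZ_def mult_single)
  qed (rule 0)
  have 2: "P (Poly_Mapping.single (0, j, k) c)" for j k
  proof (induction j)
    case (Suc j)
    from Y[OF this] show ?case by (simp add: varY_def mult_single)
  qed (rule 1)
  have 3: "P (Poly_Mapping.single (i, j, k) c)" for i j k
  proof (induction i)
    case (Suc i)
    from X[OF this] show ?case by (simp add: varX_def mult_single)
  qed (rule 2)
  show ?case unfolding m by (rule 3)
qed (rule add)

lemma lookup_varX_mult:
    "lookup (varX * p) (a, b, c) = (if a = 0 then 0 else lookup p (a - 1, b, c))"
  and lookup_varY_mult:
    "lookup (varY * p) (a, b, c) = (if b = 0 then 0 else lookup p (a, b - 1, c))"
  and lookup_varZ_mult:
    "lookup (varZ * p) (a, b, c) = (if c = 0 then 0 else lookup p (a, b, c - 1))"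
  by (induction p rule: poly_mapping_induct_add;
      auto simp: varX_def varY_def varZ_def mult_single lookup_single when_def lookup_add
        distrib_left)+

lemma lookup_var:
  "lookup varX (a, b, c) = (if a = 1 \<and> b = 0 \<and> c = 0 then 1 else 0)"
  "lookup varY (a, b, c) = (if a = 0 \<and> b = 1 \<and> c = 0 then 1 else 0)"
  "lookup varZ (a, b, c) = (if a = 0 \<and> b = 0 \<and> c = 1 then 1 else 0)"
  by (auto simp: varX_def varY_def varZ_def lookup_single when_def)

lemmas lookup_simps = lookup_varX_mult lookup_varY_mult lookup_varZ_mult lookup_var
  lookup_const_mult lookup_add lookup_minus

lemma subspaceI_poly3:
  fixes J :: "'a::comm_ring_1 poly3 set"
  assumes zero: "0 \<in> J" and add: "\<And>p q. p \<in> J \<Longrightarrow> q \<in> J \<Longrightarrow> p + q \<in> J"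
    and const: "\<And>c p. p \<in> J \<Longrightarrow> const c * p \<in> J" and X: "\<And>p. p \<in> J \<Longrightarrow> varX * p \<in> J"
    and Y: "\<And>p. p \<in> J \<Longrightarrow> varY * p \<in> J" and Z: "\<And>p. p \<in> J \<Longrightarrow> varZ * p \<in> J"
  shows "rmod.subspace J"
proof (rule rmod.subspaceI)
  fix r p assume p: "p \<in> J"
  show "r * p \<in> J"
    by (induction r rule: poly3_induct)
      (simp_all add: p const X Y Z add distrib_right mult.assoc)
qed (fact zero add)+

lemma hom_modI:
  assumes I: "rmod.subspace I"
    and add: "\<And>f g. \<psi> (f + g) = \<psi> f + \<psi> g"
    and const: "\<And>c f. \<psi> (const c * f) = const c * \<psi> f"
    and X: "\<And>f. f \<in> I \<Longrightarrow> \<psi> (varX * f) - varX * \<psi> f \<in> I"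
    and Y: "\<And>f. f \<in> I \<Longrightarrow> \<psi> (varY * f) - varY * \<psi> f \<in> I"
    and Z: "\<And>f. f \<in> I \<Longrightarrow> \<psi> (varZ * f) - varZ * \<psi> f \<in> I"
  shows "hom_mod I \<psi>"
proof -
  have step: "\<psi> ((v * p) * f) - (v * p) * \<psi> f \<in> I"
    if v: "\<And>f. f \<in> I \<Longrightarrow> \<psi> (v * f) - v * \<psi> f \<in> I" and p: "\<psi> (p * f) - p * \<psi> f \<in> I"
      and f: "f \<in> I" for v p f
  proof -
    have "(\<psi> (v * (p * f)) - v * \<psi> (p * f)) + v * (\<psi> (p * f) - p * \<psi> f) \<in> I"
      by (intro rmod.subspace_add[OF I] rmod.subspace_scale[OF I] v p f)
    then show ?thesis by (simp add: algebra_simps)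
  qed
  have "\<psi> (r * f) - r * \<psi> f \<in> I" if f: "f \<in> I" for r f
  proof (induction r rule: poly3_induct)
    case (const c)
    then show ?case using rmod.subspace_0[OF I] by (simp add: assms(3))
  next
    case (add p q)
    from rmod.subspace_add[OF I this] show ?case by (simp add: assms(2) algebra_simps)
  qed (intro step X Y Z f; assumption)+
  then show ?thesis using rmod.subspace_0[OF I] by (simp add: hom_mod_def add)
qed

section \<open>The square of the ideal and its socle\<close>

text \<open>Exponents of the monomials outside the square of \<open>(x, y^2, y z, z^2)\<close>: ten
  free of \<open>x\<close>, and \<open>x\<close>, \<open>x y\<close>, \<open>x z\<close>.\<close>

definition low :: "(nat \<times> nat \<times> nat) set" where
  "low = {(0,0,0), (0,1,0), (0,0,1), (0,2,0), (0,1,1), (0,0,2), (0,3,0), (0,2,1), (0,1,2), (0,0,3),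
    (1,0,0), (1,1,0), (1,0,1)}"

lemma low_iff: "(a, b, c) \<in> low \<longleftrightarrow> a = 0 \<and> b + c \<le> 3 \<or> a = 1 \<and> b + c \<le> 1"
  unfolding low_def by (simp, presburger)

lemma finite_low: "finite low" and card_low: "card low = 13"
  by (simp_all add: low_def)

text \<open>The pairwise products of \<open>X, Y^2, Y Z, Z^2\<close>; there are nine since
  \<open>(Y Z)^2 = Y^2 Z^2\<close>. Nesting to the right lets the lookup rules for multiplication by
  a variable evaluate them.\<close>

definition generators :: "complex poly3 \<Rightarrow> complex poly3 \<Rightarrow> complex poly3 \<Rightarrow> complex poly3 set" where
  "generators X Y Z = {X * X, X * (Y * Y), X * (Y * Z), X * (Z * Z), Y * (Y * (Y * Y)),
    Y * (Y * (Y * Z)), Y * (Y * (Z * Z)), Y * (Z * (Z * Z)), Z * (Z * (Z * Z))}"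

lemma span_generators:
  "rmod.span (generators varX varY varZ) = {p. \<forall>m\<in>low. lookup p m = 0}" (is "?S = ?N")
proof (rule equalityI)
  have "rmod.subspace ?N"
    by (rule subspaceI_poly3) (simp_all add: low_def lookup_simps)
  then show "?S \<subseteq> ?N"
    by (rule rmod.span_minimal[rotated]) (simp add: generators_def low_def lookup_simps)
  show "?N \<subseteq> ?S"
  proof
    fix p assume p: "p \<in> ?N"
    have "Poly_Mapping.single m c \<in> ?S" if "m \<notin> low" for m c
    proof -
      obtain i j k where m: "m = (i, j, k)" by (cases m)
      \<comment> \<open>The exponents of the nine generators; the disjunction below says that every
        monomial outside \<open>low\<close> is a multiple of one of them.\<close>
      define G :: "(nat \<times> nat \<times> nat) set"
        where "G = {(2,0,0), (1,2,0), (1,1,1), (1,0,2), (0,4,0), (0,3,1), (0,2,2), (0,1,3), (0,0,4)}"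
      have "\<exists>i' j' k'. (i', j', k') \<in> G \<and> i' \<le> i \<and> j' \<le> j \<and> k' \<le> k"
      proof -
        have "2 \<le> i \<or> 1 \<le> i \<and> (2 \<le> j \<or> 1 \<le> j \<and> 1 \<le> k \<or> 2 \<le> k) \<or> 4 \<le> j \<or> 3 \<le> j \<and> 1 \<le> k
            \<or> 2 \<le> j \<and> 2 \<le> k \<or> 1 \<le> j \<and> 3 \<le> k \<or> 4 \<le> k"
          using that unfolding m low_iff by presburger
        then show ?thesis unfolding G_def
          by (elim disjE conjE)
            (rule exI[of _ 2] exI[of _ 1] exI[of _ 0] exI[of _ 3] exI[of _ 4] | force)+
      qed
      then obtain i' j' k' where g: "(i', j', k') \<in> G" "i' \<le> i" "j' \<le> j" "k' \<le> k" by blast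
      have "Poly_Mapping.single (i', j', k') 1 \<in> generators varX varY varZ"
        using g(1) unfolding G_def generators_def varX_def varY_def varZ_def mult_single
        by (elim insertE) (simp_all add: numeral_eq_Suc)
      then have "Poly_Mapping.single (i - i', j - j', k - k') c * Poly_Mapping.single (i', j', k') 1
          \<in> ?S"
        by (intro rmod.span_scale rmod.span_base)
      then show ?thesis using g by (simp add: m mult_single)
    qed
    then have "(\<Sum>m\<in>Poly_Mapping.keys p. Poly_Mapping.single m (lookup p m)) \<in> ?S"
      using p by (intro rmod.span_sum) (auto simp: in_keys_iff)
    then show "p \<in> ?S" by (simp add: sum_single_keys)
  qed
qed

text \<open>The first condition in \<open>socle_poly\<close> says that \<open>v\<close> lies in the socle modulo the generators,
  so that adding \<open>v\<close> to the ideal only adds the line through \<open>v\<close>.\<close>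

definition socle_poly :: "complex poly3 \<Rightarrow> bool" where
  "socle_poly v \<longleftrightarrow>
    (\<forall>m\<in>{(0,0,0), (1,0,0), (0,1,0), (0,0,1), (0,2,0), (0,1,1), (0,0,2)}. lookup v m = 0) \<and>
    (\<exists>m\<in>low. lookup v m \<noteq> 0)"

definition line_ideal :: "complex poly3 \<Rightarrow> complex poly3 set" where
  "line_ideal v = {p. \<exists>c. \<forall>m\<in>low. lookup p m = c * lookup v m}"

lemma span_insert_generators:
  assumes "socle_poly v"
  shows "rmod.span (insert v (generators varX varY varZ)) = line_ideal v"
proof (rule equalityI)
  have v: "\<forall>m\<in>low. lookup (varX * v) m = 0" "\<forall>m\<in>low. lookup (varY * v) m = 0"
      "\<forall>m\<in>low. lookup (varZ * v) m = 0"
    using assms by (simp_all add: socle_poly_def low_def lookup_simps)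
  have N: "rmod.subspace {p :: complex poly3. \<forall>m\<in>low. lookup p m = 0}"
    unfolding span_generators[symmetric] by (rule rmod.subspace_span)
  have mult: "u * p \<in> line_ideal v" if u: "\<forall>m\<in>low. lookup (u * v) m = 0" and p: "p \<in> line_ideal v"
    for u p
  proof -
    obtain c where c: "\<forall>m\<in>low. lookup p m = c * lookup v m" using p by (auto simp: line_ideal_def)
    then have "p - const c * v \<in> {p. \<forall>m\<in>low. lookup p m = 0}"
      by (simp add: lookup_minus lookup_const_mult)
    from rmod.subspace_add[OF N rmod.subspace_scale[OF N this, of u]
        rmod.subspace_scale[OF N, of "u * v" "const c"]] u
    have "u * p \<in> {p. \<forall>m\<in>low. lookup p m = 0}" by (simp add: algebra_simps)
    then show ?thesis by (auto simp: line_ideal_def intro: exI[of _ 0])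
  qed
  have sub: "rmod.subspace (line_ideal v)"
  proof (rule subspaceI_poly3)
    show "0 \<in> line_ideal v" by (auto simp: line_ideal_def intro: exI[of _ 0])
    show "p + q \<in> line_ideal v" if "p \<in> line_ideal v" "q \<in> line_ideal v" for p q
      using that unfolding line_ideal_def
      by (auto simp: lookup_add distrib_right[symmetric])
    show "const c * p \<in> line_ideal v" if "p \<in> line_ideal v" for c p
      using that unfolding line_ideal_def
      by (auto simp: lookup_const_mult intro: exI[of _ "c * _"])
  qed (use v mult in blast)+
  have "v \<in> line_ideal v" by (auto simp: line_ideal_def intro: exI[of _ 1])
  moreover have "rmod.span (generators varX varY varZ) \<subseteq> line_ideal v"
    unfolding span_generators by (auto simp: line_ideal_def intro: exI[of _ 0])
  ultimately show "rmod.span (insert v (generators varX varY varZ)) \<subseteq> line_ideal v"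
    using rmod.span_superset by (intro rmod.span_minimal sub) blast
  show "line_ideal v \<subseteq> rmod.span (insert v (generators varX varY varZ))"
  proof
    fix p assume "p \<in> line_ideal v"
    then obtain c where "\<forall>m\<in>low. lookup p m = c * lookup v m" by (auto simp: line_ideal_def)
    then have "p - const c * v \<in> rmod.span (generators varX varY varZ)"
      unfolding span_generators by (simp add: lookup_minus lookup_const_mult)
    then have "p - const c * v \<in> rmod.span (insert v (generators varX varY varZ))"
      using rmod.span_mono[OF subset_insertI] by blast
    from rmod.span_add[OF this rmod.span_scale[OF rmod.span_base[OF insertI1], of "const c"]]
    show "p \<in> rmod.span (insert v (generators varX varY varZ))" by simp
  qed
qed

text \<open>Subtracting \<open>t * v\<close> with \<open>t = lookup p \<mu> / lookup v \<mu>\<close>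
  eliminates the monomial \<open>\<mu>\<close>, and the other twelve monomials of \<open>low\<close>
  remain as a basis.\<close>

lemma quot_basis_line_ideal:
  assumes \<mu>: "\<mu> \<in> low" and v: "lookup v \<mu> \<noteq> 0"
  shows "quot_basis (line_ideal v) (low - {\<mu>}) (\<lambda>m. Poly_Mapping.single m 1)"
proof -
  let ?s = "\<lambda>c. \<Sum>m\<in>low - {\<mu>}. const (c m) * Poly_Mapping.single m 1"
  have s: "lookup (?s c) m = (if m \<in> low - {\<mu>} then c m else 0)" for c m
    using finite_low
    by (simp add: lookup_sum lookup_const_mult lookup_single when_def sum.delta' if_distrib cong: if_cong)
  show ?thesis
    unfolding quot_basis_def
  proof (intro conjI allI impI)
    fix p
    define t where "t = lookup p \<mu> / lookup v \<mu>"
    have "p - ?s (\<lambda>m. lookup p m - t * lookup v m) \<in> line_ideal v"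
      using v by (auto simp: line_ideal_def lookup_minus s t_def intro!: exI[of _ t])
    then show "\<exists>c. p - ?s c \<in> line_ideal v"
      by (rule exI[of _ "\<lambda>m. lookup p m - t * lookup v m"])
  next
    fix c assume "?s c \<in> line_ideal v"
    then obtain t where t: "\<forall>m\<in>low. lookup (?s c) m = t * lookup v m" by (auto simp: line_ideal_def)
    from bspec[OF t \<mu>] v have "t = 0" by (simp add: s)
    with t have "(if m \<in> low - {\<mu>} then c m else 0) = 0" if "m \<in> low" for m
      using that by (simp add: s)
    then show "\<forall>m\<in>low - {\<mu>}. c m = 0" by (metis DiffD1)
  qed (simp add: finite_low)
qed

section \<open>Homomorphisms for the ideal of x z + y^3\<close>

abbreviation "v0 \<equiv> varX * varZ + varY * (varY * varY) :: complex poly3"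

definition I0 :: "complex poly3 set" where "I0 = line_ideal v0"

lemma socle_poly_v0: "socle_poly v0"
  by (simp add: socle_poly_def low_def lookup_simps)

text \<open>Eliminating the scalar from \<open>line_ideal\<close> leaves one equation per dimension
  of the quotient: \<open>v0\<close> involves only \<open>x z\<close> and \<open>y^3\<close>, with
  equal coefficients. Later claims about \<open>I0\<close> are evaluations of these
  equations.\<close>

lemma I0_iff: "p \<in> I0 \<longleftrightarrow>
  lookup p (0,0,0) = 0 \<and> lookup p (1,0,0) = 0 \<and> lookup p (0,1,0) = 0 \<and> lookup p (0,0,1) = 0 \<and>
  lookup p (0,2,0) = 0 \<and> lookup p (0,1,1) = 0 \<and> lookup p (0,0,2) = 0 \<and> lookup p (1,1,0) = 0 \<and>
  lookup p (0,2,1) = 0 \<and> lookup p (0,1,2) = 0 \<and> lookup p (0,0,3) = 0 \<and>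
  lookup p (1,0,1) = lookup p (0,3,0)"
  by (auto simp: I0_def line_ideal_def low_def lookup_simps)

lemma I0_eq_span: "I0 = rmod.span (insert v0 (generators varX varY varZ))"
  by (simp add: I0_def span_insert_generators socle_poly_v0)

lemma subspace_I0: "rmod.subspace I0"
  unfolding I0_eq_span by (rule rmod.subspace_span)

text \<open>A minimal system of generators of \<open>I0\<close> and the dual coordinates on \<open>I0/\<mm>I0\<close>.\<close>

definition gen :: "nat \<Rightarrow> complex poly3" where
  "gen j = [varX * varX, varX * (varY * varY), varY * (varY * (varY * varY)),
    varY * (varY * (varY * varZ)), varY * (varY * (varZ * varZ)), varY * (varZ * (varZ * varZ)),
    varZ * (varZ * (varZ * varZ)), v0] ! j"

definition coord :: "nat \<Rightarrow> complex poly3 \<Rightarrow> complex" where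
  "coord j p = [lookup p (2,0,0), lookup p (1,2,0), lookup p (0,4,0) - lookup p (1,1,1),
    lookup p (0,3,1) - lookup p (1,0,2), lookup p (0,2,2), lookup p (0,1,3), lookup p (0,0,4),
    lookup p (1,0,1)] ! j"

text \<open>Monomials representing a basis of the socle of \<open>R/I0\<close>. The monomial
  \<open>x z\<close> is missing because it is congruent to \<open>- y^3\<close>.\<close>

definition soc :: "nat \<Rightarrow> nat \<times> nat \<times> nat" where
  "soc e = [(1,1,0), (0,3,0), (0,2,1), (0,1,2), (0,0,3)] ! e"

lemma less_5_iff: "(i::nat) < 5 \<longleftrightarrow> i = 0 \<or> i = 1 \<or> i = 2 \<or> i = 3 \<or> i = 4"
  by auto

lemma less_8_iff:
  "(i::nat) < 8 \<longleftrightarrow> i = 0 \<or> i = 1 \<or> i = 2 \<or> i = 3 \<or> i = 4 \<or> i = 5 \<or> i = 6 \<or> i = 7"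
  by auto

lemma sum_5: "(\<Sum>i<5. f i) = f 0 + f 1 + f 2 + f 3 + (f (4::nat) :: 'a::comm_monoid_add)"
  by (simp add: numeral_eq_Suc)

lemma I0_eq_span_gen: "I0 = rmod.span (gen ` {..<8})"
proof (rule equalityI)
  let ?S = "rmod.span (gen ` {..<8})"
  have gen: "gen j \<in> ?S" if "j < 8" for j
    using that by (intro rmod.span_base) simp
  \<comment> \<open>These are \<open>x y z = y v0 - y^4\<close> and
    \<open>x z^2 = z v0 - y^3 z\<close>, so two of the ten generators are redundant and eight
    remain.\<close>
  have "varY * gen 7 - gen 2 \<in> ?S" "varZ * gen 7 - gen 3 \<in> ?S"
    by (intro rmod.span_diff rmod.span_scale gen; simp)+
  then have "varX * (varY * varZ) \<in> ?S" "varX * (varZ * varZ) \<in> ?S"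
    by (simp_all add: gen_def algebra_simps)
  with gen[of 0] gen[of 1] gen[of 2] gen[of 3] gen[of 4] gen[of 5] gen[of 6] gen[of 7]
  have "insert v0 (generators varX varY varZ) \<subseteq> ?S"
    by (simp add: generators_def gen_def)
  then show "I0 \<subseteq> ?S" unfolding I0_eq_span by (rule rmod.span_minimal) (rule rmod.subspace_span)
  show "?S \<subseteq> I0"
    by (rule rmod.span_minimal[OF _ subspace_I0])
      (auto simp: less_8_iff gen_def I0_iff lookup_simps)
qed

lemma coord_gen: "j < 8 \<Longrightarrow> j' < 8 \<Longrightarrow> coord j (gen j') = (if j = j' then 1 else 0)"
  unfolding less_8_iff by (elim disjE; simp add: coord_def gen_def lookup_simps)

lemma coord_add: "j < 8 \<Longrightarrow> coord j (p + q) = coord j p + coord j q"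
  and coord_const: "j < 8 \<Longrightarrow> coord j (const c * p) = c * coord j p"
  unfolding less_8_iff by (elim disjE; simp add: coord_def lookup_simps right_diff_distrib)+

text \<open>The differences in \<open>coord 2\<close> and \<open>coord 3\<close> are chosen to
  vanish on \<open>y v0 = y^4 + x y z\<close> and \<open>z v0 = y^3 z + x z^2\<close>, which lie in
  \<open>m I0\<close>.\<close>

lemma coord_var:
  assumes "j < 8" "p \<in> I0"
  shows "coord j (varX * p) = 0" "coord j (varY * p) = 0" "coord j (varZ * p) = 0"
  using assms unfolding less_8_iff by (elim disjE; simp add: coord_def lookup_simps I0_iff)+

lemma var_mult_soc:
  assumes "e < 5"
  shows "varX * Poly_Mapping.single (soc e) c \<in> I0" "varY * Poly_Mapping.single (soc e) c \<in> I0"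
    "varZ * Poly_Mapping.single (soc e) c \<in> I0"
  using assms unfolding less_5_iff
  by (elim disjE; simp add: soc_def I0_iff lookup_simps lookup_single when_def)+

text \<open>Linearity is trivial: coordinates vanish on variable multiples of \<open>I0\<close>, and
  variables kill the socle modulo \<open>I0\<close>. These are the forty homomorphisms into the
  socle.\<close>

lemma hom_mod_coord:
  assumes j: "j < 8" and e: "e < 5"
  shows "hom_mod I0 (\<lambda>p. Poly_Mapping.single (soc e) (coord j p))"
proof (rule hom_modI[OF subspace_I0])
  show "Poly_Mapping.single (soc e) (coord j (const c * f))
      = const c * Poly_Mapping.single (soc e) (coord j f)" for c f
    unfolding coord_const[OF j] by (simp add: const_def mult_single)
qed (use j e rmod.subspace_neg[OF subspace_I0 var_mult_soc(1)[OF e]]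
      rmod.subspace_neg[OF subspace_I0 var_mult_soc(2)[OF e]]
      rmod.subspace_neg[OF subspace_I0 var_mult_soc(3)[OF e]]
    in \<open>simp_all add: coord_add coord_var single_add\<close>)

text \<open>\<open>special 0\<close> is \<open>\<partial>/\<partial>x\<close> modulo \<open>I0\<close>. The others agree, modulo homomorphisms into the socle,
  with the derivations \<open>\<partial>/\<partial>z\<close>, \<open>\<partial>/\<partial>y\<close>, \<open>y \<partial>/\<partial>x\<close> and \<open>z \<partial>/\<partial>x\<close>; they send \<open>v0\<close> to the
  entries of \<open>targets\<close>.\<close>

definition targets :: "nat \<Rightarrow> complex poly3" where
  "targets i = [varZ, varX, varY * varY, varY * varZ, varZ * varZ] ! i"

definition special :: "nat \<Rightarrow> complex poly3 \<Rightarrow> complex poly3" where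
  "special i p = const (lookup p (1,0,1)) * targets i + const (lookup p (1,1,1)) * (varY * targets i)
    + const (lookup p (1,0,2)) * (varZ * targets i) +
    (if i = 0 then const (2 * lookup p (2,0,0)) * varX + const (lookup p (1,2,0)) * (varY * varY)
      + const (2 * lookup p (2,1,0)) * (varX * varY) + const (2 * lookup p (2,0,1)) * (varX * varZ)
      + const (lookup p (1,3,0)) * (varY * (varY * varY))
      + const (lookup p (1,2,1)) * (varY * (varY * varZ))
      + const (lookup p (1,1,2)) * (varY * (varZ * varZ))
      + const (lookup p (1,0,3)) * (varZ * (varZ * varZ)) else 0)"

text \<open>For \<open>i > 0\<close> the target times \<open>x\<close>, or times a quadric in
  \<open>y, z\<close>, lies in \<open>I0\<close>, so three coefficients suffice. For
  \<open>i = 0\<close> the product \<open>x z\<close> survives: on \<open>x f\<close> the terms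
  \<open>2 x z\<close> and \<open>y^3\<close> appear with the coefficient of \<open>x z\<close> in
  \<open>f\<close>, and subtracting \<open>x z\<close> leaves a multiple of
  \<open>v0\<close>.\<close>

lemma hom_mod_special:
  assumes "i < 5"
  shows "hom_mod I0 (special i)"
proof (rule hom_modI[OF subspace_I0])
  show "special i (f + g) = special i f + special i g" for f g
    by (simp add: special_def lookup_simps const_add algebra_simps)
  show "special i (const c * f) = const c * special i f" for c f
    unfolding special_def lookup_const_mult by (simp add: const_mult algebra_simps)
  fix f assume f: "f \<in> I0"
  show "special i (varX * f) - varX * special i f \<in> I0"
    "special i (varY * f) - varY * special i f \<in> I0"
    "special i (varZ * f) - varZ * special i f \<in> I0"
    using assms f unfolding less_5_iff
    by (elim disjE; simp add: special_def targets_def I0_iff lookup_simps)+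
qed

text \<open>A homomorphism carries each syzygy of the generators to a congruence between its values.
  The syzygies below have this three-term shape, with \<open>t = 0\<close> for the two-term
  ones.\<close>

lemma hom_mod_rel:
  assumes \<psi>: "hom_mod I0 \<psi>" and g: "g \<in> I0" "h \<in> I0" "k \<in> I0" and rel: "r * g = s * h + t * k"
  shows "r * \<psi> g - (s * \<psi> h + t * \<psi> k) \<in> I0"
proof -
  note I = subspace_I0
  have cl: "u * f \<in> I0" if "f \<in> I0" for u f by (rule rmod.subspace_scale[OF I that])
  have a: "\<psi> (s * h + t * k) - (\<psi> (s * h) + \<psi> (t * k)) \<in> I0"
    using \<psi> cl g by (simp add: hom_mod_def)
  have b: "\<psi> (u * f) - u * \<psi> f \<in> I0" if "f \<in> I0" for u f
    using \<psi> that by (simp add: hom_mod_def)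
  have "(\<psi> (s * h + t * k) - (\<psi> (s * h) + \<psi> (t * k))) - (\<psi> (r * g) - r * \<psi> g) +
      (\<psi> (s * h) - s * \<psi> h) + (\<psi> (t * k) - t * \<psi> k) \<in> I0"
    by (rule rmod.subspace_add[OF I rmod.subspace_add[OF I rmod.subspace_diff[OF I a b] b] b])
      (fact g)+
  then show ?thesis unfolding rel[symmetric] by (simp add: algebra_simps)
qed

lemma gen_in_I0: "j < 8 \<Longrightarrow> gen j \<in> I0"
  unfolding I0_eq_span_gen by (rule rmod.span_base) simp

definition in_socle :: "complex poly3 \<Rightarrow> bool" where
  "in_socle p \<longleftrightarrow> lookup p (0,0,0) = 0 \<and> lookup p (1,0,0) = 0 \<and> lookup p (0,1,0) = 0 \<and>
    lookup p (0,0,1) = 0 \<and> lookup p (0,2,0) = 0 \<and> lookup p (0,1,1) = 0 \<and> lookup p (0,0,2) = 0"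

text \<open>The assumptions \<open>w\<close> hold once suitable multiples of the
  \<open>special i\<close> are subtracted. The syzygies are \<open>x v0 = z x^2 + y (x y^2)\<close>,
  \<open>y^2 v0 = z (x y^2) + y y^4\<close>, and the four between neighbouring quartics in
  \<open>y, z\<close>; comparing coefficients in them rules out every value outside the
  socle.\<close>

lemma hom_mod_in_socle:
  assumes \<psi>: "hom_mod I0 \<psi>"
    and w: "lookup (\<psi> (gen 7)) (0,0,1) = 0" "lookup (\<psi> (gen 7)) (1,0,0) = 0"
      "lookup (\<psi> (gen 7)) (0,2,0) = 0" "lookup (\<psi> (gen 7)) (0,1,1) = 0"
      "lookup (\<psi> (gen 7)) (0,0,2) = 0"
    and j: "j < 8"
  shows "in_socle (\<psi> (gen j))"
proof -
  note rel = hom_mod_rel[OF \<psi> gen_in_I0 gen_in_I0 gen_in_I0]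
  have r1: "varX * \<psi> (gen 7) - (varZ * \<psi> (gen 0) + varY * \<psi> (gen 1)) \<in> I0"
    by (rule rel) (simp_all add: gen_def algebra_simps)
  have r2: "(varY * varY) * \<psi> (gen 7) - (varZ * \<psi> (gen 1) + varY * \<psi> (gen 2)) \<in> I0"
    by (rule rel) (simp_all add: gen_def algebra_simps)
  have r3: "varZ * \<psi> (gen 2) - (varY * \<psi> (gen 3) + 0 * \<psi> (gen 0)) \<in> I0"
    by (rule rel) (simp_all add: gen_def algebra_simps)
  have r4: "varZ * \<psi> (gen 3) - (varY * \<psi> (gen 4) + 0 * \<psi> (gen 0)) \<in> I0"
    by (rule rel) (simp_all add: gen_def algebra_simps)
  have r5: "varZ * \<psi> (gen 4) - (varY * \<psi> (gen 5) + 0 * \<psi> (gen 0)) \<in> I0"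
    by (rule rel) (simp_all add: gen_def algebra_simps)
  have r6: "varZ * \<psi> (gen 5) - (varY * \<psi> (gen 6) + 0 * \<psi> (gen 0)) \<in> I0"
    by (rule rel) (simp_all add: gen_def algebra_simps)
  let ?q = "\<lambda>j. lookup (\<psi> (gen j))"
  note defs = I0_iff lookup_simps mult.assoc
  have 1: "?q 7 (0,0,0) = 0" "?q 1 (0,0,0) = 0" "?q 0 (0,0,0) = 0" "?q 1 (0,1,0) = 0"
      "- ?q 0 (0,1,0) = ?q 1 (0,0,1)" "?q 0 (0,0,1) = 0" "?q 7 (0,1,0) = ?q 1 (1,0,0)"
      "?q 0 (1,0,0) = ?q 1 (0,2,0)" "- ?q 0 (0,2,0) = ?q 1 (0,1,1)" "- ?q 0 (0,1,1) = ?q 1 (0,0,2)"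
      "?q 0 (0,0,2) = 0"
    using r1 w by (simp_all add: defs)
  have 2: "?q 2 (0,0,0) = 0" "?q 2 (0,1,0) = 0" "?q 2 (0,0,1) = 0" "?q 1 (0,0,1) = 0"
      "?q 2 (1,0,0) = 0" "?q 2 (0,2,0) = ?q 7 (0,1,0) + ?q 1 (1,0,0)"
      "?q 1 (0,2,0) = - ?q 2 (0,1,1)" "- ?q 1 (0,1,1) = ?q 2 (0,0,2)" "?q 1 (0,0,2) = 0"
    using r2 w 1 by (simp_all add: defs eq_neg_iff_add_eq_0)
  have 3: "?q 3 (0,0,0) = 0" "?q 3 (0,1,0) = 0" "?q 3 (0,0,1) = 0" "?q 3 (1,0,0) = 0"
      "?q 3 (0,2,0) = 0" "?q 3 (0,1,1) = ?q 2 (0,2,0)" "?q 3 (0,0,2) = ?q 2 (0,1,1)"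
      "?q 2 (0,0,2) = 0"
    using r3 2 by (simp_all add: defs)
  have 4: "?q 4 (0,0,0) = 0" "?q 4 (0,1,0) = 0" "?q 4 (0,0,1) = 0" "?q 4 (1,0,0) = 0"
      "?q 4 (0,2,0) = 0" "?q 4 (0,1,1) = 0" "?q 4 (0,0,2) = ?q 3 (0,1,1)" "?q 3 (0,0,2) = 0"
    using r4 3 by (simp_all add: defs)
  have 5: "?q 5 (0,0,0) = 0" "?q 5 (0,1,0) = 0" "?q 5 (0,0,1) = 0" "?q 5 (1,0,0) = 0"
      "?q 5 (0,2,0) = 0" "?q 5 (0,1,1) = 0" "?q 5 (0,0,2) = 0" "?q 4 (0,0,2) = 0"
    using r5 4 by (simp_all add: defs)
  have 6: "?q 6 (0,0,0) = 0" "?q 6 (0,1,0) = 0" "?q 6 (0,0,1) = 0" "?q 6 (1,0,0) = 0"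
      "?q 6 (0,2,0) = 0" "?q 6 (0,1,1) = 0" "?q 6 (0,0,2) = 0"
    using r6 5 by (simp_all add: defs)
  \<comment> \<open>Along the quartics a coefficient is passed on: \<open>y^2\<close> at
    \<open>y^4\<close> becomes \<open>y z\<close> at \<open>y^3 z\<close> and \<open>z^2\<close> at
    \<open>y^2 z^2\<close>, where \<open>r5\<close> kills it. The chain starting with
    \<open>y z\<close> at \<open>y^4\<close> ends one step earlier, by \<open>r4\<close>.\<close>
  have 7: "?q 2 (0,2,0) = 0" "?q 2 (0,1,1) = 0"
    by (simp_all only: 3(6)[symmetric] 3(7)[symmetric] 4(7)[symmetric] 4(8) 5(8))
  \<comment> \<open>The linear coefficient absent from \<open>w\<close>: \<open>r1\<close> and
    \<open>r2\<close> give \<open>?q 2 (0,2,0) = 2 * ?q 7 (0,1,0)\<close>, and the left side is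
    zero.\<close>
  have 8: "?q 7 (0,1,0) = 0"
    using 2(6) 1(7) 7(1) by simp
  have socle: "in_socle (\<psi> (gen 0))" "in_socle (\<psi> (gen 1))" "in_socle (\<psi> (gen 2))"
    "in_socle (\<psi> (gen 3))" "in_socle (\<psi> (gen 4))" "in_socle (\<psi> (gen 5))"
    "in_socle (\<psi> (gen 6))" "in_socle (\<psi> (gen 7))"
  proof -
    have 9: "?q 1 (0,2,0) = 0" "?q 1 (0,1,1) = 0" "?q 1 (1,0,0) = 0"
      using 2(7,8) 3(8) 7(2) 1(7) 8 by simp_all
    show "in_socle (\<psi> (gen 0))" unfolding in_socle_def using 1 2(4,9) 9 by simp
    show "in_socle (\<psi> (gen 1))" unfolding in_socle_def using 1(2,4) 2(4,9) 9 by simp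
    show "in_socle (\<psi> (gen 2))" unfolding in_socle_def using 2(1-3,5) 3(8) 7 by simp
    show "in_socle (\<psi> (gen 3))" unfolding in_socle_def using 3(1-6) 4(8) 7 by simp
    show "in_socle (\<psi> (gen 4))" unfolding in_socle_def using 4(1-6) 5(8) by simp
    show "in_socle (\<psi> (gen 5))" unfolding in_socle_def using 5(1-7) by simp
    show "in_socle (\<psi> (gen 6))" unfolding in_socle_def using 6 by simp
    show "in_socle (\<psi> (gen 7))" unfolding in_socle_def using 1(1) 8 w by simp
  qed
  show ?thesis using j unfolding less_8_iff by (elim disjE) (simp_all only: socle)
qed

definition hom_index :: "(nat + nat \<times> nat) set" where
  "hom_index = {..<5} <+> ({..<8} \<times> {..<5})"

text \<open>Spanning takes two subtractions: the \<open>special i\<close> adjust the value at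
  \<open>v0\<close>, after which all values on generators lie in the socle and the coordinate
  homomorphisms remove them. What is left maps the generators, and hence \<open>I0\<close>, into
  \<open>I0\<close>.\<close>

lemma hom_basis_I0:
  "hom_basis I0 hom_index
     (case_sum special (\<lambda>(j, e) p. Poly_Mapping.single (soc e) (coord j p)))"
proof -
  let ?K = hom_index
  let ?\<phi> = "case_sum special (\<lambda>(j, e) p. Poly_Mapping.single (soc e) (coord j p))"
  have sum_K: "(\<Sum>k\<in>?K. const (c k) * ?\<phi> k p) = (\<Sum>i<5. const (c (Inl i)) * special i p) +
      (\<Sum>j<8. \<Sum>e<5. const (c (Inr (j, e))) * Poly_Mapping.single (soc e) (coord j p))" for c p
    by (simp add: sum.Plus sum.cartesian_product split_def hom_index_def)
  have sum_gen: "(\<Sum>k\<in>?K. const (c k) * ?\<phi> k (gen j)) = (\<Sum>i<5. const (c (Inl i)) * special i (gen j)) +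
      (\<Sum>e<5. Poly_Mapping.single (soc e) (c (Inr (j, e))))" if "j < 8" for c j
  proof -
    have "(\<Sum>j'<8. \<Sum>e<5. const (c (Inr (j', e))) * Poly_Mapping.single (soc e) (coord j' (gen j)))
        = (\<Sum>j'<8. if j' = j then \<Sum>e<5. Poly_Mapping.single (soc e) (c (Inr (j, e))) else 0)"
      using that by (intro sum.cong refl) (auto simp: coord_gen const_def mult_single)
    then show ?thesis using that by (simp add: sum_K)
  qed
  have special_v0: "special i v0 = targets i" for i
    by (simp add: special_def lookup_simps)
  show ?thesis
    unfolding hom_basis_def
  proof (intro conjI ballI allI impI)
    show "finite ?K" by (simp add: hom_index_def)
    show "hom_mod I0 (?\<phi> k)" if "k \<in> ?K" for k
      using that hom_mod_special hom_mod_coord by (auto simp: hom_index_def)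
  next
    fix \<psi> assume \<psi>: "hom_mod I0 \<psi>"
    \<comment> \<open>The exponents of \<open>z, x, y^2, y z, z^2\<close>, in the order of
      \<open>targets\<close>.\<close>
    define t where "t i = lookup (\<psi> v0)
      ([(0,0,1), (1,0,0), (0,2,0), (0,1,1), (0,0,2)] ! i)" for i :: nat
    define \<chi> where "\<chi> p = \<psi> p + const (- 1) * (\<Sum>i<5. const (t i) * special i p)" for p
    have \<chi>: "hom_mod I0 \<chi>"
      unfolding \<chi>_def[abs_def]
      by (intro hom_mod_add hom_mod_mult hom_mod_sum subspace_I0 \<psi>) (simp add: hom_mod_special)
    have "in_socle (\<chi> (gen j))" if "j < 8" for j
    proof (rule hom_mod_in_socle[OF \<chi> _ _ _ _ _ that])
      have "\<chi> (gen 7) = \<psi> v0 + const (- 1) * (\<Sum>i<5. const (t i) * targets i)"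
        by (simp add: \<chi>_def gen_def special_v0)
      then show "lookup (\<chi> (gen 7)) (0,0,1) = 0" "lookup (\<chi> (gen 7)) (1,0,0) = 0"
        "lookup (\<chi> (gen 7)) (0,2,0) = 0" "lookup (\<chi> (gen 7)) (0,1,1) = 0"
        "lookup (\<chi> (gen 7)) (0,0,2) = 0"
        by (simp_all add: sum_5 lookup_simps t_def targets_def)
    qed
    then have soc: "in_socle (\<chi> (gen j))" if "j < 8" for j using that by blast
    \<comment> \<open>For \<open>e = 1\<close> the coefficient of \<open>x z\<close> is subtracted,
      as \<open>x z\<close> is congruent to \<open>- y^3\<close> modulo \<open>I0\<close>.\<close>
    define c where "c = case_sum t (\<lambda>(j, e).
      if e = 1 then lookup (\<chi> (gen j)) (0,3,0) - lookup (\<chi> (gen j)) (1,0,1)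
      else lookup (\<chi> (gen j)) (soc e))"
    define \<omega> where "\<omega> p = \<psi> p + const (- 1) * (\<Sum>k\<in>?K. const (c k) * ?\<phi> k p)" for p
    have \<omega>: "hom_mod I0 \<omega>"
      unfolding \<omega>_def[abs_def]
      by (intro hom_mod_add hom_mod_mult hom_mod_sum subspace_I0 \<psi>)
        (auto simp: hom_mod_special hom_mod_coord hom_index_def)
    have \<omega>_gen: "\<omega> (gen j) \<in> I0" if j: "j < 8" for j
    proof -
      have "\<omega> (gen j) = \<chi> (gen j) - (\<Sum>e<5. Poly_Mapping.single (soc e) (c (Inr (j, e))))"
        by (simp add: \<omega>_def sum_gen[OF j] \<chi>_def c_def const_def[of "-1"] single_uminus)
      then show ?thesis
        using soc[OF j]
        by (simp add: sum_5 in_socle_def I0_iff lookup_simps lookup_single when_def soc_def c_def)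
    qed
    have "f \<in> I0 \<and> \<omega> f \<in> I0" if "f \<in> rmod.span (gen ` {..<8})" for f
      using that
    proof (induction f rule: rmod.span_induct_alt)
      case base
      then show ?case
        using hom_mod_0[OF subspace_I0 \<omega>] rmod.subspace_0[OF subspace_I0] by blast
    next
      case (step r x y)
      then obtain j where j: "j < 8" "x = gen j" by auto
      have y: "y \<in> I0" "\<omega> y \<in> I0" using step by blast+
      have x: "x \<in> I0" using gen_in_I0 j by simp
      have rx: "r * x \<in> I0" by (rule rmod.subspace_scale[OF subspace_I0 x])
      have "(\<omega> (r * x + y) - (\<omega> (r * x) + \<omega> y)) + (\<omega> (r * x) - r * \<omega> x) + r * \<omega> x + \<omega> y \<in> I0"
      proof (intro rmod.subspace_add[OF subspace_I0])
        show "\<omega> (r * x + y) - (\<omega> (r * x) + \<omega> y) \<in> I0" "\<omega> (r * x) - r * \<omega> x \<in> I0"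
          using \<omega> rx x y by (simp_all add: hom_mod_def)
        show "r * \<omega> x \<in> I0" using \<omega>_gen j by (simp add: rmod.subspace_scale[OF subspace_I0])
      qed (fact y)
      then show ?case using rmod.subspace_add[OF subspace_I0 rx y(1)] by simp
    qed
    then have "\<psi> f - (\<Sum>k\<in>?K. const (c k) * ?\<phi> k f) \<in> I0" if "f \<in> I0" for f
      using that by (simp add: I0_eq_span_gen \<omega>_def const_def[of "-1"] single_uminus)
    then show "\<exists>c. \<forall>f\<in>I0. \<psi> f - (\<Sum>k\<in>?K. const (c k) * ?\<phi> k f) \<in> I0" by blast
  next
    fix c k assume c: "\<forall>f\<in>I0. (\<Sum>k\<in>?K. const (c k) * ?\<phi> k f) \<in> I0" and k: "k \<in> ?K"
    \<comment> \<open>At \<open>v0\<close> the targets are independent modulo the socle, which kills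
      the coefficients of the \<open>special i\<close>; evaluation at \<open>gen j\<close> then
      isolates the five coefficients belonging to \<open>j\<close>.\<close>
    have "(\<Sum>i<5. const (c (Inl i)) * targets i) +
        (\<Sum>e<5. Poly_Mapping.single (soc e) (c (Inr (7, e)))) \<in> I0"
      using bspec[OF c gen_in_I0[of 7]] sum_gen[of 7 c] by (simp add: gen_def special_v0)
    then have Inl: "c (Inl i) = 0" if "i < 5" for i
      using that unfolding less_5_iff
      by (elim disjE; simp add: sum_5 I0_iff lookup_simps lookup_single when_def soc_def targets_def)
    have "c (Inr (j, e)) = 0" if j: "j < 8" and e: "e < 5" for j e
    proof -
      have "(\<Sum>e<5. Poly_Mapping.single (soc e) (c (Inr (j, e)))) \<in> I0"
        using bspec[OF c gen_in_I0[OF j]] sum_gen[OF j, of c] by (simp add: Inl)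
      then show ?thesis
        using e unfolding less_5_iff
        by (elim disjE; simp add: sum_5 I0_iff lookup_simps lookup_single when_def soc_def)
    qed
    with Inl show "c k = 0" using k by (auto simp: hom_index_def)
  qed
qed

lemma card_hom_index: "card hom_index = 45"
  by (simp add: hom_index_def card_Plus)

section \<open>Automorphisms of the polynomial ring\<close>

definition alg_hom :: "(complex poly3 \<Rightarrow> complex poly3) \<Rightarrow> bool" where
  "alg_hom \<sigma> \<longleftrightarrow> (\<forall>p q. \<sigma> (p + q) = \<sigma> p + \<sigma> q) \<and> (\<forall>p q. \<sigma> (p * q) = \<sigma> p * \<sigma> q) \<and>
     (\<forall>c. \<sigma> (const c) = const c)"

lemma alg_homD:
  assumes "alg_hom \<sigma>"
  shows "\<sigma> (p + q) = \<sigma> p + \<sigma> q" "\<sigma> (p * q) = \<sigma> p * \<sigma> q" "\<sigma> (const c) = const c" "\<sigma> 0 = 0"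
    "\<sigma> 1 = 1" "\<sigma> (- p) = - \<sigma> p" "\<sigma> (p - q) = \<sigma> p - \<sigma> q" "\<sigma> (\<Sum>k\<in>K. f k) = (\<Sum>k\<in>K. \<sigma> (f k))"
proof -
  show add: "\<sigma> (p + q) = \<sigma> p + \<sigma> q" for p q using assms by (simp add: alg_hom_def)
  show "\<sigma> (p * q) = \<sigma> p * \<sigma> q" and const: "\<sigma> (const c) = const c" for p q c
    using assms by (simp_all add: alg_hom_def)
  show 0: "\<sigma> 0 = 0" and "\<sigma> 1 = 1" using const[of 0] const[of 1] by simp_all
  show neg: "\<sigma> (- p) = - \<sigma> p" for p using add[of p "- p"] 0 by (simp add: eq_neg_iff_add_eq_0 add.commute)
  show "\<sigma> (p - q) = \<sigma> p - \<sigma> q" using add[of p "- q"] neg[of q] by simp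
  show "\<sigma> (\<Sum>k\<in>K. f k) = (\<Sum>k\<in>K. \<sigma> (f k))"
    by (induction K rule: infinite_finite_induct) (simp_all add: 0 add)
qed

lemma alg_hom_ext:
  assumes "alg_hom \<sigma>" "alg_hom \<tau>" "\<sigma> varX = \<tau> varX" "\<sigma> varY = \<tau> varY" "\<sigma> varZ = \<tau> varZ"
  shows "\<sigma> p = \<tau> p"
  by (induction p rule: poly3_induct) (simp_all add: assms(3-5) alg_homD[OF assms(1)] alg_homD[OF assms(2)])

lemma alg_hom_comp: "alg_hom \<sigma> \<Longrightarrow> alg_hom \<tau> \<Longrightarrow> alg_hom (\<lambda>p. \<sigma> (\<tau> p))"
  by (simp add: alg_hom_def)

lemma alg_hom_id: "alg_hom (\<lambda>p. p)"
  by (simp add: alg_hom_def)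

definition subst ::
    "complex poly3 \<Rightarrow> complex poly3 \<Rightarrow> complex poly3 \<Rightarrow> complex poly3 \<Rightarrow> complex poly3" where
  "subst X Y Z p = (\<Sum>m\<in>Poly_Mapping.keys p.
     const (lookup p m) * (case m of (a, b, c) \<Rightarrow> X^a * Y^b * Z^c))"

lemma subst_single: "subst X Y Z (Poly_Mapping.single (a, b, c) d) = const d * (X^a * Y^b * Z^c)"
  by (simp add: subst_def)

lemma subst_add: "subst X Y Z (p + q) = subst X Y Z p + subst X Y Z q"
proof -
  let ?e = "\<lambda>m. case m of (a, b, c) \<Rightarrow> X^a * Y^b * Z^c"
  have *: "subst X Y Z r = (\<Sum>m\<in>S. const (lookup r m) * ?e m)"
    if "finite S" "Poly_Mapping.keys r \<subseteq> S" for r S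
    unfolding subst_def by (rule sum.mono_neutral_left) (use that in \<open>auto simp: in_keys_iff\<close>)
  let ?S = "Poly_Mapping.keys p \<union> Poly_Mapping.keys q"
  have "subst X Y Z (p + q) = (\<Sum>m\<in>?S. const (lookup (p + q) m) * ?e m)"
    by (rule *) (simp_all add: keys_add)
  also have "\<dots> = (\<Sum>m\<in>?S. const (lookup p m) * ?e m) + (\<Sum>m\<in>?S. const (lookup q m) * ?e m)"
    by (simp add: lookup_add const_add distrib_right sum.distrib)
  also have "\<dots> = subst X Y Z p + subst X Y Z q"
    by (simp add: *[of ?S])
  finally show ?thesis .
qed

lemma subst_mult: "subst X Y Z (p * q) = subst X Y Z p * subst X Y Z q"
proof (induction p rule: poly_mapping_induct_add)
  case (single m d)
  obtain a b c where m: "m = (a, b, c)" by (cases m)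
  show ?case
  proof (induction q rule: poly_mapping_induct_add)
    case (single m' d')
    obtain a' b' c' where m': "m' = (a', b', c')" by (cases m')
    show ?case by (simp add: m m' mult_single subst_single const_mult power_add algebra_simps)
  qed (simp_all add: subst_add distrib_left subst_def[of _ _ _ 0])
qed (simp_all add: subst_add distrib_right subst_def[of _ _ _ 0])

lemma alg_hom_subst: "alg_hom (subst X Y Z)"
proof -
  have "subst X Y Z (const c) = const c" for c
    using subst_single[of X Y Z 0 0 0 c] by (simp add: const_def zero_prod_def)
  then show ?thesis by (simp add: alg_hom_def subst_add subst_mult)
qed

lemma subst_var [simp]:
  "subst X Y Z varX = X" "subst X Y Z varY = Y" "subst X Y Z varZ = Z"
  by (simp_all add: varX_def varY_def varZ_def subst_single)

definition alg_iso :: "(complex poly3 \<Rightarrow> complex poly3) \<Rightarrow> (complex poly3 \<Rightarrow> complex poly3) \<Rightarrow> bool" where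
  "alg_iso \<sigma> \<tau> \<longleftrightarrow> alg_hom \<sigma> \<and> alg_hom \<tau> \<and> (\<forall>p. \<sigma> (\<tau> p) = p) \<and> (\<forall>p. \<tau> (\<sigma> p) = p)"

lemma alg_isoI:
  assumes \<sigma>: "alg_hom \<sigma>" and \<tau>: "alg_hom \<tau>"
    and "\<sigma> (\<tau> varX) = varX" "\<sigma> (\<tau> varY) = varY" "\<sigma> (\<tau> varZ) = varZ"
    and "\<tau> (\<sigma> varX) = varX" "\<tau> (\<sigma> varY) = varY" "\<tau> (\<sigma> varZ) = varZ"
  shows "alg_iso \<sigma> \<tau>"
proof -
  have "\<sigma> (\<tau> p) = p" for p
    by (rule alg_hom_ext[OF alg_hom_comp[OF \<sigma> \<tau>] alg_hom_id]) (fact assms)+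
  moreover have "\<tau> (\<sigma> p) = p" for p
    by (rule alg_hom_ext[OF alg_hom_comp[OF \<tau> \<sigma>] alg_hom_id]) (fact assms)+
  ultimately show ?thesis using assms by (simp add: alg_iso_def)
qed

lemma image_span:
  assumes "alg_iso \<sigma> \<tau>"
  shows "\<sigma> ` rmod.span S = rmod.span (\<sigma> ` S)"
proof -
  have sub: "\<sigma> ` rmod.span S \<subseteq> rmod.span (\<sigma> ` S)" if "alg_hom \<sigma>" for \<sigma> S
  proof
    fix q assume "q \<in> \<sigma> ` rmod.span S"
    then obtain p where "p \<in> rmod.span S" "q = \<sigma> p" by blast
    moreover have "\<sigma> p \<in> rmod.span (\<sigma> ` S)" if "p \<in> rmod.span S" for p
      using that
    proof (induction p rule: rmod.span_induct_alt)
      case base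
      then show ?case by (simp add: alg_homD[OF \<open>alg_hom \<sigma>\<close>] rmod.span_zero)
    next
      case (step c x y)
      then have "\<sigma> c * \<sigma> x + \<sigma> y \<in> rmod.span (\<sigma> ` S)"
        by (intro rmod.span_add[OF rmod.span_scale[OF rmod.span_base]]) auto
      then show ?case by (simp add: alg_homD[OF \<open>alg_hom \<sigma>\<close>])
    qed
    ultimately show "q \<in> rmod.span (\<sigma> ` S)" by blast
  qed
  show ?thesis
  proof (rule equalityI)
    show "\<sigma> ` rmod.span S \<subseteq> rmod.span (\<sigma> ` S)"
      using assms by (intro sub) (simp add: alg_iso_def)
    have "\<tau> ` rmod.span (\<sigma> ` S) \<subseteq> rmod.span (\<tau> ` (\<sigma> ` S))"
      using assms by (intro sub) (simp add: alg_iso_def)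
    also have "\<tau> ` (\<sigma> ` S) = S" using assms by (simp add: alg_iso_def image_image)
    finally have "\<sigma> ` (\<tau> ` rmod.span (\<sigma> ` S)) \<subseteq> \<sigma> ` rmod.span S" by (rule image_mono)
    then show "rmod.span (\<sigma> ` S) \<subseteq> \<sigma> ` rmod.span S"
      using assms by (simp add: alg_iso_def image_image)
  qed
qed

context
  fixes \<sigma> \<tau> :: "complex poly3 \<Rightarrow> complex poly3" and I :: "complex poly3 set"
  assumes iso: "alg_iso \<sigma> \<tau>"
begin

lemma alg_iso_simps:
  "\<sigma> (p + q) = \<sigma> p + \<sigma> q" "\<sigma> (p * q) = \<sigma> p * \<sigma> q" "\<sigma> (p - q) = \<sigma> p - \<sigma> q" "\<sigma> (const c) = const c"
  "\<tau> (p + q) = \<tau> p + \<tau> q" "\<tau> (p * q) = \<tau> p * \<tau> q" "\<tau> (p - q) = \<tau> p - \<tau> q" "\<tau> (const c) = const c"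
  "\<sigma> (\<tau> p) = p" "\<tau> (\<sigma> p) = p"
  "\<sigma> (\<Sum>k\<in>K. f k) = (\<Sum>k\<in>K. \<sigma> (f k))" "\<tau> (\<Sum>k\<in>K. f k) = (\<Sum>k\<in>K. \<tau> (f k))"
proof -
  have "alg_hom \<sigma>" "alg_hom \<tau>" using iso by (simp_all add: alg_iso_def)
  note hom = this[THEN alg_homD(1)] this[THEN alg_homD(2)] this[THEN alg_homD(3)]
    this[THEN alg_homD(7)] this[THEN alg_homD(8)]
  show "\<sigma> (p + q) = \<sigma> p + \<sigma> q" "\<sigma> (p * q) = \<sigma> p * \<sigma> q" "\<sigma> (p - q) = \<sigma> p - \<sigma> q"
    "\<sigma> (const c) = const c" "\<tau> (p + q) = \<tau> p + \<tau> q" "\<tau> (p * q) = \<tau> p * \<tau> q"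
    "\<tau> (p - q) = \<tau> p - \<tau> q" "\<tau> (const c) = const c"
    "\<sigma> (\<Sum>k\<in>K. f k) = (\<Sum>k\<in>K. \<sigma> (f k))" "\<tau> (\<Sum>k\<in>K. f k) = (\<Sum>k\<in>K. \<tau> (f k))"
    by (fact hom)+
  show "\<sigma> (\<tau> p) = p" "\<tau> (\<sigma> p) = p" using iso by (simp_all add: alg_iso_def)
qed

lemma mem_image_iff: "p \<in> \<sigma> ` I \<longleftrightarrow> \<tau> p \<in> I"
  by (metis alg_iso_simps(9,10) image_iff)

lemma subspace_image:
  assumes "rmod.subspace I"
  shows "rmod.subspace (\<sigma> ` I)"
proof (rule rmod.subspaceI)
  have "\<tau> 0 = 0" using alg_iso_simps(7)[of 0 0] by simp
  then show "0 \<in> \<sigma> ` I" by (simp add: mem_image_iff rmod.subspace_0[OF assms])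
qed (simp_all add: mem_image_iff alg_iso_simps rmod.subspace_add[OF assms] rmod.subspace_scale[OF assms])

lemma quot_basis_image:
  assumes "quot_basis I K b"
  shows "quot_basis (\<sigma> ` I) K (\<lambda>k. \<sigma> (b k))"
  using assms unfolding quot_basis_def mem_image_iff alg_iso_simps by blast

lemma hom_mod_image:
  assumes "hom_mod I \<psi>"
  shows "hom_mod (\<sigma> ` I) (\<lambda>f. \<sigma> (\<psi> (\<tau> f)))"
  using assms unfolding hom_mod_def by (simp add: mem_image_iff alg_iso_simps)

lemma hom_mod_preimage:
  assumes "hom_mod (\<sigma> ` I) \<psi>"
  shows "hom_mod I (\<lambda>f. \<tau> (\<psi> (\<sigma> f)))"
proof -
  have "\<tau> (\<psi> (\<sigma> r * \<sigma> f) - \<sigma> r * \<psi> (\<sigma> f)) \<in> I" if "f \<in> I" for r f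
    using assms that by (simp add: hom_mod_def flip: mem_image_iff)
  then show ?thesis
    using assms by (simp add: hom_mod_def mem_image_iff alg_iso_simps)
qed

lemma hom_basis_image:
  assumes "hom_basis I K \<phi>"
  shows "hom_basis (\<sigma> ` I) K (\<lambda>k f. \<sigma> (\<phi> k (\<tau> f)))"
  unfolding hom_basis_def
proof (intro conjI ballI allI impI)
  have ball: "(\<forall>f\<in>\<sigma> ` I. P f) \<longleftrightarrow> (\<forall>f\<in>I. P (\<sigma> f))" for P by blast
  show "finite K" using assms by (simp add: hom_basis_def)
  show "hom_mod (\<sigma> ` I) (\<lambda>f. \<sigma> (\<phi> k (\<tau> f)))" if "k \<in> K" for k
    using assms that by (intro hom_mod_image) (simp add: hom_basis_def)
  show "\<exists>c. \<forall>f\<in>\<sigma> ` I. \<psi> f - (\<Sum>k\<in>K. const (c k) * \<sigma> (\<phi> k (\<tau> f))) \<in> \<sigma> ` I"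
    if \<psi>: "hom_mod (\<sigma> ` I) \<psi>" for \<psi>
  proof -
    obtain c where "\<forall>f\<in>I. \<tau> (\<psi> (\<sigma> f)) - (\<Sum>k\<in>K. const (c k) * \<phi> k f) \<in> I"
      using assms hom_mod_preimage[OF \<psi>] unfolding hom_basis_def by blast
    then show ?thesis
      unfolding ball by (intro exI[of _ c]) (simp add: mem_image_iff alg_iso_simps)
  qed
  show "c k = 0"
    if c: "\<forall>f\<in>\<sigma> ` I. (\<Sum>k\<in>K. const (c k) * \<sigma> (\<phi> k (\<tau> f))) \<in> \<sigma> ` I" and k: "k \<in> K" for c k
  proof -
    have "\<forall>f\<in>I. (\<Sum>k\<in>K. const (c k) * \<phi> k f) \<in> I"
      using c unfolding ball by (simp add: mem_image_iff alg_iso_simps)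
    then show ?thesis using assms k unfolding hom_basis_def by blast
  qed
qed

end

section \<open>The ideals in adapted coordinates\<close>

lemma max_ideal_eq: "max_ideal = rmod.span {varX, varY, varZ}"
  by (simp add: max_ideal_def genideal_eq_span)

text \<open>Since \<open>X\<close> and \<open>l\<close> differ by a quadric in \<open>Y, Z\<close>,
  both give \<open>(l) + m^2 = (X, Y^2, Y Z, Z^2)\<close>. Freedom in the choice of \<open>X\<close>
  is what allows the nonlinear change of \<open>x\<close> in \<open>normal_form\<close>.\<close>

lemma square_ideal_eq:
  assumes m: "max_ideal = rmod.span {X, Y, Z}"
    and X: "X - l \<in> rmod.span {Y * Y, Y * Z, Z * Z}"
  shows "square_ideal l v = rmod.span (insert v (generators X Y Z))"
proof -
  let ?M = "{X, Y, Z}" and ?G = "{X, Y * Y, Y * Z, Z * Z}"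
  let ?MM = "{a * b |a b. a \<in> ?M \<and> b \<in> ?M}" and ?GG = "{a * b |a b. a \<in> ?G \<and> b \<in> ?G}"
  have MM: "ideal_prod class_ring max_ideal max_ideal = rmod.span ?MM"
    unfolding m by (simp only: ideal_prod_eq_span[OF rmod.subspace_span rmod.subspace_span] span_mult_span)
  have sub1: "rmod.span {Y * Y, Y * Z, Z * Z} \<subseteq> rmod.span ?G" by (rule rmod.span_mono) blast
  have sub2: "rmod.span {Y * Y, Y * Z, Z * Z} \<subseteq> rmod.span (insert l ?MM)" by (rule rmod.span_mono) blast
  have "insert l ?MM \<subseteq> rmod.span ?G"
  proof -
    have G: "g \<in> rmod.span ?G" if "g \<in> ?G" for g by (rule rmod.span_base) (fact that)
    have "l = X - (X - l)" by simp
    also have "\<dots> \<in> rmod.span ?G" by (rule rmod.span_diff[OF G subsetD[OF sub1 X]]) simp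
    finally have "l \<in> rmod.span ?G" .
    moreover have "a * b \<in> rmod.span ?G" if "a \<in> ?M" "b \<in> ?M" for a b
    proof (cases "a = X \<or> b = X")
      case True
      then show ?thesis using G[of X] rmod.span_scale[of X ?G a] rmod.span_scale[of X ?G b]
        by (auto simp: mult.commute)
    next
      case False
      then have "a * b \<in> ?G" using that by (auto simp: mult.commute)
      then show ?thesis by (rule G)
    qed
    ultimately show ?thesis unfolding insert_subset by blast
  qed
  moreover have "?G \<subseteq> rmod.span (insert l ?MM)"
  proof -
    have G: "g \<in> rmod.span (insert l ?MM)" if "g \<in> insert l ?MM" for g
      by (rule rmod.span_base) (fact that)
    have "X = (X - l) + l" by simp
    also have "\<dots> \<in> rmod.span (insert l ?MM)" by (rule rmod.span_add[OF subsetD[OF sub2 X] G]) simp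
    finally have "X \<in> rmod.span (insert l ?MM)" .
    moreover have "Y * Y \<in> ?MM" "Y * Z \<in> ?MM" "Z * Z \<in> ?MM" by blast+
    ultimately show ?thesis using G unfolding insert_subset by blast
  qed
  ultimately have "rmod.span (insert l ?MM) = rmod.span ?G"
    by (intro equalityI rmod.span_minimal rmod.subspace_span)
  moreover have "rmod.span (insert l ?MM) = {a + b |a b. a \<in> rmod.span {l} \<and> b \<in> rmod.span ?MM}"
    using rmod.span_Un[of "{l}" ?MM] by auto
  ultimately have Q: "(Idl\<^bsub>class_ring\<^esub> {l}) <+>\<^bsub>class_ring\<^esub> ideal_prod class_ring max_ideal max_ideal
      = rmod.span ?G"
    by (simp add: genideal_eq_span set_add_class_ring MM)
  have GG: "?GG = generators X Y Z"
  proof (rule equalityI)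
    show "generators X Y Z \<subseteq> ?GG"
    proof -
      have "a * b \<in> ?GG" if "a \<in> ?G" "b \<in> ?G" for a b using that by blast
      from this[of X X] this[of X "Y * Y"] this[of X "Y * Z"] this[of X "Z * Z"]
        this[of "Y * Y" "Y * Y"] this[of "Y * Y" "Y * Z"] this[of "Y * Y" "Z * Z"]
        this[of "Y * Z" "Z * Z"] this[of "Z * Z" "Z * Z"]
      show ?thesis by (simp add: generators_def mult.assoc)
    qed
    show "?GG \<subseteq> generators X Y Z"
    proof
      fix x assume "x \<in> ?GG"
      then obtain a b where "x = a * b" "a \<in> ?G" "b \<in> ?G" by blast
      then show "x \<in> generators X Y Z"
        by (elim insertE emptyE; simp add: generators_def mult.assoc mult.left_commute mult.commute)
    qed
  qed
  have QQ: "ideal_prod class_ring (rmod.span ?G) (rmod.span ?G) = rmod.span (generators X Y Z)"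
    unfolding GG[symmetric]
    by (simp only: ideal_prod_eq_span[OF rmod.subspace_span rmod.subspace_span] span_mult_span)
  have "square_ideal l v = {a + b |a b. a \<in> rmod.span (generators X Y Z) \<and> b \<in> rmod.span {v}}"
    unfolding square_ideal_def Let_def Q QQ by (simp only: set_add_class_ring genideal_eq_span)
  also have "\<dots> = rmod.span (insert v (generators X Y Z))"
    using rmod.span_Un[of "generators X Y Z" "{v}"] by auto
  finally show ?thesis .
qed

lemma image_generators:
  assumes "alg_hom \<sigma>"
  shows "\<sigma> ` generators X Y Z = generators (\<sigma> X) (\<sigma> Y) (\<sigma> Z)"
  by (simp add: generators_def alg_homD[OF assms])

section \<open>The normal form of a general parameter\<close>

lemma complex_cube_root: "\<exists>z. z ^ 3 = (w :: complex)"
proof -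
  obtain r a where w: "w = rcis r a" using rcis_Ex by blast
  have "rcis (root 3 r) (a / 3) ^ 3 = w"
    by (simp add: w DeMoivre2 odd_real_root_pow)
  then show ?thesis by blast
qed

definition cubic_quadric ::
    "complex \<Rightarrow> complex \<Rightarrow> complex \<Rightarrow> complex \<Rightarrow> complex \<Rightarrow> complex \<Rightarrow>
      complex poly3 \<Rightarrow> complex poly3 \<Rightarrow> complex poly3 \<Rightarrow> complex poly3" where
  "cubic_quadric a b c d s t X Y Z = const a * (Y * (Y * Y)) + const b * (Y * (Y * Z)) +
     const c * (Y * (Z * Z)) + const d * (Z * (Z * Z)) + X * (const s * Y + const t * Z)"

lemma cubic_quadric_hom:
  assumes "alg_hom \<sigma>"
  shows "\<sigma> (cubic_quadric a b c d s t X Y Z) = cubic_quadric a b c d s t (\<sigma> X) (\<sigma> Y) (\<sigma> Z)"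
  by (simp add: cubic_quadric_def alg_homD[OF assms])

text \<open>The triangular substitution is the inverse of the change of \<open>y, z\<close> in
  \<open>normal_form\<close>; the lemma supplies the assumption on \<open>X - l\<close> in
  \<open>square_ideal_eq\<close>.\<close>

lemma span_quadrics:
  assumes "y = const a * Y" "z = const b * Z + const c * Y"
  shows "const p * (y * y) + const q * (y * z) + const r * (z * z) \<in> rmod.span {Y * Y, Y * Z, Z * Z}"
proof -
  have "const p * (y * y) + const q * (y * z) + const r * (z * z) =
      (const p * const a * const a + const q * const a * const c + const r * const c * const c) * (Y * Y) +
      (const q * const a * const b + const r * (const b * const c + const b * const c)) * (Y * Z) +
      const r * const b * const b * (Z * Z)"
    by (simp add: assms algebra_simps)
  also have "\<dots> \<in> rmod.span {Y * Y, Y * Z, Z * Z}"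
    by (intro rmod.span_add rmod.span_scale[OF rmod.span_base]) simp_all
  finally show ?thesis .
qed

text \<open>The substitution \<open>x \<mapsto> x + q(y, z)\<close> removes from the cubic part of \<open>v\<close> everything that is
  divisible by its linear factor \<open>s y + t z\<close>; what is left is \<open>y^3\<close> times the value
  of the cubic at the zero \<open>(1, - s / t)\<close> of that factor.\<close>

lemma normal_form:
  fixes a b c d s t :: complex
  defines "r \<equiv> s / t"
  defines "\<Lambda> \<equiv> a - b * r + c * r ^ 2 - d * r ^ 3"
  assumes t: "t \<noteq> 0" and \<Lambda>: "\<Lambda> \<noteq> 0"
  obtains \<sigma> \<tau> where "alg_iso \<sigma> \<tau>" "\<sigma> v0 = cubic_quadric a b c d s t varX varY varZ"
    "max_ideal = rmod.span {\<sigma> varX, \<sigma> varY, \<sigma> varZ}"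
    "\<sigma> varX - varX \<in> rmod.span {\<sigma> varY * \<sigma> varY, \<sigma> varY * \<sigma> varZ, \<sigma> varZ * \<sigma> varZ}"
proof -
  obtain \<kappa> where \<kappa>3: "\<kappa> ^ 3 = \<Lambda>" using complex_cube_root by blast
  with \<Lambda> have \<kappa>: "\<kappa> \<noteq> 0" by auto
  \<comment> \<open>Long division in \<open>z\<close>: the cubic equals
    \<open>(s y + t z) * (A y^2 + B y z + C z^2) + \<Lambda> y^3\<close>.\<close>
  define A where "A = (b - c * r + d * r ^ 2) / t"
  define B where "B = (c - d * r) / t"
  define C where "C = d / t"
  define q where "q y z = const A * (y * y) + const B * (y * z) + const C * (z * z)" for y z :: "complex poly3"
  have q_hom: "\<sigma> (q y z) = q (\<sigma> y) (\<sigma> z)" if "alg_hom \<sigma>" for \<sigma> y z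
    by (simp add: q_def alg_homD[OF that])
  let ?Y = "const \<kappa> * varY" and ?Z = "const s * varY + const t * varZ"
  \<comment> \<open>These invert the triangular change \<open>?Y\<close>, \<open>?Z\<close>;
    accordingly the inverse of \<open>x \<mapsto> x + q\<close> subtracts \<open>q\<close> at
    \<open>?y\<close>, \<open>?z\<close>.\<close>
  let ?y = "const (1 / \<kappa>) * varY" and ?z = "const (1 / t) * varZ + const (- s / (t * \<kappa>)) * varY"
  define \<sigma> where "\<sigma> = subst (varX + q varY varZ) ?Y ?Z"
  define \<tau> where "\<tau> = subst (varX - q ?y ?z) ?y ?z"
  have \<sigma>: "alg_hom \<sigma>" and \<tau>: "alg_hom \<tau>" by (simp_all add: \<sigma>_def \<tau>_def alg_hom_subst)
  have \<sigma>_var: "\<sigma> varX = varX + q varY varZ" "\<sigma> varY = ?Y" "\<sigma> varZ = ?Z"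
    and \<tau>_var: "\<tau> varX = varX - q ?y ?z" "\<tau> varY = ?y" "\<tau> varZ = ?z"
    by (simp_all add: \<sigma>_def \<tau>_def)
  have cc: "const e * (const f * p) = const (e * f) * p" for e f and p :: "complex poly3"
    by (simp add: const_mult mult.assoc)
  have y: "const (1 / \<kappa>) * ?Y = varY"
    using \<kappa> by (simp add: cc)
  have z: "const (1 / t) * ?Z + const (- s / (t * \<kappa>)) * ?Y = varZ"
  proof -
    have "const (1 / t) * ?Z + const (- s / (t * \<kappa>)) * ?Y
        = (const (s / t) + const (- s / t)) * varY + const 1 * varZ"
      using \<kappa> t by (simp add: distrib_left distrib_right cc)
    also have "const (s / t) + const (- s / t) = 0" by (simp flip: const_add)
    finally show ?thesis by simp
  qed
  have \<sigma>\<tau>: "\<sigma> ?y = varY" "\<sigma> ?z = varZ"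
    using y z by (simp_all add: alg_homD[OF \<sigma>] \<sigma>_var)
  have \<tau>\<sigma>: "\<tau> ?Y = varY" "\<tau> ?Z = varZ"
  proof -
    show "\<tau> ?Y = varY" using \<kappa> by (simp add: alg_homD[OF \<tau>] \<tau>_var cc)
    have "\<tau> ?Z = (const (s / \<kappa>) + const (- s / \<kappa>)) * varY + const 1 * varZ"
      using \<kappa> t by (simp add: alg_homD[OF \<tau>] \<tau>_var distrib_left distrib_right cc)
    also have "const (s / \<kappa>) + const (- s / \<kappa>) = 0" by (simp flip: const_add)
    finally show "\<tau> ?Z = varZ" by simp
  qed
  show thesis
  proof
    show "alg_iso \<sigma> \<tau>"
    proof (rule alg_isoI[OF \<sigma> \<tau>])
      show "\<sigma> (\<tau> varY) = varY" "\<sigma> (\<tau> varZ) = varZ" "\<tau> (\<sigma> varY) = varY" "\<tau> (\<sigma> varZ) = varZ"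
        by (simp_all only: \<tau>_var \<sigma>_var \<sigma>\<tau> \<tau>\<sigma>)
      show "\<sigma> (\<tau> varX) = varX"
        unfolding \<tau>_var alg_homD(7)[OF \<sigma>] q_hom[OF \<sigma>] \<sigma>\<tau> unfolding \<sigma>_var by simp
      show "\<tau> (\<sigma> varX) = varX"
        unfolding \<sigma>_var alg_homD(1)[OF \<tau>] q_hom[OF \<tau>] \<tau>_var by simp
    qed
    have coeffs: "a = A * s + \<kappa> * (\<kappa> * \<kappa>)" "b = A * t + B * s" "c = B * t + C * s" "d = C * t"
    proof -
      have s: "s = r * t" and \<kappa>\<Lambda>: "\<kappa> * (\<kappa> * \<kappa>) = \<Lambda>"
        using t \<kappa>3 by (simp_all add: r_def power3_eq_cube mult.assoc)
      have At: "A * t = b - c * r + d * r ^ 2" and Bt: "B * t = c - d * r" and Ct: "C * t = d"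
        using t by (simp_all add: A_def B_def C_def)
      have As: "A * s = (A * t) * r" and Bs: "B * s = (B * t) * r" and Cs: "C * s = (C * t) * r"
        by (simp_all add: s)
      show "a = A * s + \<kappa> * (\<kappa> * \<kappa>)" "b = A * t + B * s" "c = B * t + C * s" "d = C * t"
        unfolding \<kappa>\<Lambda> \<Lambda>_def As Bs Cs At Bt Ct
        by (simp_all add: algebra_simps power2_eq_square power3_eq_cube)
    qed
    show "\<sigma> v0 = cubic_quadric a b c d s t varX varY varZ"
    proof -
      have "\<sigma> v0 = (varX + q varY varZ) * ?Z + ?Y * (?Y * ?Y)"
        by (simp only: alg_homD(1,2)[OF \<sigma>] \<sigma>_var)
      also have "\<dots> = (const A * const s + const \<kappa> * (const \<kappa> * const \<kappa>)) * (varY * (varY * varY)) +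
          (const A * const t + const B * const s) * (varY * (varY * varZ)) +
          (const B * const t + const C * const s) * (varY * (varZ * varZ)) +
          (const C * const t) * (varZ * (varZ * varZ)) + varX * ?Z"
        unfolding q_def by (simp add: algebra_simps)
      also have "\<dots> = cubic_quadric a b c d s t varX varY varZ"
        unfolding cubic_quadric_def by (simp only: coeffs const_add const_mult)
      finally show ?thesis .
    qed
    have q_span: "q varY varZ \<in> rmod.span {?Y * ?Y, ?Y * ?Z, ?Z * ?Z}"
      unfolding q_def by (rule span_quadrics[OF y[symmetric] z[symmetric]])
    then show "\<sigma> varX - varX \<in> rmod.span {\<sigma> varY * \<sigma> varY, \<sigma> varY * \<sigma> varZ, \<sigma> varZ * \<sigma> varZ}"
      unfolding \<sigma>_var by simp
    let ?S = "rmod.span {varX + q varY varZ, ?Y, ?Z}"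
    have base: "varX + q varY varZ \<in> ?S" "?Y \<in> ?S" "?Z \<in> ?S" by (auto intro: rmod.span_base)
    have yS: "varY \<in> ?S" using rmod.span_scale[OF base(2), of "const (1 / \<kappa>)"] by (simp only: y)
    have zS: "varZ \<in> ?S"
      using rmod.span_add[OF rmod.span_scale[OF base(3), of "const (1 / t)"]
          rmod.span_scale[OF base(2), of "const (- s / (t * \<kappa>))"]] by (simp only: z)
    have "const A * (varY * varY) + const B * (varY * varZ) + const C * (varZ * varZ) \<in> ?S"
      by (intro rmod.span_add rmod.span_scale yS zS)
    then have qS: "q varY varZ \<in> ?S" by (simp only: q_def)
    have xS: "varX \<in> ?S" using rmod.span_diff[OF base(1) qS] by simp
    have v: "varX \<in> max_ideal" "varY \<in> max_ideal" "varZ \<in> max_ideal"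
      unfolding max_ideal_eq by (auto intro: rmod.span_base)
    have "q varY varZ \<in> max_ideal"
      using v unfolding max_ideal_eq q_def by (intro rmod.span_add rmod.span_scale)
    with v have "{varX + q varY varZ, ?Y, ?Z} \<subseteq> max_ideal"
      unfolding max_ideal_eq by (simp add: rmod.span_add rmod.span_scale)
    then show "max_ideal = rmod.span {\<sigma> varX, \<sigma> varY, \<sigma> varZ}"
      unfolding \<sigma>_var max_ideal_eq using xS yS zS
      by (intro equalityI rmod.span_minimal rmod.subspace_span) simp_all
  qed
qed

section \<open>Linear forms and homogeneous polynomials\<close>

lemma homogeneous_1_iff:
  "p \<in> homogeneous 1 \<longleftrightarrow> (\<exists>a b c. p = const a * varX + const b * varY + const c * varZ)"
proof
  assume p: "p \<in> homogeneous 1"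
  have "p = const (lookup p (1,0,0)) * varX + const (lookup p (0,1,0)) * varY + const (lookup p (0,0,1)) * varZ"
  proof (rule poly_mapping_eqI)
    fix m :: "nat \<times> nat \<times> nat"
    obtain a b c where m: "m = (a, b, c)" by (cases m)
    have "a + b + c = 1" if "lookup p (a, b, c) \<noteq> 0"
    proof -
      have "\<forall>(a, b, c) \<in> Poly_Mapping.keys p. a + b + c = 1" using p by (simp add: homogeneous_def)
      from bspec[OF this, of "(a, b, c)"] that show ?thesis by (simp add: in_keys_iff)
    qed
    then have "lookup p (a, b, c) = 0 \<or> (a, b, c) = (1,0,0) \<or> (a, b, c) = (0,1,0) \<or> (a, b, c) = (0,0,1)"
      by (auto simp: add_is_1)
    then show "lookup p m = lookup (const (lookup p (1,0,0)) * varX + const (lookup p (0,1,0)) * varY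
        + const (lookup p (0,0,1)) * varZ) m"
      unfolding m by (auto simp: lookup_simps)
  qed
  then show "\<exists>a b c. p = const a * varX + const b * varY + const c * varZ" by blast
next
  assume "\<exists>a b c. p = const a * varX + const b * varY + const c * varZ"
  then show "p \<in> homogeneous 1"
    by (auto simp: homogeneous_def in_keys_iff lookup_simps split: if_splits)
qed

lemma homogeneous_add:
  assumes "p \<in> homogeneous k" "q \<in> homogeneous k"
  shows "p + q \<in> homogeneous k"
proof -
  have *: "\<forall>m\<in>Poly_Mapping.keys p \<union> Poly_Mapping.keys q. case m of (a, b, c) \<Rightarrow> a + b + c = k"
    using assms by (simp add: homogeneous_def ball_Un)
  show ?thesis
    unfolding homogeneous_def by (rule CollectI) (rule ballI, rule bspec[OF *], erule subsetD[OF keys_add])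
qed

lemma homogeneous_const_mult: "p \<in> homogeneous k \<Longrightarrow> const c * p \<in> homogeneous k"
  unfolding homogeneous_def by (auto simp: in_keys_iff lookup_const_mult)

lemma homogeneous_mult:
  assumes "p \<in> homogeneous j" "q \<in> homogeneous k"
  shows "p * q \<in> homogeneous (j + k)"
proof -
  have "a + b + c = j + k" if abc: "(a, b, c) \<in> Poly_Mapping.keys (p * q)" for a b c
  proof -
    obtain m n where mn: "(a, b, c) = m + n" "m \<in> Poly_Mapping.keys p" "n \<in> Poly_Mapping.keys q"
    proof -
      have "(a, b, c) \<in> {m + n |m n. m \<in> Poly_Mapping.keys p \<and> n \<in> Poly_Mapping.keys q}"
        by (rule subsetD[OF keys_mult]) (fact abc)
      then show ?thesis using that by blast
    qed
    obtain a1 b1 c1 where m: "m = (a1, b1, c1)" by (cases m)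
    obtain a2 b2 c2 where n: "n = (a2, b2, c2)" by (cases n)
    have "a1 + b1 + c1 = j" "a2 + b2 + c2 = k"
      using assms mn(2,3) unfolding m n homogeneous_def by blast+
    then show ?thesis using mn(1) by (simp add: m n)
  qed
  then show ?thesis by (auto simp: homogeneous_def)
qed

section \<open>Coordinates adapted to the decomposition of the linear forms\<close>

text \<open>\<open>\<sigma>\<close> substitutes \<open>l, Y, Z\<close> for the variables, and
  \<open>\<tau>\<close> is read off from the expansions of \<open>x, y, z\<close> in
  \<open>l, Y, Z\<close>. One composite is the identity by construction, the other by uniqueness of
  such expansions.\<close>

lemma linear_coordinates:
  fixes l :: "complex poly3" and L :: "complex poly3 set"
  assumes l: "l \<in> homogeneous 1" "l \<noteq> 0"
    and L: "L \<subseteq> homogeneous 1" "cpoly.subspace L" "cpoly.dim L = 2"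
    and sum: "homogeneous 1 = {a + b | a b. a \<in> cpoly.span {l} \<and> b \<in> L}"
    and int: "cpoly.span {l} \<inter> L = {0}"
  obtains Y Z \<sigma> \<tau> where "L = {const b * Y + const c * Z |b c. True}" "alg_iso \<sigma> \<tau>"
    "\<sigma> varX = l" "\<sigma> varY = Y" "\<sigma> varZ = Z" "max_ideal = rmod.span {l, Y, Z}"
proof -
  obtain B where B: "B \<subseteq> L" "cpoly.independent B" "L \<subseteq> cpoly.span B" "card B = 2"
    using cpoly.basis_exists[of L] L(3) by metis
  then obtain Y Z where BYZ: "B = {Y, Z}" and YZ: "Y \<noteq> Z" by (auto simp: card_2_iff)
  have mem_L: "const b * Y + const c * Z \<in> L" for b c
    using cpoly.subspace_add[OF L(2) cpoly.subspace_scale[OF L(2)] cpoly.subspace_scale[OF L(2)]] B(1)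
    by (simp add: BYZ scale_def)
  have L_eq: "L = {const b * Y + const c * Z |b c. True}"
  proof (intro equalityI subsetI)
    fix p assume "p \<in> L"
    then have "p \<in> cpoly.span {Y, Z}" using B(3) BYZ by blast
    then obtain b c where "p - scale b Y = scale c Z"
      by (auto simp: cpoly.span_insert cpoly.span_singleton)
    then have "p = const b * Y + const c * Z" by (simp add: scale_def algebra_simps)
    then show "p \<in> {const b * Y + const c * Z |b c. True}" by blast
  qed (use mem_L in auto)
  have indep: "b = 0 \<and> c = 0" if "const b * Y + const c * Z = 0" for b c
  proof -
    let ?u = "\<lambda>w. if w = Y then b else c"
    have "(\<Sum>w\<in>{Y, Z}. scale (?u w) w) = 0" using YZ that by (simp add: scale_def)
    then show ?thesis
      using cpoly.independentD[OF B(2)[unfolded BYZ], of "{Y, Z}" ?u Y]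
        cpoly.independentD[OF B(2)[unfolded BYZ], of "{Y, Z}" ?u Z] YZ by auto
  qed
  have repr: "\<exists>a b c. p = const a * l + const b * Y + const c * Z" if p: "p \<in> homogeneous 1" for p
  proof -
    obtain q m where qm: "p = q + m" "q \<in> cpoly.span {l}" "m \<in> L" using p sum by blast
    obtain a where "q = const a * l" using qm(2) by (auto simp: cpoly.span_singleton scale_def)
    moreover obtain b c where "m = const b * Y + const c * Z" using qm(3) L_eq by blast
    ultimately have "p = const a * l + const b * Y + const c * Z" using qm(1) by (simp add: add.assoc)
    then show ?thesis by blast
  qed
  have unique: "a = a' \<and> b = b' \<and> c = c'"
    if "const a * l + const b * Y + const c * Z = const a' * l + const b' * Y + const c' * Z"
    for a b c a' b' c'
  proof -
    from that have *: "const (a - a') * l = const (b' - b) * Y + const (c' - c) * Z"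
      by (simp add: const_diff algebra_simps)
    have "const (a - a') * l \<in> cpoly.span {l}" by (auto simp: cpoly.span_singleton scale_def)
    then have 0: "const (a - a') * l = 0" using int mem_L * by auto
    then have "scale (a - a') l = 0" by (simp add: scale_def)
    then have "a = a'" using l(2) by (simp only: cpoly.scale_eq_0_iff) simp
    moreover have "const (b' - b) * Y + const (c' - c) * Z = 0" using 0 * by simp
    from indep[OF this] have "b' - b = 0 \<and> c' - c = 0" .
    ultimately show ?thesis by simp
  qed
  have var: "varX \<in> homogeneous 1" "varY \<in> homogeneous 1" "varZ \<in> homogeneous 1"
    by (auto simp: homogeneous_def varX_def varY_def varZ_def)
  obtain a1 b1 c1 where x: "varX = const a1 * l + const b1 * Y + const c1 * Z" using repr[OF var(1)] by blast
  obtain a2 b2 c2 where y: "varY = const a2 * l + const b2 * Y + const c2 * Z" using repr[OF var(2)] by blast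
  obtain a3 b3 c3 where z: "varZ = const a3 * l + const b3 * Y + const c3 * Z" using repr[OF var(3)] by blast
  define \<sigma> where "\<sigma> = subst l Y Z"
  define \<tau> where "\<tau> = subst (const a1 * varX + const b1 * varY + const c1 * varZ)
    (const a2 * varX + const b2 * varY + const c2 * varZ) (const a3 * varX + const b3 * varY + const c3 * varZ)"
  have \<sigma>: "alg_hom \<sigma>" and \<tau>: "alg_hom \<tau>" by (simp_all add: \<sigma>_def \<tau>_def alg_hom_subst)
  have \<sigma>_var: "\<sigma> varX = l" "\<sigma> varY = Y" "\<sigma> varZ = Z" by (simp_all add: \<sigma>_def)
  have \<tau>_var: "\<tau> varX = const a1 * varX + const b1 * varY + const c1 * varZ"
    "\<tau> varY = const a2 * varX + const b2 * varY + const c2 * varZ"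
    "\<tau> varZ = const a3 * varX + const b3 * varY + const c3 * varZ" by (simp_all add: \<tau>_def)
  have \<sigma>\<tau>: "\<sigma> (\<tau> varX) = varX" "\<sigma> (\<tau> varY) = varY" "\<sigma> (\<tau> varZ) = varZ"
    unfolding \<tau>_var alg_homD(1-3)[OF \<sigma>] \<sigma>_var by (simp_all only: x[symmetric] y[symmetric] z[symmetric])
  have \<sigma>\<tau>_all: "\<sigma> (\<tau> p) = p" for p
    by (rule alg_hom_ext[OF alg_hom_comp[OF \<sigma> \<tau>] alg_hom_id]) (fact \<sigma>\<tau>)+
  have \<tau>_lin: "\<exists>a b c. \<tau> p = const a * varX + const b * varY + const c * varZ" if p: "p \<in> homogeneous 1" for p
  proof -
    obtain a b c where "p = const a * varX + const b * varY + const c * varZ"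
      using p homogeneous_1_iff by blast
    then have "\<tau> p = const a * \<tau> varX + const b * \<tau> varY + const c * \<tau> varZ"
      by (simp only: alg_homD(1-3)[OF \<tau>])
    also have "\<dots> \<in> homogeneous 1"
      unfolding \<tau>_var by (intro homogeneous_add homogeneous_const_mult var)
    finally show ?thesis using homogeneous_1_iff by blast
  qed
  \<comment> \<open>\<open>\<tau> p\<close> is linear, and applying \<open>\<sigma>\<close> returns
    \<open>p\<close>; \<open>unique\<close> therefore identifies the coefficients of
    \<open>\<tau> p\<close> with those of \<open>p\<close> in \<open>l, Y, Z\<close>.\<close>
  have \<tau>_eq: "\<tau> p = const a * varX + const b * varY + const c * varZ"
    if "p \<in> homogeneous 1" "p = const a * l + const b * Y + const c * Z" for p a b c
  proof -
    obtain a' b' c' where t: "\<tau> p = const a' * varX + const b' * varY + const c' * varZ"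
      using \<tau>_lin[OF \<open>p \<in> homogeneous 1\<close>] by blast
    have "p = \<sigma> (\<tau> p)" by (simp only: \<sigma>\<tau>_all)
    also have "\<dots> = const a' * l + const b' * Y + const c' * Z"
      unfolding t alg_homD(1-3)[OF \<sigma>] \<sigma>_var ..
    finally have "a' = a \<and> b' = b \<and> c' = c" using that(2) by (intro unique) simp
    with t show ?thesis by simp
  qed
  have YZ1: "Y \<in> homogeneous 1" "Z \<in> homogeneous 1" using B(1) L(1) BYZ by auto
  have \<tau>\<sigma>: "\<tau> (\<sigma> varX) = varX" "\<tau> (\<sigma> varY) = varY" "\<tau> (\<sigma> varZ) = varZ"
    using \<tau>_eq[OF l(1), of 1 0 0] \<tau>_eq[OF YZ1(1), of 0 1 0] \<tau>_eq[OF YZ1(2), of 0 0 1]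
    by (simp_all add: \<sigma>_var)
  have iso: "alg_iso \<sigma> \<tau>" by (rule alg_isoI[OF \<sigma> \<tau> \<sigma>\<tau> \<tau>\<sigma>])
  have "max_ideal = rmod.span {l, Y, Z}"
    unfolding max_ideal_eq
  proof (intro equalityI rmod.span_minimal rmod.subspace_span)
    have v: "varX \<in> rmod.span {varX, varY, varZ}" "varY \<in> rmod.span {varX, varY, varZ}"
      "varZ \<in> rmod.span {varX, varY, varZ}" by (auto intro: rmod.span_base)
    have "p \<in> rmod.span {varX, varY, varZ}" if p: "p \<in> homogeneous 1" for p
    proof -
      obtain a b c where "p = const a * varX + const b * varY + const c * varZ"
        using p homogeneous_1_iff by blast
      then show ?thesis by (simp only:) (intro rmod.span_add rmod.span_scale v)
    qed
    then show "{l, Y, Z} \<subseteq> rmod.span {varX, varY, varZ}" using l(1) YZ1 by simp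
    have w: "l \<in> rmod.span {l, Y, Z}" "Y \<in> rmod.span {l, Y, Z}" "Z \<in> rmod.span {l, Y, Z}"
      by (auto intro: rmod.span_base)
    have "p \<in> rmod.span {l, Y, Z}" if p: "p \<in> homogeneous 1" for p
    proof -
      obtain a b c where "p = const a * l + const b * Y + const c * Z" using repr[OF p] by blast
      then show ?thesis using w by (simp only: rmod.span_add rmod.span_scale)
    qed
    then show "{varX, varY, varZ} \<subseteq> rmod.span {l, Y, Z}" using var by simp
  qed
  with L_eq iso \<sigma>_var that show thesis by blast
qed

text \<open>The first claim gives six coordinates for every parameter; the second exhibits the
  counterpart of \<open>v0\<close>, which later shows that the open set is nonempty.\<close>

lemma parameter_space_cubic_quadric:
  assumes L: "L = {const b * Y + const c * Z |b c. True}"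
  shows "v \<in> parameter_space l L \<Longrightarrow> \<exists>a b c d s t. v = cubic_quadric a b c d s t l Y Z"
    and "Y * (Y * Y) + l * Z \<in> parameter_space l L"
proof -
  let ?C = "{const a * (Y * (Y * Y)) + const b * (Y * (Y * Z)) + const c * (Y * (Z * Z))
    + const d * (Z * (Z * Z)) |a b c d. True}"
  have sub: "cpoly.subspace ?C"
  proof (rule cpoly.subspaceI)
    show "0 \<in> ?C" by (rule CollectI, (rule exI[of _ 0])+) simp
  next
    fix p q assume "p \<in> ?C" "q \<in> ?C"
    then obtain a b c d a' b' c' d' where
      "p = const a * (Y * (Y * Y)) + const b * (Y * (Y * Z)) + const c * (Y * (Z * Z)) + const d * (Z * (Z * Z))"
      "q = const a' * (Y * (Y * Y)) + const b' * (Y * (Y * Z)) + const c' * (Y * (Z * Z)) + const d' * (Z * (Z * Z))"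
      by blast
    then have "p + q = const (a + a') * (Y * (Y * Y)) + const (b + b') * (Y * (Y * Z))
        + const (c + c') * (Y * (Z * Z)) + const (d + d') * (Z * (Z * Z))"
      by (simp add: const_add algebra_simps)
    then show "p + q \<in> ?C" by blast
  next
    fix e p assume "p \<in> ?C"
    then obtain a b c d where
      "p = const a * (Y * (Y * Y)) + const b * (Y * (Y * Z)) + const c * (Y * (Z * Z)) + const d * (Z * (Z * Z))"
      by blast
    then have "scale e p = const (e * a) * (Y * (Y * Y)) + const (e * b) * (Y * (Y * Z))
        + const (e * c) * (Y * (Z * Z)) + const (e * d) * (Z * (Z * Z))"
      by (simp add: scale_def const_mult algebra_simps)
    then show "scale e p \<in> ?C" by blast
  qed
  have "sym3 L \<subseteq> ?C"
    unfolding sym3_def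
  proof (rule cpoly.span_minimal[OF subsetI sub])
    fix p assume "p \<in> {a * b * c | a b c. a \<in> L \<and> b \<in> L \<and> c \<in> L}"
    then obtain b1 c1 b2 c2 b3 c3 where
      "p = (const b1 * Y + const c1 * Z) * (const b2 * Y + const c2 * Z) * (const b3 * Y + const c3 * Z)"
      unfolding L by blast
    then have "p = const (b1 * b2 * b3) * (Y * (Y * Y))
        + const (b1 * b2 * c3 + b1 * c2 * b3 + c1 * b2 * b3) * (Y * (Y * Z))
        + const (b1 * c2 * c3 + c1 * b2 * c3 + c1 * c2 * b3) * (Y * (Z * Z))
        + const (c1 * c2 * c3) * (Z * (Z * Z))"
      by (simp add: const_add const_mult algebra_simps)
    then show "p \<in> ?C" by blast
  qed
  then show "v \<in> parameter_space l L \<Longrightarrow> \<exists>a b c d s t. v = cubic_quadric a b c d s t l Y Z"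
    unfolding parameter_space_def cubic_quadric_def L by blast
  have "const 1 * Y + const 0 * Z \<in> L" "const 0 * Y + const 1 * Z \<in> L" unfolding L by blast+
  then have "Y \<in> L" "Z \<in> L" by simp_all
  then have "Y * Y * Y \<in> sym3 L" unfolding sym3_def by (intro cpoly.span_base) blast
  then show "Y * (Y * Y) + l * Z \<in> parameter_space l L"
    unfolding parameter_space_def using \<open>Z \<in> L\<close> by (auto simp: mult.assoc)
qed

lemma lookup_cubic_quadric:
  "lookup (cubic_quadric a b c d s t varX varY varZ) (0,3,0) = a"
  "lookup (cubic_quadric a b c d s t varX varY varZ) (0,2,1) = b"
  "lookup (cubic_quadric a b c d s t varX varY varZ) (0,1,2) = c"
  "lookup (cubic_quadric a b c d s t varX varY varZ) (0,0,3) = d"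
  "lookup (cubic_quadric a b c d s t varX varY varZ) (1,1,0) = s"
  "lookup (cubic_quadric a b c d s t varX varY varZ) (1,0,1) = t"
  by (simp_all add: cubic_quadric_def lookup_simps)

lemma socle_poly_cubic_quadric:
  assumes "cubic_quadric a b c d s t varX varY varZ \<noteq> 0"
  shows "socle_poly (cubic_quadric a b c d s t varX varY varZ)"
proof -
  have "\<not> (a = 0 \<and> b = 0 \<and> c = 0 \<and> d = 0 \<and> s = 0 \<and> t = 0)"
    using assms by (auto simp: cubic_quadric_def)
  then have "\<exists>m\<in>low. lookup (cubic_quadric a b c d s t varX varY varZ) m \<noteq> 0"
    using lookup_cubic_quadric[of a b c d s t] by (simp add: low_def)
  then show ?thesis
    unfolding socle_poly_def by (simp add: cubic_quadric_def lookup_simps)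
qed

text \<open>One finite box of exponents serves all parameters, so the coordinates of
  \<open>v\<close> can be written as a sum over a fixed index set.\<close>

lemma keys_cubic_quadric:
  assumes X: "X \<in> homogeneous 1" and Y: "Y \<in> homogeneous 1" and Z: "Z \<in> homogeneous 1"
  shows "Poly_Mapping.keys (cubic_quadric a b c d s t X Y Z) \<subseteq> {..3} \<times> {..3} \<times> {..3}"
proof -
  have deg: "Poly_Mapping.keys p \<subseteq> {..3} \<times> {..3} \<times> {..3}" if "p \<in> homogeneous k" "k \<le> 3" for p k
    using that by (fastforce simp: homogeneous_def)
  have 2: "U * V \<in> homogeneous 2" if "U \<in> homogeneous 1" "V \<in> homogeneous 1" for U V
    using homogeneous_mult[OF that] by (simp add: numeral_2_eq_2)
  have 3: "U * V \<in> homogeneous 3" if "U \<in> homogeneous 1" "V \<in> homogeneous 2" for U V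
    using homogeneous_mult[OF that] by (simp add: numeral_3_eq_3)
  have A: "X * (const s * Y + const t * Z) \<in> homogeneous 2"
    by (intro 2 homogeneous_add homogeneous_const_mult X Y Z)
  have B: "const a * (Y * (Y * Y)) + const b * (Y * (Y * Z)) + const c * (Y * (Z * Z))
      + const d * (Z * (Z * Z)) \<in> homogeneous 3"
    by (intro homogeneous_add homogeneous_const_mult 3 2 Y Z)
  show ?thesis
    unfolding cubic_quadric_def
    by (rule order_trans[OF keys_add Un_least[OF deg[OF B] deg[OF A]]]) simp_all
qed

lemma polynomial_function_sum:
  assumes "finite S" "\<And>k. k \<in> S \<Longrightarrow> f k \<in> polynomial_functions"
  shows "(\<lambda>p. \<Sum>k\<in>S. f k p) \<in> polynomial_functions"
  using assms
  by (induction S rule: finite_induct)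
    (simp_all add: polynomial_functions.const polynomial_functions.add)

lemma polynomial_function_power:
  "f \<in> polynomial_functions \<Longrightarrow> (\<lambda>p. f p ^ n) \<in> polynomial_functions"
  by (induction n) (simp_all add: polynomial_functions.const polynomial_functions.mult)

text \<open>An algebra homomorphism is linear, so a coefficient of \<open>\<tau> p\<close> is a
  fixed linear combination of coefficients of \<open>p\<close>. Through this the adapted coordinates
  of \<open>v\<close> become polynomial functions of \<open>v\<close>.\<close>

lemma alg_hom_lookup:
  assumes \<tau>: "alg_hom \<tau>" and S: "finite S" "Poly_Mapping.keys p \<subseteq> S"
  shows "lookup (\<tau> p) m = (\<Sum>k\<in>S. lookup p k * lookup (\<tau> (Poly_Mapping.single k 1)) m)"
proof -
  have "p = (\<Sum>k\<in>Poly_Mapping.keys p. const (lookup p k) * Poly_Mapping.single k 1)"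
    by (simp flip: single_eq_const_mult add: sum_single_keys)
  also have "\<dots> = (\<Sum>k\<in>S. const (lookup p k) * Poly_Mapping.single k 1)"
    by (rule sum.mono_neutral_left) (use S in \<open>auto simp: in_keys_iff\<close>)
  finally have "\<tau> p = \<tau> (\<Sum>k\<in>S. const (lookup p k) * Poly_Mapping.single k 1)"
    by (rule arg_cong)
  also have "\<dots> = (\<Sum>k\<in>S. const (lookup p k) * \<tau> (Poly_Mapping.single k 1))"
    by (simp only: alg_homD(2,3,8)[OF \<tau>])
  finally have "\<tau> p = (\<Sum>k\<in>S. const (lookup p k) * \<tau> (Poly_Mapping.single k 1))" .
  then show ?thesis by (simp add: lookup_sum lookup_const_mult)
qed

theorem theorem3p1:
  fixes l :: "complex poly3" and L :: "complex poly3 set"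
  assumes "l \<in> homogeneous 1" and "l \<noteq> 0"
    and "L \<subseteq> homogeneous 1" and "cpoly.subspace L" and "cpoly.dim L = 2"
    and "homogeneous 1 = {a + b | a b. a \<in> cpoly.span {l} \<and> b \<in> L}"
    and "cpoly.span {l} \<inter> L = {0}"
  shows "(\<forall>v \<in> parameter_space l L - {0}. has_dimension (quot_module (square_ideal l v)) 12) \<and>
    (\<exists>U. zariski_open_in (parameter_space l L - {0}) U \<and> U \<noteq> {} \<and>
      (\<forall>v \<in> U. has_dimension (hilb_tangent_space 12 (square_ideal l v)) 45))"
proof -
  obtain Y Z \<sigma> \<tau> where L: "L = {const b * Y + const c * Z |b c. True}" and iso: "alg_iso \<sigma> \<tau>"
    and \<sigma>_var: "\<sigma> varX = l" "\<sigma> varY = Y" "\<sigma> varZ = Z" and m: "max_ideal = rmod.span {l, Y, Z}"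
    by (rule linear_coordinates[OF assms])
  have \<sigma>: "alg_hom \<sigma>" and \<tau>: "alg_hom \<tau>" using iso by (simp_all add: alg_iso_def)
  have "const 1 * Y + const 0 * Z \<in> L" "const 0 * Y + const 1 * Z \<in> L" unfolding L by blast+
  then have YZ: "Y \<in> homogeneous 1" "Z \<in> homogeneous 1" using assms(3) by auto
  let ?P = "parameter_space l L - {0}"
  let ?w = "\<lambda>a b c d s t. cubic_quadric a b c d s t varX varY varZ"
  have P: "\<exists>a b c d s t. v = \<sigma> (?w a b c d s t)" if "v \<in> parameter_space l L" for v
    using parameter_space_cubic_quadric(1)[OF L that] by (simp add: cubic_quadric_hom[OF \<sigma>] \<sigma>_var)
  have ideal: "square_ideal l (\<sigma> w) = \<sigma> ` rmod.span (insert w (generators varX varY varZ))" for w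
    using square_ideal_eq[OF m, of l "\<sigma> w"]
    by (simp add: image_span[OF iso] image_generators[OF \<sigma>] \<sigma>_var rmod.span_zero)
  have basis: "\<exists>\<mu>\<in>low. quot_basis (square_ideal l v) (low - {\<mu>}) (\<lambda>m. \<sigma> (Poly_Mapping.single m 1))"
    if v: "v \<in> ?P" for v
  proof -
    obtain a b c d s t where w: "v = \<sigma> (?w a b c d s t)" using P v by blast
    with v have "?w a b c d s t \<noteq> 0" using alg_homD(4)[OF \<sigma>] by auto
    then have soc: "socle_poly (?w a b c d s t)" by (rule socle_poly_cubic_quadric)
    then obtain \<mu> where \<mu>: "\<mu> \<in> low" "lookup (?w a b c d s t) \<mu> \<noteq> 0"
      unfolding socle_poly_def by blast
    from quot_basis_image[OF iso quot_basis_line_ideal[OF \<mu>]] \<mu>(1) show ?thesis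
      unfolding w ideal span_insert_generators[OF soc] by blast
  qed
  have sub: "rmod.subspace (square_ideal l v)" if "v \<in> ?P" for v
  proof -
    have "v = \<sigma> (\<tau> v)" using iso by (simp add: alg_iso_def)
    then show ?thesis using ideal[of "\<tau> v"] by (metis subspace_image[OF iso rmod.subspace_span])
  qed
  have card: "card (low - {\<mu>}) = 12" if "\<mu> \<in> low" for \<mu>
    using that by (simp add: card_low finite_low)
  have part1: "has_dimension (quot_module (square_ideal l v)) 12" if v: "v \<in> ?P" for v
  proof -
    obtain \<mu> where \<mu>: "\<mu> \<in> low"
      "quot_basis (square_ideal l v) (low - {\<mu>}) (\<lambda>m. \<sigma> (Poly_Mapping.single m 1))"
      using basis[OF v] by blast
    from free_of_rank_imp_has_dimension[OF free_of_rank_quot_moduleI[OF sub[OF v] \<mu>(2)]]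
    show ?thesis by (simp only: card[OF \<mu>(1)])
  qed
  define S :: "(nat \<times> nat \<times> nat) set" where "S = {..3} \<times> {..3} \<times> {..3}"
  \<comment> \<open>On the parameter space this is the coefficient at \<open>m\<close> of
    \<open>\<tau> v\<close>, that is, one of the adapted coordinates \<open>a, b, c, d, s, t\<close>
    when \<open>m\<close> is the matching exponent.\<close>
  define g where "g m v = (\<Sum>k\<in>S. lookup v k * lookup (\<tau> (Poly_Mapping.single k 1)) m)"
    for m and v :: "complex poly3"
  have finS: "finite S" by (simp add: S_def)
  have g_poly: "g m \<in> polynomial_functions" for m
    unfolding g_def[abs_def]
    by (intro polynomial_function_sum finS polynomial_functions.intros)
  have g_eq: "g m (\<sigma> (?w a b c d s t)) = lookup (?w a b c d s t) m" for m a b c d s t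
  proof -
    have "Poly_Mapping.keys (\<sigma> (?w a b c d s t)) \<subseteq> S"
      unfolding cubic_quadric_hom[OF \<sigma>] \<sigma>_var S_def by (intro keys_cubic_quadric assms(1) YZ)
    from alg_hom_lookup[OF \<tau> finS this, of m] show ?thesis
      using iso by (simp add: g_def alg_iso_def)
  qed
  \<comment> \<open>This is \<open>t\<close> times the cubic at \<open>(t, -s)\<close>, the zero of
    the linear form \<open>s y + t z\<close>; the second factor is \<open>t^3 * \<Lambda>\<close>
    with denominators cleared. Differences are written with the constant \<open>-1\<close> to fit
    the rules of \<open>polynomial_functions\<close>.\<close>
  define F where "F v = g (1,0,1) v * (g (0,3,0) v * g (1,0,1) v ^ 3
    + (- 1) * (g (0,2,1) v * (g (1,0,1) v ^ 2 * g (1,1,0) v))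
    + g (0,1,2) v * (g (1,0,1) v * g (1,1,0) v ^ 2) + (- 1) * (g (0,0,3) v * g (1,1,0) v ^ 3))" for v
  have F_poly: "F \<in> polynomial_functions"
    unfolding F_def[abs_def]
    by (intro polynomial_functions.add polynomial_functions.mult polynomial_function_power
        polynomial_functions.const g_poly)
  define U where "U = {v \<in> ?P. \<exists>f\<in>{F}. f v \<noteq> 0}"
  have "zariski_open_in ?P U"
    unfolding zariski_open_in_def U_def using F_poly by blast
  moreover have "U \<noteq> {}"
  proof -
    \<comment> \<open>The cubic \<open>Y^3\<close> and the linear form \<open>Z\<close> have no
      common factor; here \<open>a = t = 1\<close>, the other coordinates vanish, and
      \<open>F\<close> equals 1.\<close>
    let ?v = "Y * (Y * Y) + l * Z"
    have v: "?v = \<sigma> (?w 1 0 0 0 0 1)"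
      unfolding cubic_quadric_hom[OF \<sigma>] \<sigma>_var by (simp add: cubic_quadric_def)
    have "F ?v \<noteq> 0" unfolding F_def v g_eq lookup_cubic_quadric by simp
    moreover have "?v \<noteq> 0"
    proof
      assume "?v = 0"
      then have "\<tau> (\<sigma> (?w 1 0 0 0 0 1)) = 0" using alg_homD(4)[OF \<tau>] by (simp add: v)
      then show False
        using iso lookup_cubic_quadric(1)[of 1 0 0 0 0 1] by (simp add: alg_iso_def)
    qed
    ultimately show ?thesis
      using parameter_space_cubic_quadric(2)[OF L, of l] unfolding U_def by blast
  qed
  moreover have "has_dimension (hilb_tangent_space 12 (square_ideal l v)) 45" if "v \<in> U" for v
  proof -
    from that have v: "v \<in> ?P" and Fv: "F v \<noteq> 0" by (auto simp: U_def)
    obtain a b c d s t where w: "v = \<sigma> (?w a b c d s t)" using P v by blast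
    have "t * (a * t ^ 3 - b * (t ^ 2 * s) + c * (t * s ^ 2) - d * s ^ 3) \<noteq> 0"
      using Fv unfolding w F_def g_eq lookup_cubic_quadric by simp
    then have t: "t \<noteq> 0" and disc: "a * t ^ 3 - b * (t ^ 2 * s) + c * (t * s ^ 2) - d * s ^ 3 \<noteq> 0" by simp_all
    have "a - b * (s / t) + c * (s / t) ^ 2 - d * (s / t) ^ 3
        = (a * t ^ 3 - b * (t ^ 2 * s) + c * (t * s ^ 2) - d * s ^ 3) / t ^ 3"
      using t by (simp add: field_simps power2_eq_square power3_eq_cube)
    with t disc have "a - b * (s / t) + c * (s / t) ^ 2 - d * (s / t) ^ 3 \<noteq> 0" by simp
    from normal_form[OF t this] obtain \<sigma>' \<tau>' where iso': "alg_iso \<sigma>' \<tau>'" and v0: "\<sigma>' v0 = ?w a b c d s t"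
      and m': "max_ideal = rmod.span {\<sigma>' varX, \<sigma>' varY, \<sigma>' varZ}"
      and X': "\<sigma>' varX - varX \<in> rmod.span {\<sigma>' varY * \<sigma>' varY, \<sigma>' varY * \<sigma>' varZ, \<sigma>' varZ * \<sigma>' varZ}"
      by blast
    have \<sigma>': "alg_hom \<sigma>'" using iso' by (simp add: alg_iso_def)
    \<comment> \<open>The same ideal is computed twice by \<open>square_ideal_eq\<close>, with
      \<open>X = x\<close> and with \<open>X = \<sigma>' x\<close>. The second description is the
      image of \<open>I0\<close>.\<close>
    have "rmod.span (insert (?w a b c d s t) (generators varX varY varZ)) = square_ideal varX (?w a b c d s t)"
      by (rule square_ideal_eq[symmetric]) (simp_all add: max_ideal_eq rmod.span_zero)
    also have "\<dots> = rmod.span (insert (?w a b c d s t) (generators (\<sigma>' varX) (\<sigma>' varY) (\<sigma>' varZ)))"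
      by (rule square_ideal_eq[OF m' X'])
    also have "\<dots> = \<sigma>' ` I0"
      unfolding I0_eq_span image_span[OF iso'] image_insert image_generators[OF \<sigma>'] v0 ..
    finally have I: "square_ideal l v = \<sigma> ` \<sigma>' ` I0" unfolding w ideal by simp
    obtain \<mu> where \<mu>: "\<mu> \<in> low"
      "quot_basis (square_ideal l v) (low - {\<mu>}) (\<lambda>m. \<sigma> (Poly_Mapping.single m 1))"
      using basis[OF v] by blast
    from hom_basis_image[OF iso hom_basis_image[OF iso' hom_basis_I0]]
    have "has_dimension (hilb_tangent_space (card (low - {\<mu>})) (square_ideal l v)) (card hom_index)"
      unfolding I[symmetric] by (rule has_dimension_hilb_tangent_space[OF sub[OF v] \<mu>(2)])
    then show ?thesis by (simp only: card[OF \<mu>(1)] card_hom_index)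
  qed
  ultimately show ?thesis using part1 by blast
qed

end
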